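(* Assume (A1)–(A3) and (B1). Let $\mathbf{w}_M\in\mathbb{R}^d$ be random vectors with $\mathbf{w}_M\to\mathbf{w}=(w_1,\dots,w_d)$ $P_x$-almost surely for every $x\in\mathsf{X}$, where $w_i\neq0$ for all $i$. Let $\boldsymbol\delta=(\delta_1,\dots,\delta_d)$ satisfy $0<\delta_i\le\Delta(F_{g_i})$ for all $i$. Then for all $1\le i,j\le d$ and every $x\in\mathsf{X}$, $P_x$-almost surely as $M\to\infty$: (1) $\sum_{k\in\mathbb{Z}}\{\hat\gamma^{(\boldsymbol\delta)}_{M,ij}(k;\mathbf{w}_M)-\gamma_{g_i,g_j}(k)\}^2\to0$; (2) $\big|\sum_{k\in\mathbb{Z}}\hat\gamma^{(\boldsymbol\delta)}_{M,ij}(k;\mathbf{w}_M)-\sum_{k\in\mathbb{Z}}\gamma_{g_i,g_j}(k)\big|\to0$.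
   Context: Let $(\mathsf{X},\mathscr{X})$ be a complete separable metric space with Borel $\sigma$-algebra, $\pi$ a probability measure, $Q$ a Markov kernel, $X=(X_0,X_1,\dots)$ a Markov chain with kernel $Q$, and $P_x$ the law of the chain started at $X_0=x$. (A1): $X$ is $\psi$-irreducible, aperiodic and positive Harris recurrent. (A2): $Q$ is $\pi$-reversible. (A3): there exist $\rho<1$ and a nonnegative function $M(\cdot)$ with $\|Q^n(x,\cdot)-\pi\|_{TV}\le M(x)\rho^n$ for all $x,n$. $g=(g_1,\dots,g_d)$ satisfies (B1): $\int g_j^2d\pi<\infty$. For real $f_1,f_2\in L^2(\pi)$: $\gamma_{f_1f_2}(k)=\mathrm{Cov}_\pi(f_1(X_0),f_2(X_k))$ for $k\ge0$, $\mathrm{Cov}_\pi(f_1(X_{|k|}),f_2(X_0))$ for $k<0$ (stationary chain); $\gamma_f=\gamma_{ff}$, $\gamma_{g_i,g_j}=\gamma_{g_ig_j}$. $F_f$ is the unique positive measure on $[-1,1]$ with $\gamma_f(k)=\int\alpha^{|k|}F_f(d\alpha)$ (convention $0^0=1$); $\Delta(F)=1-\max\{|x|:x\in\mathrm{Supp}F\}$. $\mathscr{M}_\infty(b)$ is the set of sequences $m(k)=\int x^{|k|}\mu(dx)$, $k\in\mathbb{Z}$, with $\mu$ a positive measure on $[-b,b]$; for $r\in\ell_2(\mathbb{Z})$, $\Pi_\delta(r)=\arg\min_{m\in\mathscr{M}_\infty(1-\delta)}\sum_k(r(k)-m(k))^2$. For a real function $f$ (possibly depending on random coefficients), $r_{M,f}(k)=\frac1M\sum_{t=0}^{M-1-|k|}(f(X_t)-\bar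 f_M)(f(X_{t+|k|})-\bar f_M)$ for $|k|<M$ and $0$ otherwise, $\bar f_M=\frac1M\sum_{t=0}^{M-1}f(X_t)$. The estimator: with $\delta_{ij}=\min\{\delta_i,\delta_j\}$, $\hat\gamma^{(\boldsymbol\delta)}_{M,ii}(\cdot;\mathbf{w}_M)=\Pi_{\delta_i}(r_{M,g_i})$; for $i<j$ (and whenever $w_{Mi}w_{Mj}\ne0$) $\hat\gamma^{(\boldsymbol\delta)}_{M,ij}(\cdot;\mathbf{w}_M)=\frac{1}{4w_{Mi}w_{Mj}}\{\Pi_{\delta_{ij}}(r_{M,w_{Mi}g_i+w_{Mj}g_j})-\Pi_{\delta_{ij}}(r_{M,w_{Mi}g_i-w_{Mj}g_j})\}$; for $i>j$, $\hat\gamma^{(\boldsymbol\delta)}_{M,ij}=\hat\gamma^{(\boldsymbol\delta)}_{M,ji}$. *)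

theory Defs
  imports "HOL-Probability.Probability"
begin

definition markov_kernel :: "('a::topological_space \<Rightarrow> 'a measure) \<Rightarrow> bool" where
  "markov_kernel Q \<longleftrightarrow> Q \<in> measurable borel (prob_algebra borel)"

fun kernel_pow :: "('a::topological_space \<Rightarrow> 'a measure) \<Rightarrow> nat \<Rightarrow> 'a \<Rightarrow> 'a measure" where
  "kernel_pow Q 0 x = return borel x"
| "kernel_pow Q (Suc n) x = bind (kernel_pow Q n x) Q"

text \<open>Finite-dimensional probabilities of the chain:
  fdd Q A m k y = P_y(X_0 in A k, X_1 in A (k+1), ..., X_m in A (k+m)).\<close>
fun fdd :: "('a::topological_space \<Rightarrow> 'a measure) \<Rightarrow> (nat \<Rightarrow> 'a set) \<Rightarrow> nat \<Rightarrow> nat \<Rightarrow> 'a \<Rightarrow> real" where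
  "fdd Q A 0 k y = indicator (A k) y"
| "fdd Q A (Suc m) k y = indicator (A k) y * (\<integral>z. fdd Q A m (Suc k) z \<partial>(Q y))"

definition markov_chain_law ::
  "('a::topological_space \<Rightarrow> 'a measure) \<Rightarrow> ('a \<Rightarrow> 'b measure) \<Rightarrow> (nat \<Rightarrow> 'b \<Rightarrow> 'a) \<Rightarrow> bool" where
  "markov_chain_law Q Px X \<longleftrightarrow>
     (\<forall>x. prob_space (Px x)) \<and>
     (\<forall>x t. X t \<in> measurable (Px x) borel) \<and>
     (\<forall>x n A. (\<forall>k. A k \<in> sets borel) \<longrightarrow>
        measure (Px x) {\<omega> \<in> space (Px x). \<forall>k\<le>n. X k \<omega> \<in> A k} = fdd Q A n 0 x)"

definition irred_measure :: "('a::topological_space \<Rightarrow> 'a measure) \<Rightarrow> 'a measure \<Rightarrow> bool" where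
  "irred_measure Q \<phi> \<longleftrightarrow> sets \<phi> = sets borel \<and> sigma_finite_measure \<phi> \<and> emeasure \<phi> UNIV > 0 \<and>
     (\<forall>A \<in> sets borel. emeasure \<phi> A > 0 \<longrightarrow> (\<forall>x. \<exists>n\<ge>1. measure (kernel_pow Q n x) A > 0))"

definition max_irred_measure :: "('a::topological_space \<Rightarrow> 'a measure) \<Rightarrow> 'a measure \<Rightarrow> bool" where
  "max_irred_measure Q \<psi> \<longleftrightarrow> irred_measure Q \<psi> \<and> (\<forall>\<phi>. irred_measure Q \<phi> \<longrightarrow> absolutely_continuous \<psi> \<phi>)"

definition psi_irreducible :: "('a::topological_space \<Rightarrow> 'a measure) \<Rightarrow> bool" where
  "psi_irreducible Q \<longleftrightarrow> (\<exists>\<psi>. max_irred_measure Q \<psi>)"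

definition d_cycle :: "('a::topological_space \<Rightarrow> 'a measure) \<Rightarrow> 'a measure \<Rightarrow> nat \<Rightarrow> (nat \<Rightarrow> 'a set) \<Rightarrow> bool" where
  "d_cycle Q \<psi> d D \<longleftrightarrow> (\<forall>i<d. D i \<in> sets borel) \<and> disjoint_family_on D {..<d} \<and>
     (\<forall>i<d. \<forall>x \<in> D i. measure (Q x) (D (Suc i mod d)) = 1) \<and>
     emeasure \<psi> (UNIV - (\<Union>i<d. D i)) = 0"

definition aperiodic :: "('a::topological_space \<Rightarrow> 'a measure) \<Rightarrow> bool" where
  "aperiodic Q \<longleftrightarrow> (\<exists>\<psi>. max_irred_measure Q \<psi> \<and> \<not> (\<exists>d\<ge>2. \<exists>D. d_cycle Q \<psi> d D))"

definition harris_recurrent ::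
  "('a::topological_space \<Rightarrow> 'a measure) \<Rightarrow> ('a \<Rightarrow> 'b measure) \<Rightarrow> (nat \<Rightarrow> 'b \<Rightarrow> 'a) \<Rightarrow> bool" where
  "harris_recurrent Q Px X \<longleftrightarrow> (\<exists>\<psi>. max_irred_measure Q \<psi> \<and>
     (\<forall>A \<in> sets borel. emeasure \<psi> A > 0 \<longrightarrow> (\<forall>x. AE \<omega> in Px x. \<exists>\<^sub>\<infinity>n. X n \<omega> \<in> A)))"

definition invariant_prob :: "('a::topological_space \<Rightarrow> 'a measure) \<Rightarrow> 'a measure \<Rightarrow> bool" where
  "invariant_prob Q \<mu> \<longleftrightarrow> prob_space \<mu> \<and> sets \<mu> = sets borel \<and>
     (\<forall>A \<in> sets borel. emeasure \<mu> A = (\<integral>\<^sup>+x. emeasure (Q x) A \<partial>\<mu>))"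

definition positive_harris ::
  "('a::topological_space \<Rightarrow> 'a measure) \<Rightarrow> ('a \<Rightarrow> 'b measure) \<Rightarrow> (nat \<Rightarrow> 'b \<Rightarrow> 'a) \<Rightarrow> bool" where
  "positive_harris Q Px X \<longleftrightarrow> harris_recurrent Q Px X \<and> (\<exists>\<mu>. invariant_prob Q \<mu>)"

definition reversible :: "('a::topological_space \<Rightarrow> 'a measure) \<Rightarrow> 'a measure \<Rightarrow> bool" where
  "reversible Q \<pi> \<longleftrightarrow> (\<forall>A \<in> sets borel. \<forall>B \<in> sets borel.
     (\<integral>\<^sup>+x. indicator A x * emeasure (Q x) B \<partial>\<pi>) = (\<integral>\<^sup>+x. indicator B x * emeasure (Q x) A \<partial>\<pi>))"

definition tv_dist :: "'a::topological_space measure \<Rightarrow> 'a measure \<Rightarrow> real" where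
  "tv_dist \<mu> \<nu> = (SUP A \<in> sets borel. \<bar>measure \<mu> A - measure \<nu> A\<bar>)"

text \<open>Cov_pi(f(X_0), h(X_n)) for the chain with X_0 ~ pi.\<close>
definition cov_lag :: "'a::topological_space measure \<Rightarrow> ('a \<Rightarrow> 'a measure) \<Rightarrow> ('a \<Rightarrow> real) \<Rightarrow> ('a \<Rightarrow> real) \<Rightarrow> nat \<Rightarrow> real" where
  "cov_lag \<pi> Q f h n =
     (\<integral>x. f x * (\<integral>y. h y \<partial>(kernel_pow Q n x)) \<partial>\<pi>)
     - (\<integral>x. f x \<partial>\<pi>) * (\<integral>x. (\<integral>y. h y \<partial>(kernel_pow Q n x)) \<partial>\<pi>)"

definition acov :: "'a::topological_space measure \<Rightarrow> ('a \<Rightarrow> 'a measure) \<Rightarrow> ('a \<Rightarrow> real) \<Rightarrow> ('a \<Rightarrow> real) \<Rightarrow> int \<Rightarrow> real" where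
  "acov \<pi> Q f1 f2 k = (if k \<ge> 0 then cov_lag \<pi> Q f1 f2 (nat k) else cov_lag \<pi> Q f2 f1 (nat (- k)))"

definition spectral_rep :: "(int \<Rightarrow> real) \<Rightarrow> real measure \<Rightarrow> bool" where
  "spectral_rep \<gamma> F \<longleftrightarrow> sets F = sets borel \<and> finite_measure F \<and> emeasure F (- {-1..1}) = 0 \<and>
     (\<forall>k. \<gamma> k = (\<integral>\<alpha>. \<alpha> ^ nat \<bar>k\<bar> \<partial>F))"

definition spectral_measure :: "(int \<Rightarrow> real) \<Rightarrow> real measure" where
  "spectral_measure \<gamma> = (THE F. spectral_rep \<gamma> F)"

definition msupport :: "real measure \<Rightarrow> real set" where
  "msupport F = {x. \<forall>e>0. emeasure F (ball x e) > 0}"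

definition spec_gap :: "real measure \<Rightarrow> real" where
  "spec_gap F = (if msupport F = {} then 1 else 1 - Sup (abs ` msupport F))"

definition moment_seqs :: "real \<Rightarrow> (int \<Rightarrow> real) set" where
  "moment_seqs b = {m. \<exists>\<mu>. sets \<mu> = sets borel \<and> finite_measure \<mu> \<and> emeasure \<mu> (- {-b..b}) = 0 \<and>
                        (\<forall>k. m k = (\<integral>x. x ^ nat \<bar>k\<bar> \<partial>\<mu>))}"

definition sqdist :: "(int \<Rightarrow> real) \<Rightarrow> (int \<Rightarrow> real) \<Rightarrow> ennreal" where
  "sqdist r m = (\<integral>\<^sup>+k. ennreal ((r k - m k)\<^sup>2) \<partial>count_space UNIV)"

definition proj :: "real \<Rightarrow> (int \<Rightarrow> real) \<Rightarrow> (int \<Rightarrow> real)" where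
  "proj \<delta> r = (THE m. m \<in> moment_seqs (1 - \<delta>) \<and> (\<forall>m' \<in> moment_seqs (1 - \<delta>). sqdist r m \<le> sqdist r m'))"

definition sample_acov :: "nat \<Rightarrow> (nat \<Rightarrow> real) \<Rightarrow> int \<Rightarrow> real" where
  "sample_acov M y k =
     (let ybar = (\<Sum>t<M. y t) / real M; h = nat \<bar>k\<bar> in
      if h < M then (\<Sum>t < M - h. (y t - ybar) * (y (t + h) - ybar)) / real M else 0)"

text \<open>hat gamma^{(delta)}_{M,ij}(.; w) computed from the path xs (xs t = X_t); indices i, j in 1..d.
  Convention: when w_i w_j = 0 (i \<noteq> j) the estimator is set to 0 (undefined in the paper).\<close>
definition hat_gamma ::
  "(nat \<Rightarrow> real) \<Rightarrow> (nat \<Rightarrow> 'a \<Rightarrow> real) \<Rightarrow> nat \<Rightarrow> (nat \<Rightarrow> real) \<Rightarrow> (nat \<Rightarrow> 'a) \<Rightarrow> nat \<Rightarrow> nat \<Rightarrow> int \<Rightarrow> real" where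
  "hat_gamma \<delta> g M w xs i j =
     (if i = j then proj (\<delta> i) (sample_acov M (\<lambda>t. g i (xs t)))
      else (let a = min i j; b = max i j; dl = min (\<delta> a) (\<delta> b) in
        if w a * w b \<noteq> 0 then
          (\<lambda>k. (proj dl (sample_acov M (\<lambda>t. w a * g a (xs t) + w b * g b (xs t))) k
                - proj dl (sample_acov M (\<lambda>t. w a * g a (xs t) - w b * g b (xs t))) k) / (4 * w a * w b))
        else (\<lambda>k. 0)))"

end

theory Submission
  imports Defs "HOL-Real_Asymp.Real_Asymp" "HOL-Computational_Algebra.Polynomial"
begin

text \<open>
  For \<open>\<gamma>\<close> in the cone of moment sequences of measures on \<open>[-b, b]\<close>, \<open>b = 1 - \<delta> < 1\<close>, the variational
  inequality of the projection gives, up to a constant factor, \<open>\<parallel>\<Pi> r - \<gamma>\<parallel>\<^sup>2 \<le> \<Sum>\<^sub>k \<bar>\<Pi> r k - \<gamma> k\<bar> \<bar>r k - \<gamma> k\<bar>\<close>,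
  and \<open>\<bar>\<Pi> r k - \<gamma> k\<bar> \<le> b\<^bsup>\<bar>k\<bar>\<^esup> (\<Pi> r 0 + \<gamma> 0)\<close>.  Hence pointwise convergence of the bounded sequences
  \<open>r\<close> already implies \<open>\<ell>\<^sub>1\<close> convergence of the projections, although the sample autocovariances do not converge
  in \<open>\<ell>\<^sub>2\<close>.  Pointwise convergence from every starting point is an ergodic theorem: total variation
  convergence makes bounded harmonic functions constant, so shift-invariant events have probability 0 or 1,
  the same for every starting point.

  By reversibility the autocovariance \<open>\<gamma> k = \<langle>f, Q\<^sup>k f\<rangle>\<close> comes from a self-adjoint contraction.  This gives
  the Hankel form inequalities which characterise moment sequences on \<open>[-1, 1]\<close> (Hausdorff) and which, being
  linear and closed, also show that the cone is convex and closed.  The cross terms follow by polarisation,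
  since the autocovariances of a combination of \<open>g\<^sub>i\<close> and \<open>g\<^sub>j\<close> inherit the slower of the two decay rates.
\<close>

section \<open>Reversible kernels as self-adjoint operators\<close>

text \<open>Both \<open>spectral_measure\<close> and \<open>proj\<close> are definite descriptions:
  the hypothesis on the spectral gap and the estimator itself say nothing until existence and
  uniqueness are settled. For the spectral measure it is enough that the linear functional belonging
  to \<gamma> is nonnegative on the polynomials \<open>(1 + x)^a (1 - x)^b\<close>, which follows
  from the contraction bound. For the projection the cone is handled through its inequalities
  instead of through measures, so that minimising sequences need no compactness argument.

  In the l1 estimate, the bound on the projection contains the unknown value of the projection at
  lag 0. That value is in turn controlled by the squared distance, and a quadratic inequality closes
  the circle.

  The weights vary with the sample size and with the path, so the ergodic theorem cannot be applied
  to the combined functions. It is applied only to fixed products of one \<open>g i\<close> at time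
  \<open>t\<close> with one \<open>g j\<close> at time \<open>t + h\<close>, and to the means; what
  follows is deterministic along a single path.\<close>

locale transition_kernel =
  fixes Q :: "'a::polish_space \<Rightarrow> 'a measure"
  assumes kernel: "markov_kernel Q"
begin

lemma Q_measurable[measurable]: "Q \<in> measurable borel (prob_algebra borel)"
  using kernel by (simp add: markov_kernel_def)

lemma Q_measurable_subprob[measurable]: "Q \<in> measurable borel (subprob_algebra borel)"
  by (rule measurable_prob_algebraD) simp

lemma Q_in_prob_algebra: "Q x \<in> space (prob_algebra borel)"
  using measurable_space[OF Q_measurable, of x] by simp

lemma prob_space_Q: "prob_space (Q x)" and sets_Q[simp, measurable_cong]: "sets (Q x) = sets borel"
  using Q_in_prob_algebra[of x] by (auto simp: space_prob_algebra)

lemma space_Q[simp]: "space (Q x) = UNIV"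
  using sets_eq_imp_space_eq[OF sets_Q] by simp

lemma kernel_pow_measurable[measurable]: "kernel_pow Q n \<in> measurable borel (prob_algebra borel)"
proof (induction n)
  case 0 
  have "return borel \<in> measurable borel (prob_algebra borel)" by (rule measurable_return_prob_space)
  then show ?case by (simp cong: measurable_cong)
next
  case (Suc n)
  have "(\<lambda>x. bind (kernel_pow Q n x) Q) \<in> measurable borel (prob_algebra borel)"
    by (rule measurable_bind_prob_space[OF Suc Q_measurable])
  then show ?case by (simp cong: measurable_cong)
qed

lemma kernel_pow_measurable_subprob[measurable]: "kernel_pow Q n \<in> measurable borel (subprob_algebra borel)"
  by (rule measurable_prob_algebraD) simp

lemma kernel_pow_in_prob_algebra: "kernel_pow Q n x \<in> space (prob_algebra borel)"
  using measurable_space[OF kernel_pow_measurable, of x] by simp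

lemma prob_space_kernel_pow: "prob_space (kernel_pow Q n x)"
  and sets_kernel_pow[simp, measurable_cong]: "sets (kernel_pow Q n x) = sets borel"
  using kernel_pow_in_prob_algebra[of n x] by (auto simp: space_prob_algebra)

lemma space_kernel_pow[simp]: "space (kernel_pow Q n x) = UNIV"
  using sets_eq_imp_space_eq[OF sets_kernel_pow] by simp

end

text \<open>Fubini for functions that are merely integrable, so that the inner integrals make sense
  only for almost every \<open>x\<close>. For a nonnegative function, finiteness of the iterated
  integral forces almost all inner ones to be finite; a general function is the difference of its
  two parts. Boundedness would be too much to ask, the functions \<open>g i\<close> being only
  square integrable.\<close>

lemma
  fixes f :: "'b \<Rightarrow> real"
  assumes N[measurable]: "N \<in> measurable M (subprob_algebra B)" and f[measurable]: "f \<in> borel_measurable B"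
    and int: "integrable (bind M N) f" and ne: "space M \<noteq> {}"
  shows AE_integrable_bind: "AE x in M. integrable (N x) f"
    and integrable_integral_bind: "integrable M (\<lambda>x. \<integral>y. f y \<partial>N x)"
    and integral_bind_integrable: "(\<integral>y. f y \<partial>bind M N) = (\<integral>x. (\<integral>y. f y \<partial>N x) \<partial>M)"
proof -
  have sets_N: "x \<in> space M \<Longrightarrow> sets (N x) = sets B" for x using N by (rule sets_kernel)
  have sb: "sets (bind M N) = sets B" using sets_N ne by (rule sets_bind)
  have meas: "h \<in> borel_measurable (N x)" if "h \<in> borel_measurable B" "x \<in> space M" for h :: "'b \<Rightarrow> real" and x
    using that sets_N by (simp cong: measurable_cong_sets)
  have nonneg: "(AE x in M. integrable (N x) h) \<and> integrable M (\<lambda>x. \<integral>y. h y \<partial>N x) \<and>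
      (\<integral>y. h y \<partial>bind M N) = (\<integral>x. (\<integral>y. h y \<partial>N x) \<partial>M)"
    if h[measurable]: "h \<in> borel_measurable B" and ih: "integrable (bind M N) h" and h0: "\<And>y. 0 \<le> h y" for h :: "'b \<Rightarrow> real"
  proof -
    have eq: "(\<integral>\<^sup>+y. ennreal (h y) \<partial>bind M N) = (\<integral>\<^sup>+x. (\<integral>\<^sup>+y. ennreal (h y) \<partial>N x) \<partial>M)"
      by (rule nn_integral_bind[OF _ N]) measurable
    have fin: "(\<integral>\<^sup>+y. ennreal (h y) \<partial>bind M N) = ennreal (\<integral>y. h y \<partial>bind M N)"
      using ih h0 by (intro nn_integral_eq_integral) auto
    have "(\<lambda>x. \<integral>\<^sup>+y. ennreal (h y) \<partial>N x) \<in> borel_measurable M"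
      by (rule measurable_compose[OF N nn_integral_measurable_subprob_algebra]) simp
    then have "AE x in M. (\<integral>\<^sup>+y. ennreal (h y) \<partial>N x) \<noteq> \<infinity>"
      using fin eq by (intro nn_integral_PInf_AE) auto
    then have AE: "AE x in M. integrable (N x) h"
      using AE_space
    proof eventually_elim
      case (elim x)
      then show ?case using h0 meas[OF h] by (intro integrableI_nonneg) (auto simp: less_top)
    qed
    then have "AE x in M. (\<integral>\<^sup>+y. ennreal (h y) \<partial>N x) = ennreal (\<integral>y. h y \<partial>N x)"
      by eventually_elim (use h0 in \<open>auto intro!: nn_integral_eq_integral\<close>)
    then have eq2: "(\<integral>\<^sup>+x. (\<integral>\<^sup>+y. ennreal (h y) \<partial>N x) \<partial>M) = (\<integral>\<^sup>+x. ennreal (\<integral>y. h y \<partial>N x) \<partial>M)"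
      by (rule nn_integral_cong_AE)
    have m: "(\<lambda>x. \<integral>y. h y \<partial>N x) \<in> borel_measurable M"
      by (rule measurable_compose[OF N integral_measurable_subprob_algebra]) simp
    have fin2: "(\<integral>\<^sup>+x. ennreal (\<integral>y. h y \<partial>N x) \<partial>M) = ennreal (\<integral>y. h y \<partial>bind M N)"
      by (simp only: eq2[symmetric] eq[symmetric] fin)
    have "integrable M (\<lambda>x. \<integral>y. h y \<partial>N x)"
      using m h0 fin2 by (intro integrableI_nonneg) auto
    moreover have "(\<integral>y. h y \<partial>bind M N) = (\<integral>x. (\<integral>y. h y \<partial>N x) \<partial>M)"
      using m h0 fin2 by (simp add: integral_eq_nn_integral[of "\<lambda>x. \<integral>y. h y \<partial>N x"] integral_nonneg) 
    ultimately show ?thesis using AE by blast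
  qed
  let ?p = "\<lambda>y. max 0 (f y)" and ?n = "\<lambda>y. max 0 (- f y)"
  have pn: "f y = ?p y - ?n y" for y by auto
  have p: "(AE x in M. integrable (N x) ?p) \<and> integrable M (\<lambda>x. \<integral>y. ?p y \<partial>N x) \<and>
      (\<integral>y. ?p y \<partial>bind M N) = (\<integral>x. (\<integral>y. ?p y \<partial>N x) \<partial>M)"
    using int by (intro nonneg) auto
  have n: "(AE x in M. integrable (N x) ?n) \<and> integrable M (\<lambda>x. \<integral>y. ?n y \<partial>N x) \<and>
      (\<integral>y. ?n y \<partial>bind M N) = (\<integral>x. (\<integral>y. ?n y \<partial>N x) \<partial>M)"
    using int by (intro nonneg) auto
  have AE: "AE x in M. integrable (N x) f \<and> (\<integral>y. f y \<partial>N x) = (\<integral>y. ?p y \<partial>N x) - (\<integral>y. ?n y \<partial>N x)"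
    using conjunct1[OF p] conjunct1[OF n]
  proof eventually_elim
    case (elim x)
    have "integrable (N x) (\<lambda>y. ?p y - ?n y)" using elim by (rule Bochner_Integration.integrable_diff)
    moreover have "(\<integral>y. ?p y - ?n y \<partial>N x) = (\<integral>y. ?p y \<partial>N x) - (\<integral>y. ?n y \<partial>N x)"
      using elim by (rule Bochner_Integration.integral_diff)
    ultimately show ?case by (simp only: pn[symmetric])
  qed
  then show "AE x in M. integrable (N x) f" by eventually_elim simp
  have m: "(\<lambda>x. \<integral>y. f y \<partial>N x) \<in> borel_measurable M"
    by (rule measurable_compose[OF N integral_measurable_subprob_algebra]) simp
  have d: "integrable M (\<lambda>x. (\<integral>y. ?p y \<partial>N x) - (\<integral>y. ?n y \<partial>N x))" using p n by auto
  have AE': "AE x in M. (\<integral>y. ?p y \<partial>N x) - (\<integral>y. ?n y \<partial>N x) = (\<integral>y. f y \<partial>N x)"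
    using AE by eventually_elim simp
  show "integrable M (\<lambda>x. \<integral>y. f y \<partial>N x)"
    by (rule integrable_cong_AE_imp[OF d m AE'])
  have "(\<integral>y. f y \<partial>bind M N) = (\<integral>y. ?p y - ?n y \<partial>bind M N)" by (simp only: pn[symmetric])
  also have "\<dots> = (\<integral>y. ?p y \<partial>bind M N) - (\<integral>y. ?n y \<partial>bind M N)"
    using int by (intro Bochner_Integration.integral_diff) auto
  also have "\<dots> = (\<integral>x. (\<integral>y. ?p y \<partial>N x) \<partial>M) - (\<integral>x. (\<integral>y. ?n y \<partial>N x) \<partial>M)" using p n by simp
  also have "\<dots> = (\<integral>x. (\<integral>y. ?p y \<partial>N x) - (\<integral>y. ?n y \<partial>N x) \<partial>M)" using p n by simp
  also have "\<dots> = (\<integral>x. (\<integral>y. f y \<partial>N x) \<partial>M)"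
    using m d AE' by (intro integral_cong_AE) auto
  finally show "(\<integral>y. f y \<partial>bind M N) = (\<integral>x. (\<integral>y. f y \<partial>N x) \<partial>M)" .
qed

section \<open>Kernels with symmetric joint law, acting on square integrable functions\<close>

lemma abs_mult_le_sum_squares: "\<bar>u * v\<bar> \<le> u\<^sup>2 + v\<^sup>2" for u v :: real
proof -
  have "2 * \<bar>u * v\<bar> \<le> u\<^sup>2 + v\<^sup>2"
    using sum_squares_bound[of "\<bar>u\<bar>" "\<bar>v\<bar>"] by (simp add: abs_mult)
  moreover have "\<bar>u * v\<bar> \<ge> 0" by simp
  ultimately show ?thesis by linarith
qed

text \<open>Kept apart from \<open>Q\<close> because every power \<open>kernel_pow Q n\<close> will
  be an instance as well.\<close>

locale kernel_pair =
  fixes \<pi> :: "'a::polish_space measure" and P :: "'a \<Rightarrow> 'a measure"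
  assumes prob_space_pi: "prob_space \<pi>" and sets_pi[simp, measurable_cong]: "sets \<pi> = sets borel"
    and P[measurable]: "P \<in> measurable borel (prob_algebra borel)"
    and symm: "\<And>A B. A \<in> sets borel \<Longrightarrow> B \<in> sets borel \<Longrightarrow>
      (\<integral>\<^sup>+x. indicator A x * emeasure (P x) B \<partial>\<pi>) = (\<integral>\<^sup>+x. indicator B x * emeasure (P x) A \<partial>\<pi>)"
begin

lemma space_pi[simp]: "space \<pi> = UNIV"
  using sets_eq_imp_space_eq[OF sets_pi] by simp

lemma pi_in_prob_algebra: "\<pi> \<in> space (prob_algebra borel)"
  by (simp add: space_prob_algebra prob_space_pi)

lemma prob_space_P: "prob_space (P x)" and sets_P[simp, measurable_cong]: "sets (P x) = sets borel"
  using measurable_space[OF P, of x] by (auto simp: space_prob_algebra)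

lemma space_P[simp]: "space (P x) = UNIV"
  using sets_eq_imp_space_eq[OF sets_P] by simp

lemma P_subprob[measurable]: "P \<in> measurable borel (subprob_algebra borel)"
  by (rule measurable_prob_algebraD) simp

lemma measurable_pi: "measurable \<pi> N = measurable borel N"
  by (rule measurable_cong_sets[OF sets_pi refl])

text \<open>The law of two consecutive states when the first has law \<pi>. On the product space
  reversibility becomes invariance under swapping, and integrability of a product of functions of
  the two states follows from the marginals.\<close>

definition joint :: "('a \<times> 'a) measure" where
  "joint = bind \<pi> (\<lambda>x. distr (P x) (borel \<Otimes>\<^sub>M borel) (Pair x))"

lemma Pair_distr_measurable[measurable]:
  "(\<lambda>x. distr (P x) (borel \<Otimes>\<^sub>M borel) (Pair x)) \<in> measurable borel (prob_algebra (borel \<Otimes>\<^sub>M borel))"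
  by (rule measurable_distr_prob_space2[OF P]) simp

lemma sets_joint[simp, measurable_cong]: "sets joint = sets (borel \<Otimes>\<^sub>M borel)"
  unfolding joint_def by (rule sets_bind'[OF pi_in_prob_algebra Pair_distr_measurable])

lemma space_joint[simp]: "space joint = UNIV"
  using sets_eq_imp_space_eq[OF sets_joint] by (simp add: space_pair_measure)

lemma prob_space_joint: "prob_space joint"
  unfolding joint_def by (rule prob_space_bind'[OF pi_in_prob_algebra Pair_distr_measurable])

lemma nn_integral_joint:
  assumes [measurable]: "f \<in> borel_measurable (borel \<Otimes>\<^sub>M borel)"
  shows "(\<integral>\<^sup>+p. f p \<partial>joint) = (\<integral>\<^sup>+x. (\<integral>\<^sup>+y. f (x, y) \<partial>P x) \<partial>\<pi>)"
proof -
  have "(\<lambda>x. distr (P x) (borel \<Otimes>\<^sub>M borel) (Pair x)) \<in> measurable \<pi> (subprob_algebra (borel \<Otimes>\<^sub>M borel))"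
    unfolding measurable_pi by (rule measurable_prob_algebraD) simp
  then have "(\<integral>\<^sup>+p. f p \<partial>joint) = (\<integral>\<^sup>+x. (\<integral>\<^sup>+p. f p \<partial>distr (P x) (borel \<Otimes>\<^sub>M borel) (Pair x)) \<partial>\<pi>)"
    unfolding joint_def by (intro nn_integral_bind) auto
  also have "\<dots> = (\<integral>\<^sup>+x. (\<integral>\<^sup>+y. f (x, y) \<partial>P x) \<partial>\<pi>)"
    by (intro nn_integral_cong nn_integral_distr) auto
  finally show ?thesis .
qed

lemma emeasure_joint_Times:
  assumes "A \<in> sets borel" "B \<in> sets borel"
  shows "emeasure joint (A \<times> B) = (\<integral>\<^sup>+x. indicator A x * emeasure (P x) B \<partial>\<pi>)"
proof -
  have "emeasure joint (A \<times> B) = (\<integral>\<^sup>+p. indicator (A \<times> B) p \<partial>joint)"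
    using assms by simp
  also have "\<dots> = (\<integral>\<^sup>+x. (\<integral>\<^sup>+y. indicator A x * indicator B y \<partial>P x) \<partial>\<pi>)"
    using assms by (subst nn_integral_joint) (auto simp: indicator_times)
  also have "\<dots> = (\<integral>\<^sup>+x. indicator A x * emeasure (P x) B \<partial>\<pi>)"
    using assms by (simp add: nn_integral_cmult)
  finally show ?thesis .
qed

text \<open>The assumption \<open>symm\<close> is this identity on measurable rectangles, which form
  an intersection-stable generator of the product \<sigma>-algebra.\<close>

lemma distr_joint_swap: "distr joint joint prod.swap = joint"
proof (rule measure_eqI_generator_eq[OF Int_stable_pair_measure_generator[of borel borel]])
  interpret J: prob_space joint by (rule prob_space_joint)
  have m: "prod.swap \<in> measurable joint joint"
    by (simp add: measurable_cong_sets[OF sets_joint sets_joint] prod.swap_def[abs_def])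
  show "{a \<times> b |a b. a \<in> sets borel \<and> b \<in> sets borel} \<subseteq> Pow (UNIV :: ('a \<times> 'a) set)" by simp
  show "emeasure (distr joint joint prod.swap) C = emeasure joint C"
    if "C \<in> {a \<times> b |a b. a \<in> sets borel \<and> b \<in> sets borel}" for C
  proof -
    obtain A B where C: "C = A \<times> B" and AB: "A \<in> sets borel" "B \<in> sets borel" using \<open>C \<in> _\<close> by blast
    have "prod.swap -` C \<inter> space joint = B \<times> A" by (auto simp: C)
    then show ?thesis
      using AB m symm[OF AB] by (simp add: C emeasure_distr emeasure_joint_Times)
  qed
  show s: "sets joint = sigma_sets UNIV {a \<times> b |a b. a \<in> sets borel \<and> b \<in> sets borel}"
    by (simp add: sets_pair_measure)
  then show "sets (distr joint joint prod.swap) = sigma_sets UNIV {a \<times> b |a b. a \<in> sets borel \<and> b \<in> sets borel}"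
    by (simp only: sets_distr)
  show "range (\<lambda>_::nat. UNIV) \<subseteq> {a \<times> b |a b. a \<in> sets (borel :: 'a measure) \<and> b \<in> sets (borel :: 'a measure)}"
    by (auto intro!: exI[of _ UNIV])
  show "emeasure (distr joint joint prod.swap) UNIV \<noteq> \<infinity>"
    using prob_space.emeasure_space_1[OF J.prob_space_distr[OF m]] by simp
qed simp

lemma distr_joint_fst: "distr joint borel fst = \<pi>"
proof (rule measure_eqI)
  fix A assume "A \<in> sets (distr joint borel fst)"
  then have A: "A \<in> sets borel" by simp
  have "emeasure (distr joint borel fst) A = emeasure joint (A \<times> UNIV)"
    using A by (subst emeasure_distr) (auto simp: measurable_cong_sets[OF sets_joint refl] intro!: arg_cong[where f="emeasure joint"])
  also have "\<dots> = emeasure \<pi> A"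
    using A prob_space.emeasure_space_1[OF prob_space_P] by (subst emeasure_joint_Times) auto
  finally show "emeasure (distr joint borel fst) A = emeasure \<pi> A" .
qed simp

lemma distr_joint_snd: "distr joint borel snd = \<pi>"
proof -
  have m: "prod.swap \<in> measurable joint joint"
    by (simp add: measurable_cong_sets[OF sets_joint sets_joint] prod.swap_def[abs_def])
  have "distr joint borel snd = distr (distr joint joint prod.swap) borel snd"
    by (simp only: distr_joint_swap)
  also have "\<dots> = distr joint borel fst"
    using m by (subst distr_distr) (auto simp: measurable_cong_sets[OF sets_joint refl] comp_def)
  finally show ?thesis by (simp add: distr_joint_fst)
qed

lemma nn_integral_symmetric:
  assumes [measurable]: "f \<in> borel_measurable borel" "g \<in> borel_measurable borel"
  shows "(\<integral>\<^sup>+x. f x * (\<integral>\<^sup>+y. g y \<partial>P x) \<partial>\<pi>) = (\<integral>\<^sup>+x. g x * (\<integral>\<^sup>+y. f y \<partial>P x) \<partial>\<pi>)"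
proof -
  have m: "prod.swap \<in> measurable joint joint"
    by (simp add: measurable_cong_sets[OF sets_joint sets_joint] prod.swap_def[abs_def])
  have *: "(\<integral>\<^sup>+x. u x * (\<integral>\<^sup>+y. v y \<partial>P x) \<partial>\<pi>) = (\<integral>\<^sup>+p. u (fst p) * v (snd p) \<partial>joint)"
    if [measurable]: "u \<in> borel_measurable borel" "v \<in> borel_measurable borel" for u v
    by (subst nn_integral_joint) (auto intro!: nn_integral_cong simp: nn_integral_cmult)
  have "(\<integral>\<^sup>+p. f (fst p) * g (snd p) \<partial>joint) = (\<integral>\<^sup>+p. f (fst p) * g (snd p) \<partial>distr joint joint prod.swap)"
    by (simp only: distr_joint_swap)
  also have "\<dots> = (\<integral>\<^sup>+p. g (fst p) * f (snd p) \<partial>joint)"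
    by (subst nn_integral_distr[OF m]) (auto simp: mult.commute)
  finally show ?thesis by (simp add: *)
qed

text \<open>Symmetry tested against the constant 1, every \<open>P x\<close> having total mass
  1.\<close>

lemma stationary: "(\<integral>\<^sup>+x. (\<integral>\<^sup>+y. f y \<partial>P x) \<partial>\<pi>) = (\<integral>\<^sup>+x. f x \<partial>\<pi>)" if "f \<in> borel_measurable borel"
  using nn_integral_symmetric[of "\<lambda>_. 1" f] that prob_space.emeasure_space_1[OF prob_space_P] by simp

lemma bind_pi_P: "bind \<pi> P = \<pi>"
proof (rule measure_eqI)
  fix A assume "A \<in> sets (bind \<pi> P)"
  then have A: "A \<in> sets borel" using sets_bind'[OF pi_in_prob_algebra P] by simp
  then have "emeasure (bind \<pi> P) A = (\<integral>\<^sup>+x. (\<integral>\<^sup>+y. indicator A y \<partial>P x) \<partial>\<pi>)"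
    using emeasure_bind_prob_algebra[OF pi_in_prob_algebra P] by simp
  also have "\<dots> = emeasure \<pi> A" using A by (subst stationary) auto
  finally show "emeasure (bind \<pi> P) A = emeasure \<pi> A" .
qed (simp add: sets_bind'[OF pi_in_prob_algebra P])

text \<open>These are functions, not classes modulo null sets. Operator identities below therefore
  hold almost everywhere, and \<open>form_cong_AE\<close> carries them into integrals.\<close>

definition L2 :: "('a \<Rightarrow> real) \<Rightarrow> bool" where
  "L2 f \<longleftrightarrow> f \<in> borel_measurable borel \<and> integrable \<pi> (\<lambda>x. (f x)\<^sup>2)"

lemma L2_measurable[measurable_dest]: "L2 f \<Longrightarrow> f \<in> borel_measurable borel"
  by (simp add: L2_def)

lemma L2_square_integrable: "L2 f \<Longrightarrow> integrable \<pi> (\<lambda>x. (f x)\<^sup>2)"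
  by (simp add: L2_def)

lemma L2_mult_integrable:
  assumes "L2 f" "L2 g" shows "integrable \<pi> (\<lambda>x. f x * g x)"
proof (rule Bochner_Integration.integrable_bound)
  show "integrable \<pi> (\<lambda>x. (f x)\<^sup>2 + (g x)\<^sup>2)" using assms by (auto simp: L2_def)
  show "(\<lambda>x. f x * g x) \<in> borel_measurable \<pi>" using assms by (auto simp: L2_def measurable_pi)
  show "AE x in \<pi>. norm (f x * g x) \<le> norm ((f x)\<^sup>2 + (g x)\<^sup>2)"
    using abs_mult_le_sum_squares by simp
qed

lemma L2_const: "L2 (\<lambda>_. c)"
  using prob_space.finite_measure[OF prob_space_pi] by (simp add: L2_def finite_measure.integrable_const)

lemma L2_cmult: "L2 f \<Longrightarrow> L2 (\<lambda>x. c * f x)"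
  by (auto simp: L2_def power_mult_distrib)

lemma L2_integrable: "L2 f \<Longrightarrow> integrable \<pi> f"
  using L2_mult_integrable[of f "\<lambda>_. 1"] L2_const[of 1] by simp

lemma L2_add:
  assumes "L2 f" "L2 g" shows "L2 (\<lambda>x. f x + g x)"
  using assms L2_mult_integrable[OF assms] by (auto simp: L2_def power2_sum mult.assoc)

lemma L2_diff: "L2 f \<Longrightarrow> L2 g \<Longrightarrow> L2 (\<lambda>x. f x - g x)"
  using L2_add[of f "\<lambda>x. - 1 * g x"] L2_cmult[of g "-1"] by simp

lemma L2_sum: "finite I \<Longrightarrow> (\<And>i. i \<in> I \<Longrightarrow> L2 (f i)) \<Longrightarrow> L2 (\<lambda>x. \<Sum>i\<in>I. f i x)"
  by (induction I rule: finite_induct) (auto simp: L2_const intro: L2_add)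

lemma integrable_joint:
  assumes "L2 f" "L2 g"
  shows "integrable joint (\<lambda>p. f (fst p) * g (snd p))"
proof (rule Bochner_Integration.integrable_bound)
  note [measurable] = L2_measurable[OF assms(1)] L2_measurable[OF assms(2)]
  have "integrable (distr joint borel fst) (\<lambda>x. (f x)\<^sup>2)" "integrable (distr joint borel snd) (\<lambda>x. (g x)\<^sup>2)"
    using assms by (simp_all add: distr_joint_fst distr_joint_snd L2_def)
  then have "integrable joint (\<lambda>p. (f (fst p))\<^sup>2)" "integrable joint (\<lambda>p. (g (snd p))\<^sup>2)"
    by (auto simp: integrable_distr_eq measurable_cong_sets[OF sets_joint refl])
  then show "integrable joint (\<lambda>p. (f (fst p))\<^sup>2 + (g (snd p))\<^sup>2)" by simp
  show "(\<lambda>p. f (fst p) * g (snd p)) \<in> borel_measurable joint"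
    by (simp add: measurable_cong_sets[OF sets_joint refl])
  show "AE p in joint. norm (f (fst p) * g (snd p)) \<le> norm ((f (fst p))\<^sup>2 + (g (snd p))\<^sup>2)"
    using abs_mult_le_sum_squares by simp
qed

lemma integral_joint:
  assumes "L2 f" "L2 g"
  shows "(\<integral>p. f (fst p) * g (snd p) \<partial>joint) = (\<integral>x. f x * (\<integral>y. g y \<partial>P x) \<partial>\<pi>)"
proof -
  note [measurable] = L2_measurable[OF assms(1)] L2_measurable[OF assms(2)]
  let ?F = "\<lambda>p. f (fst p) * g (snd p)"
  have K: "(\<lambda>x. distr (P x) (borel \<Otimes>\<^sub>M borel) (Pair x)) \<in> measurable \<pi> (subprob_algebra (borel \<Otimes>\<^sub>M borel))"
    unfolding measurable_pi by (rule measurable_prob_algebraD) simp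
  have F: "?F \<in> borel_measurable (borel \<Otimes>\<^sub>M borel)" by measurable
  have eq: "(\<integral>p. ?F p \<partial>distr (P x) (borel \<Otimes>\<^sub>M borel) (Pair x)) = f x * (\<integral>y. g y \<partial>P x)" for x
    by (subst integral_distr) auto
  have i: "integrable (bind \<pi> (\<lambda>x. distr (P x) (borel \<Otimes>\<^sub>M borel) (Pair x))) ?F"
    using integrable_joint[OF assms] by (simp add: joint_def)
  show "(\<integral>p. ?F p \<partial>joint) = (\<integral>x. f x * (\<integral>y. g y \<partial>P x) \<partial>\<pi>)"
    using integral_bind_integrable[OF K F i] by (simp add: eq joint_def)
qed

lemma self_adjoint:
  assumes "L2 f" "L2 g"
  shows "(\<integral>x. f x * (\<integral>y. g y \<partial>P x) \<partial>\<pi>) = (\<integral>x. g x * (\<integral>y. f y \<partial>P x) \<partial>\<pi>)"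
proof -
  note [measurable] = L2_measurable[OF assms(1)] L2_measurable[OF assms(2)]
  have m: "prod.swap \<in> measurable joint joint"
    by (simp add: measurable_cong_sets[OF sets_joint sets_joint] prod.swap_def[abs_def])
  have "(\<integral>p. f (fst p) * g (snd p) \<partial>joint) = (\<integral>p. f (fst p) * g (snd p) \<partial>distr joint joint prod.swap)"
    by (simp only: distr_joint_swap)
  also have "\<dots> = (\<integral>p. g (fst p) * f (snd p) \<partial>joint)"
    by (subst integral_distr[OF m]) (auto simp: mult.commute measurable_cong_sets[OF sets_joint refl])
  finally show ?thesis by (simp add: integral_joint assms)
qed

text \<open>The contraction property in the form in which it is used:
  \<open>2 |u v| <= u^2 + v^2\<close> is integrated over \<open>joint\<close>, and both marginals
  are \<pi>.\<close>

lemma abs_quadratic_form_le: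
  assumes f: "L2 f"
  shows "\<bar>\<integral>x. f x * (\<integral>y. f y \<partial>P x) \<partial>\<pi>\<bar> \<le> (\<integral>x. (f x)\<^sup>2 \<partial>\<pi>)"
proof -
  note [measurable] = L2_measurable[OF f]
  have i: "integrable joint (\<lambda>p. (f (fst p))\<^sup>2)" "integrable joint (\<lambda>p. (f (snd p))\<^sup>2)"
  proof -
    have "integrable (distr joint borel fst) (\<lambda>x. (f x)\<^sup>2)" "integrable (distr joint borel snd) (\<lambda>x. (f x)\<^sup>2)"
      using f by (simp_all add: distr_joint_fst distr_joint_snd L2_def)
    then show "integrable joint (\<lambda>p. (f (fst p))\<^sup>2)" "integrable joint (\<lambda>p. (f (snd p))\<^sup>2)"
      by (auto simp: integrable_distr_eq measurable_cong_sets[OF sets_joint refl])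
  qed
  have e: "(\<integral>p. (f (fst p))\<^sup>2 \<partial>joint) = (\<integral>x. (f x)\<^sup>2 \<partial>\<pi>)" "(\<integral>p. (f (snd p))\<^sup>2 \<partial>joint) = (\<integral>x. (f x)\<^sup>2 \<partial>\<pi>)"
    using integral_distr[of fst joint borel "\<lambda>x. (f x)\<^sup>2"] integral_distr[of snd joint borel "\<lambda>x. (f x)\<^sup>2"]
    by (simp_all add: distr_joint_fst distr_joint_snd measurable_cong_sets[OF sets_joint refl])
  have "\<bar>\<integral>p. f (fst p) * f (snd p) \<partial>joint\<bar> \<le> (\<integral>p. \<bar>f (fst p) * f (snd p)\<bar> \<partial>joint)"
    by (rule integral_abs_bound)
  also have "\<dots> \<le> (\<integral>p. ((f (fst p))\<^sup>2 + (f (snd p))\<^sup>2) / 2 \<partial>joint)"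
  proof (rule integral_mono)
    fix p
    show "\<bar>f (fst p) * f (snd p)\<bar> \<le> ((f (fst p))\<^sup>2 + (f (snd p))\<^sup>2) / 2"
      using sum_squares_bound[of "\<bar>f (fst p)\<bar>" "\<bar>f (snd p)\<bar>"] by (simp add: abs_mult)
  qed (use i integrable_joint[OF f f] in auto)
  also have "\<dots> = (\<integral>x. (f x)\<^sup>2 \<partial>\<pi>)" using i e by simp
  finally show ?thesis by (simp add: integral_joint f)
qed

lemma integral_P: 
  assumes "integrable \<pi> f" and [measurable]: "f \<in> borel_measurable borel"
  shows "AE x in \<pi>. integrable (P x) (f :: 'a \<Rightarrow> real)"
  and "integrable \<pi> (\<lambda>x. \<integral>y. f y \<partial>P x)"
  and "(\<integral>x. (\<integral>y. f y \<partial>P x) \<partial>\<pi>) = (\<integral>x. f x \<partial>\<pi>)"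
proof -
  have P': "P \<in> measurable \<pi> (subprob_algebra borel)" unfolding measurable_pi by simp
  have i: "integrable (bind \<pi> P) f" using assms by (simp add: bind_pi_P)
  show "AE x in \<pi>. integrable (P x) f" by (rule AE_integrable_bind[OF P' _ i]) auto
  show "integrable \<pi> (\<lambda>x. \<integral>y. f y \<partial>P x)" by (rule integrable_integral_bind[OF P' _ i]) auto
  show "(\<integral>x. (\<integral>y. f y \<partial>P x) \<partial>\<pi>) = (\<integral>x. f x \<partial>\<pi>)"
    using integral_bind_integrable[OF P' _ i] by (simp add: bind_pi_P)
qed

lemma L2_op:
  assumes f: "L2 f" shows "L2 (\<lambda>x. \<integral>y. f y \<partial>P x)"
  unfolding L2_def
proof
  note [measurable] = L2_measurable[OF f]
  show m: "(\<lambda>x. \<integral>y. f y \<partial>P x) \<in> borel_measurable borel"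
    by (rule measurable_compose[OF P_subprob integral_measurable_subprob_algebra]) simp
  show "integrable \<pi> (\<lambda>x. (\<integral>y. f y \<partial>P x)\<^sup>2)"
  proof (rule Bochner_Integration.integrable_bound)
    show "integrable \<pi> (\<lambda>x. \<integral>y. (f y)\<^sup>2 \<partial>P x)"
      using f by (intro integral_P) (auto simp: L2_def)
    show "(\<lambda>x. (\<integral>y. f y \<partial>P x)\<^sup>2) \<in> borel_measurable \<pi>" using m by (simp add: measurable_pi)
    have "AE x in \<pi>. integrable (P x) (\<lambda>y. (f y)\<^sup>2)"
      using f by (intro integral_P) (auto simp: L2_def)
    moreover have "AE x in \<pi>. integrable (P x) f"
      using L2_integrable[OF f] by (intro integral_P) auto
    ultimately show "AE x in \<pi>. norm ((\<integral>y. f y \<partial>P x)\<^sup>2) \<le> norm (\<integral>y. (f y)\<^sup>2 \<partial>P x)"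
    proof eventually_elim
      case (elim x)
      interpret prob_space "P x" by (rule prob_space_P)
      \<comment> \<open>Jensen's inequality for the square, in the guise of a nonnegative
        variance.\<close>
      have "0 \<le> variance f" by (rule variance_positive)
      also have "\<dots> = (\<integral>y. (f y)\<^sup>2 \<partial>P x) - (\<integral>y. f y \<partial>P x)\<^sup>2"
        using elim by (intro variance_eq) auto
      finally show ?case by simp
    qed
  qed
qed

end

text \<open>When \<gamma> is the moment sequence of a measure, this is the integral of
  \<open>p(x)^2 x^s\<close> for the polynomial \<open>p\<close> with coefficients
  \<open>c 0, ..., c N\<close>. For autocovariances the transition operator takes the place of
  \<open>x\<close>.\<close>

definition hankel_form :: "(nat \<Rightarrow> real) \<Rightarrow> (nat \<Rightarrow> real) \<Rightarrow> nat \<Rightarrow> nat \<Rightarrow> real" where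
  "hankel_form \<gamma> c N s = (\<Sum>i\<le>N. \<Sum>j\<le>N. c i * c j * \<gamma> (i + j + s))"

section \<open>Powers of a reversible kernel; autocovariances as quadratic forms\<close>

locale reversible_chain = transition_kernel Q for Q :: "'a::polish_space \<Rightarrow> 'a measure" +
  fixes \<pi> :: "'a measure"
  assumes prob_space_pi: "prob_space \<pi>" and sets_pi[simp, measurable_cong]: "sets \<pi> = sets borel"
    and rev: "reversible Q \<pi>"
begin

lemma kernel_pow_add: "bind (kernel_pow Q m x) (kernel_pow Q n) = kernel_pow Q (m + n) x"
proof (induction n)
  case 0
  have "kernel_pow Q 0 = return borel" by (simp add: fun_eq_iff)
  then show ?case by (simp add: bind_return'')
next
  case (Suc n)
  have "kernel_pow Q (Suc n) = (\<lambda>x. bind (kernel_pow Q n x) Q)" by (simp add: fun_eq_iff)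
  then have "bind (kernel_pow Q m x) (kernel_pow Q (Suc n)) = bind (bind (kernel_pow Q m x) (kernel_pow Q n)) Q"
    using bind_assoc[of "kernel_pow Q n" "kernel_pow Q m x" borel Q borel]
    by (simp add: measurable_cong_sets[OF sets_kernel_pow refl])
  also have "\<dots> = kernel_pow Q (m + Suc n) x" unfolding Suc by simp
  finally show ?case .
qed

lemma kernel_pow_1: "kernel_pow Q (Suc 0) x = Q x"
  by (simp add: bind_return[OF Q_measurable_subprob])

lemma kernel_pair_Q: "kernel_pair \<pi> Q"
  using rev by (intro kernel_pair.intro[OF prob_space_pi sets_pi Q_measurable]) (simp add: reversible_def)

lemma kernel_pair_pow: "kernel_pair \<pi> (kernel_pow Q n)"
proof (induction n)
  case 0
  show ?case
  proof (rule kernel_pair.intro[OF prob_space_pi sets_pi kernel_pow_measurable])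
    fix A B :: "'a set" assume "A \<in> sets borel" "B \<in> sets borel"
    then show "(\<integral>\<^sup>+x. indicator A x * emeasure (kernel_pow Q 0 x) B \<partial>\<pi>) = (\<integral>\<^sup>+x. indicator B x * emeasure (kernel_pow Q 0 x) A \<partial>\<pi>)"
      by (simp add: mult.commute)
  qed
next
  case (Suc n)
  interpret Q: kernel_pair \<pi> Q by (rule kernel_pair_Q)
  interpret Qn: kernel_pair \<pi> "kernel_pow Q n" by (rule Suc)
  show ?case
  proof (rule kernel_pair.intro[OF prob_space_pi sets_pi kernel_pow_measurable])
    fix A B :: "'a set" assume [measurable]: "A \<in> sets borel" "B \<in> sets borel"
    have [measurable]: "(\<lambda>x. emeasure (kernel_pow Q n x) B) \<in> borel_measurable borel" "(\<lambda>x. emeasure (Q x) A) \<in> borel_measurable borel"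
      by measurable
    \<comment> \<open>The recursion of \<open>kernel_pow\<close> splits off the last step. Splitting
      off the first one instead lets the symmetry of \<open>Q\<close> and then that of the n-step
      kernel be applied in turn, after which the recursion itself reassembles the result.\<close>
    have "kernel_pow Q (Suc n) x = bind (Q x) (kernel_pow Q n)" for x
      using kernel_pow_add[of "Suc 0" x n] by (simp only: kernel_pow_1 add_Suc add_0)
    then have "emeasure (kernel_pow Q (Suc n) x) B = (\<integral>\<^sup>+y. emeasure (kernel_pow Q n y) B \<partial>Q x)" for x
      by (simp only:) (rule emeasure_bind_prob_algebra[OF Q_in_prob_algebra kernel_pow_measurable], simp)
    then have "(\<integral>\<^sup>+x. indicator A x * emeasure (kernel_pow Q (Suc n) x) B \<partial>\<pi>)
        = (\<integral>\<^sup>+x. indicator A x * (\<integral>\<^sup>+y. emeasure (kernel_pow Q n y) B \<partial>Q x) \<partial>\<pi>)" by (simp only:)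
    also have "\<dots> = (\<integral>\<^sup>+x. emeasure (kernel_pow Q n x) B * (\<integral>\<^sup>+y. indicator A y \<partial>Q x) \<partial>\<pi>)"
      by (rule Q.nn_integral_symmetric) measurable
    also have "\<dots> = (\<integral>\<^sup>+x. emeasure (Q x) A * (\<integral>\<^sup>+y. indicator B y \<partial>kernel_pow Q n x) \<partial>\<pi>)"
      by (simp add: mult.commute)
    also have "\<dots> = (\<integral>\<^sup>+x. indicator B x * (\<integral>\<^sup>+y. emeasure (Q y) A \<partial>kernel_pow Q n x) \<partial>\<pi>)"
      by (rule Qn.nn_integral_symmetric) measurable
    also have "\<dots> = (\<integral>\<^sup>+x. indicator B x * emeasure (kernel_pow Q (Suc n) x) A \<partial>\<pi>)"
      by (simp add: emeasure_bind_prob_algebra[OF kernel_pow_in_prob_algebra Q_measurable])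
    finally show "(\<integral>\<^sup>+x. indicator A x * emeasure (kernel_pow Q (Suc n) x) B \<partial>\<pi>) =
        (\<integral>\<^sup>+x. indicator B x * emeasure (kernel_pow Q (Suc n) x) A \<partial>\<pi>)" .
  qed
qed

sublocale pow: kernel_pair \<pi> "kernel_pow Q n" for n
  by (rule kernel_pair_pow)

definition op :: "nat \<Rightarrow> ('a \<Rightarrow> real) \<Rightarrow> 'a \<Rightarrow> real" where
  "op n f x = (\<integral>y. f y \<partial>kernel_pow Q n x)"

definition form :: "('a \<Rightarrow> real) \<Rightarrow> nat \<Rightarrow> ('a \<Rightarrow> real) \<Rightarrow> real" where
  "form f n g = (\<integral>x. f x * op n g x \<partial>\<pi>)"

lemma L2_op: "pow.L2 f \<Longrightarrow> pow.L2 (op n f)"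
  unfolding op_def by (rule pow.L2_op)

lemma op_0: "f \<in> borel_measurable borel \<Longrightarrow> op 0 f = f"
  by (auto simp: op_def fun_eq_iff integral_return)

text \<open>Chapman-Kolmogorov. For unbounded \<open>f\<close> it needs \<open>f\<close> to be
  integrable under the law after \<open>m + n\<close> steps from \<open>x\<close>, which
  stationarity grants only for almost every \<open>x\<close>.\<close>

lemma AE_op_op:
  assumes f: "pow.L2 f"
  shows "AE x in \<pi>. op m (op n f) x = op (m + n) f x"
proof -
  note [measurable] = pow.L2_measurable[OF f]
  have "AE x in \<pi>. integrable (kernel_pow Q (m + n) x) f"
    using pow.L2_integrable[OF f] by (intro pow.integral_P) auto
  then show ?thesis
  proof eventually_elim
    case (elim x)
    then have "integrable (bind (kernel_pow Q m x) (kernel_pow Q n)) f" by (simp add: kernel_pow_add)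
    then have "(\<integral>y. f y \<partial>bind (kernel_pow Q m x) (kernel_pow Q n)) = op m (op n f) x"
      unfolding op_def
      by (intro integral_bind_integrable[where B=borel]) (auto simp: measurable_cong_sets[OF sets_kernel_pow refl])
    then show ?case by (simp add: kernel_pow_add op_def)
  qed
qed

lemma AE_op_add:
  assumes f: "pow.L2 f" and g: "pow.L2 g"
  shows "AE x in \<pi>. op n (\<lambda>x. a * f x + b * g x) x = a * op n f x + b * op n g x"
proof -
  have "AE x in \<pi>. integrable (kernel_pow Q n x) f" "AE x in \<pi>. integrable (kernel_pow Q n x) g"
    using pow.L2_integrable[OF f] pow.L2_integrable[OF g] f g by (auto intro!: pow.integral_P)
  then show ?thesis by eventually_elim (simp add: op_def)
qed

lemma AE_op_sum:
  assumes "finite I" "\<And>i. i \<in> I \<Longrightarrow> pow.L2 (f i)"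
  shows "AE x in \<pi>. op n (\<lambda>x. \<Sum>i\<in>I. c i * f i x) x = (\<Sum>i\<in>I. c i * op n (f i) x)"
proof -
  have "AE x in \<pi>. \<forall>i\<in>I. integrable (kernel_pow Q n x) (f i)"
    using assms pow.L2_integrable by (intro AE_finite_allI pow.integral_P) auto
  then show ?thesis by eventually_elim (simp add: op_def)
qed

lemma form_cong_AE:
  assumes "pow.L2 f" "pow.L2 g" "pow.L2 h" and eq: "AE x in \<pi>. g x = h x"
  shows "(\<integral>x. f x * g x \<partial>\<pi>) = (\<integral>x. f x * h x \<partial>\<pi>)"
proof (rule integral_cong_AE)
  show "(\<lambda>x. f x * g x) \<in> borel_measurable \<pi>" "(\<lambda>x. f x * h x) \<in> borel_measurable \<pi>"
    using assms(1-3) by (auto intro!: borel_measurable_integrable pow.L2_mult_integrable)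
  show "AE x in \<pi>. f x * g x = f x * h x" using eq by eventually_elim simp
qed

lemma form_commute: "pow.L2 f \<Longrightarrow> pow.L2 g \<Longrightarrow> form f n g = form g n f"
  unfolding form_def op_def by (rule pow.self_adjoint)

text \<open>Self-adjointness moves \<open>op i\<close> to the other factor, where the exponents add
  up.\<close>

lemma form_op:
  assumes "pow.L2 f" "pow.L2 g"
  shows "(\<integral>x. op i f x * op j g x \<partial>\<pi>) = form f (i + j) g"
proof -
  have "(\<integral>x. op i f x * op j g x \<partial>\<pi>) = form (op j g) i f" by (simp add: form_def mult.commute)
  also have "\<dots> = form f i (op j g)" using assms by (intro form_commute L2_op)
  also have "\<dots> = form f (i + j) g"
    unfolding form_def using assms by (intro form_cong_AE AE_op_op L2_op)
  finally show ?thesis .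
qed

lemma form_add_right:
  assumes "pow.L2 f" "pow.L2 g" "pow.L2 h"
  shows "form f n (\<lambda>x. a * g x + b * h x) = a * form f n g + b * form f n h"
proof -
  have "form f n (\<lambda>x. a * g x + b * h x) = (\<integral>x. f x * (a * op n g x + b * op n h x) \<partial>\<pi>)"
    unfolding form_def using assms by (intro form_cong_AE AE_op_add L2_op pow.L2_add pow.L2_cmult)
  also have "\<dots> = (\<integral>x. a * (f x * op n g x) + b * (f x * op n h x) \<partial>\<pi>)" by (simp add: algebra_simps)
  also have "\<dots> = a * form f n g + b * form f n h"
    unfolding form_def using pow.L2_mult_integrable[OF assms(1) L2_op] assms by simp
  finally show ?thesis .
qed

lemma form_add_left:
  assumes "pow.L2 f" "pow.L2 g" "pow.L2 h"
  shows "form (\<lambda>x. a * g x + b * h x) n f = a * form g n f + b * form h n f"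
  using form_add_right[OF assms, of n a b] assms
  by (simp add: form_commute[of f] pow.L2_add pow.L2_cmult)

text \<open>An even power splits evenly between the two factors and leaves the squared norm of
  \<open>op n f\<close>.\<close>

lemma form_square_nonneg: "pow.L2 f \<Longrightarrow> 0 \<le> form f (2 * n) f"
  using form_op[of f f n n] by (simp add: mult_2 flip: form_op)

text \<open>Putting \<open>v = \<Sum> c i * op i f\<close>, the Hankel form with offset
  \<open>s\<close> is the inner product of \<open>v\<close> with \<open>op s v\<close>. The
  contraction bound for the s-step kernel compares it with the squared norm of \<open>v\<close>,
  which is the case \<open>s = 0\<close>.\<close>

lemma abs_hankel_form_le:
  assumes f: "pow.L2 f"
  shows "\<bar>hankel_form (\<lambda>n. form f n f) c N s\<bar> \<le> hankel_form (\<lambda>n. form f n f) c N 0"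
proof -
  define v where "v x = (\<Sum>i\<le>N. c i * op i f x)" for x
  have v: "pow.L2 v" unfolding v_def using f by (intro pow.L2_sum pow.L2_cmult L2_op) auto
  have eq: "(\<integral>x. v x * op s v x \<partial>\<pi>) = hankel_form (\<lambda>n. form f n f) c N s" for s
  proof -
    have "AE x in \<pi>. op s v x = (\<Sum>j\<le>N. c j * op s (op j f) x)"
      unfolding v_def[abs_def] using f by (intro AE_op_sum L2_op) auto
    moreover have "AE x in \<pi>. \<forall>j\<in>{..N}. op s (op j f) x = op (s + j) f x"
      using f by (intro AE_finite_allI AE_op_op) auto
    ultimately have AE: "AE x in \<pi>. op s v x = (\<Sum>j\<le>N. c j * op (s + j) f x)"
      by eventually_elim simp
    have "(\<integral>x. v x * op s v x \<partial>\<pi>) = (\<integral>x. v x * (\<Sum>j\<le>N. c j * op (s + j) f x) \<partial>\<pi>)"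
      using v f AE by (intro form_cong_AE L2_op pow.L2_sum pow.L2_cmult) auto
    also have "\<dots> = (\<integral>x. (\<Sum>i\<le>N. \<Sum>j\<le>N. c i * c j * (op i f x * op (s + j) f x)) \<partial>\<pi>)"
      by (simp add: v_def sum_product mult_ac)
    also have "\<dots> = (\<Sum>i\<le>N. \<Sum>j\<le>N. c i * c j * (\<integral>x. op i f x * op (s + j) f x \<partial>\<pi>))"
      using pow.L2_mult_integrable[OF L2_op[OF f] L2_op[OF f]] by (simp add: Bochner_Integration.integral_sum)
    also have "\<dots> = hankel_form (\<lambda>n. form f n f) c N s"
      using f by (simp add: form_op hankel_form_def add_ac)
    finally show ?thesis .
  qed
  have "\<bar>\<integral>x. v x * op s v x \<partial>\<pi>\<bar> \<le> (\<integral>x. (v x)\<^sup>2 \<partial>\<pi>)"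
    unfolding op_def by (rule pow.abs_quadratic_form_le[OF v])
  also have "(\<integral>x. (v x)\<^sup>2 \<partial>\<pi>) = (\<integral>x. v x * op 0 v x \<partial>\<pi>)"
    using v by (simp add: op_0 pow.L2_measurable power2_eq_square)
  finally show ?thesis by (simp only: eq)
qed

definition centre :: "('a \<Rightarrow> real) \<Rightarrow> 'a \<Rightarrow> real" where
  "centre f x = f x - (\<integral>y. f y \<partial>\<pi>)"

lemma L2_centre: "pow.L2 f \<Longrightarrow> pow.L2 (centre f)"
  unfolding centre_def by (intro pow.L2_diff pow.L2_const)

text \<open>The two expressions serve different ends. The centred one is a bilinear form of a
  self-adjoint operator, to which the Hankel bounds apply; the other one has the shape of the limits
  of time averages.\<close>

lemma cov_lag_eq_form:
  assumes f: "pow.L2 f" and g: "pow.L2 g"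
  shows "cov_lag \<pi> Q f g n = form (centre f) n (centre g)"
    and "cov_lag \<pi> Q f g n = form f n g - (\<integral>x. f x \<partial>\<pi>) * (\<integral>x. g x \<partial>\<pi>)"
proof -
  interpret pi: prob_space \<pi> by (rule prob_space_pi)
  let ?a = "\<integral>x. f x \<partial>\<pi>" and ?b = "\<integral>x. g x \<partial>\<pi>"
  have [measurable]: "g \<in> borel_measurable borel" using g by (rule pow.L2_measurable)
  have og: "(\<integral>x. op n g x \<partial>\<pi>) = ?b"
    unfolding op_def using pow.L2_integrable[OF g] by (intro pow.integral_P) auto
  then show *: "cov_lag \<pi> Q f g n = form f n g - ?a * ?b"
    by (simp add: cov_lag_def form_def op_def)
  have "AE x in \<pi>. integrable (kernel_pow Q n x) g"
    using pow.L2_integrable[OF g] by (intro pow.integral_P) auto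
  then have "AE x in \<pi>. op n (centre g) x = op n g x - ?b"
  proof eventually_elim
    case (elim x)
    interpret prob_space "kernel_pow Q n x" by (rule prob_space_kernel_pow)
    show ?case using elim prob_space by (simp add: op_def centre_def)
  qed
  then have "form (centre f) n (centre g) = (\<integral>x. centre f x * (op n g x - ?b) \<partial>\<pi>)"
    unfolding form_def using f g by (intro form_cong_AE L2_centre L2_op pow.L2_diff pow.L2_const)
  also have "\<dots> = (\<integral>x. f x * op n g x - ?b * f x - ?a * op n g x + ?a * ?b \<partial>\<pi>)"
    by (simp add: centre_def algebra_simps)
  also have "\<dots> = form f n g - ?a * ?b"
    using pow.L2_mult_integrable[OF f L2_op[OF g, of n]] pow.L2_integrable[OF f] pow.L2_integrable[OF L2_op[OF g, of n]] og pi.prob_space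
    by (simp add: form_def)
  finally show "cov_lag \<pi> Q f g n = form (centre f) n (centre g)" using * by simp
qed

lemma cov_lag_commute: "pow.L2 f \<Longrightarrow> pow.L2 g \<Longrightarrow> cov_lag \<pi> Q f g n = cov_lag \<pi> Q g f n"
  by (simp add: cov_lag_eq_form(1) form_commute L2_centre)

lemma acov_eq_cov_lag: "pow.L2 f \<Longrightarrow> pow.L2 g \<Longrightarrow> acov \<pi> Q f g k = cov_lag \<pi> Q f g (nat \<bar>k\<bar>)"
  by (simp add: acov_def cov_lag_commute)

text \<open>Reversibility merges the two cross terms into one. Subtracting the case of
  \<open>- b\<close> leaves \<open>4 * a * b\<close> times the cross-covariance, which is where the
  factor in the estimator comes from.\<close>

lemma cov_lag_combination:
  assumes f: "pow.L2 f" and g: "pow.L2 g"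
  shows "cov_lag \<pi> Q (\<lambda>x. a * f x + b * g x) (\<lambda>x. a * f x + b * g x) n =
    a\<^sup>2 * cov_lag \<pi> Q f f n + 2 * a * b * cov_lag \<pi> Q f g n + b\<^sup>2 * cov_lag \<pi> Q g g n"
proof -
  have "(\<integral>x. a * f x + b * g x \<partial>\<pi>) = a * (\<integral>x. f x \<partial>\<pi>) + b * (\<integral>x. g x \<partial>\<pi>)"
    using pow.L2_integrable[OF f] pow.L2_integrable[OF g] by simp
  then have c: "centre (\<lambda>x. a * f x + b * g x) = (\<lambda>x. a * centre f x + b * centre g x)"
    by (simp add: centre_def fun_eq_iff algebra_simps)
  have L: "pow.L2 (\<lambda>x. a * f x + b * g x)" "pow.L2 (\<lambda>x. a * centre f x + b * centre g x)"
    using f g by (auto intro!: pow.L2_add pow.L2_cmult L2_centre)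
  show ?thesis
    using f g L
    by (simp add: cov_lag_eq_form(1) c form_add_left form_add_right L2_centre form_commute[of "centre g" "centre f"])
      (simp add: algebra_simps power2_eq_square)
qed

lemma abs_hankel_form_cov_le:
  assumes f: "pow.L2 f"
  shows "\<bar>hankel_form (cov_lag \<pi> Q f f) c N s\<bar> \<le> hankel_form (cov_lag \<pi> Q f f) c N 0"
proof -
  have "cov_lag \<pi> Q f f = (\<lambda>n. form (centre f) n (centre f))"
    using f by (simp add: fun_eq_iff cov_lag_eq_form(1))
  then show ?thesis using abs_hankel_form_le[OF L2_centre[OF f]] by simp
qed

lemma cov_lag_even_nonneg: "pow.L2 f \<Longrightarrow> 0 \<le> cov_lag \<pi> Q f f (2 * n)"
  using form_square_nonneg[OF L2_centre] by (simp add: cov_lag_eq_form(1))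

end

section \<open>An ergodic theorem\<close>

text \<open>The maximum of 0 and the first \<open>n\<close> partial sums of \<open>f\<close> along
  the orbit of \<open>x\<close>. Peeling off the first point of the orbit rather than the last
  exhibits \<open>f\<close> as an increment between \<open>x\<close> and \<open>T x\<close>, as in
  the maximal ergodic lemma.\<close>

fun max_psum :: "('s \<Rightarrow> 's) \<Rightarrow> ('s \<Rightarrow> real) \<Rightarrow> nat \<Rightarrow> 's \<Rightarrow> real" where
  "max_psum T f 0 x = 0"
| "max_psum T f (Suc n) x = max 0 (f x + max_psum T f n (T x))"

lemma max_psum_nonneg: "0 \<le> max_psum T f n x"
  by (cases n) auto

lemma max_psum_mono: "max_psum T f n x \<le> max_psum T f (Suc n) x"
proof (induction n arbitrary: x)
  case (Suc n)
  from Suc[of "T x"] show ?case by (simp only: max_psum.simps)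
qed simp

lemma psum_le_max_psum: "(\<Sum>i<n. f ((T ^^ i) x)) \<le> max_psum T f n x"
proof (induction n arbitrary: x)
  case (Suc n)
  have "(\<Sum>i<Suc n. f ((T ^^ i) x)) = f x + (\<Sum>i<n. f ((T ^^ i) (T x)))"
    by (subst sum.lessThan_Suc_shift) (simp add: funpow_swap1)
  with Suc[of "T x"] show ?case by simp
qed simp

lemma max_psum_unbounded_nat:
  "(\<forall>k::nat. \<exists>n. real k < max_psum T f n x) \<longleftrightarrow> (\<forall>B. \<exists>n. B < max_psum T f n x)"
proof (intro iffI allI)
  fix B assume unb: "\<forall>k::nat. \<exists>n. real k < max_psum T f n x"
  obtain k :: nat where "B < real k" using reals_Archimedean2 by blast
  moreover obtain n where "real k < max_psum T f n x" using unb by blast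
  ultimately have "B < max_psum T f n x" by linarith
  then show "\<exists>n. B < max_psum T f n x" ..
qed simp

text \<open>Makes the set of points with unbounded partial sums equal to its own preimage, so that
  the strict form of ergodicity applies to it.\<close>

lemma max_psum_unbounded_T:
  "(\<forall>B. \<exists>n. B < max_psum T f n (T x)) \<longleftrightarrow> (\<forall>B. \<exists>n. B < max_psum T f n x)"
proof (intro iffI allI)
  fix B assume unb: "\<forall>B. \<exists>n. B < max_psum T f n (T x)"
  obtain n where "B - f x < max_psum T f n (T x)" using spec[OF unb] by blast
  then have "B < max_psum T f (Suc n) x" by simp
  then show "\<exists>n. B < max_psum T f n x" ..
next
  fix B assume unb: "\<forall>B. \<exists>n. B < max_psum T f n x"
  obtain n where n: "max 0 (B + f x) < max_psum T f n x" using spec[OF unb] by blast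
  then obtain k where "n = Suc k" by (cases n) auto
  with n have "B < max_psum T f k (T x)" by (auto simp: max_def split: if_splits)
  then show "\<exists>n. B < max_psum T f n (T x)" ..
qed

locale mpt = prob_space M for M :: "'s measure" +
  fixes T :: "'s \<Rightarrow> 's"
  assumes T[measurable]: "T \<in> measurable M M"
    and distr_T: "distr M M T = M"
begin

lemma integrable_T: 
  assumes "integrable M (f :: 's \<Rightarrow> real)"
  shows "integrable M (\<lambda>x. f (T x))"
  using assms integrable_distr_eq[OF T, of f] distr_T by auto

lemma integral_T:
  assumes [measurable]: "f \<in> borel_measurable M"
  shows "(\<integral>x. f (T x) \<partial>M) = (\<integral>x. f x \<partial>M :: real)"
  using integral_distr[OF T, of f] distr_T by auto

lemma integrable_max_psum:
  assumes "integrable M f"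
  shows "integrable M (max_psum T f n)"
proof (induction n)
  case 0 then show ?case by simp
next
  case (Suc n)
  have "integrable M (\<lambda>x. max 0 (f x + max_psum T f n (T x)))"
    using assms integrable_T[OF Suc] by (intro integrable_max Bochner_Integration.integrable_add) auto
  then show ?case by simp
qed

end

locale ergodic_mpt = mpt +
  assumes ergodic: "\<And>A. A \<in> sets M \<Longrightarrow> T -` A \<inter> space M = A \<Longrightarrow> measure M A = 0 \<or> measure M A = 1"
begin

text \<open>If the maximal partial sums were unbounded, then by ergodicity they would be so almost
  everywhere, and the increments \<open>max_psum (n+1) x - max_psum n (T x) = max (- max_psum n (T x)) (f x)\<close>
  would decrease to \<open>f\<close>; their integrals are nonnegative by invariance, forcing \<open>\<integral>f \<ge> 0\<close>.\<close>
lemma AE_bounded_max_psum: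
  assumes f: "integrable M f" and neg: "(\<integral>x. f x \<partial>M) < 0"
  shows "AE x in M. \<exists>B. \<forall>n. max_psum T f n x \<le> B"
proof -
  have m[measurable]: "max_psum T f n \<in> borel_measurable M" for n
    using integrable_max_psum[OF f] by auto
  define A where "A = {x \<in> space M. \<forall>B::nat. \<exists>n. max_psum T f n x > real B}"
  have A[measurable]: "A \<in> sets M" unfolding A_def by measurable
  have bd: "x \<in> A \<longleftrightarrow> x \<in> space M \<and> (\<forall>B. \<exists>n. max_psum T f n x > B)" for x
    unfolding A_def mem_Collect_eq max_psum_unbounded_nat ..
  have T_sp: "x \<in> space M \<Longrightarrow> T x \<in> space M" for x using T by (rule measurable_space)
  have inv: "T -` A \<inter> space M = A"
    unfolding set_eq_iff Int_iff vimage_eq bd max_psum_unbounded_T using T_sp by blast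
  have "measure M A = 0 \<or> measure M A = 1" using ergodic[OF A inv] .
  moreover have "measure M A \<noteq> 1"
  proof
    assume "measure M A = 1"
    then have AE: "AE x in M. x \<in> A" by (simp add: AE_prob_1)
    have AET: "AE x in M. T x \<in> A"
      using AE
    proof eventually_elim
      case (elim x)
      then have "x \<in> T -` A \<inter> space M" by (simp only: inv)
      then show ?case by simp
    qed
    let ?D = "\<lambda>n x. max (- max_psum T f n (T x)) (f x)"
    have lim: "(\<lambda>n. \<integral>x. ?D n x \<partial>M) \<longlonglongrightarrow> (\<integral>x. f x \<partial>M)"
    proof (rule integral_dominated_convergence[where w="\<lambda>x. \<bar>f x\<bar>"])
      show "AE x in M. (\<lambda>n. ?D n x) \<longlonglongrightarrow> f x"
        using AET
      proof eventually_elim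
        case (elim x)
        then obtain N where N: "- f x < max_psum T f N (T x)" by (auto simp: bd)
        have "\<forall>\<^sub>F n in sequentially. ?D n x = f x"
          using eventually_ge_at_top[of N]
        proof eventually_elim
          case (elim n)
          then have "max_psum T f N (T x) \<le> max_psum T f n (T x)"
            using lift_Suc_mono_le[of "\<lambda>n. max_psum T f n (T x)" N n, OF max_psum_mono] by simp
          then show ?case using N by auto
        qed
        then show ?case by (rule tendsto_eventually)
      qed
      show "AE x in M. norm (?D n x) \<le> \<bar>f x\<bar>" for n
      proof (rule AE_I2)
        fix x show "norm (?D n x) \<le> \<bar>f x\<bar>" using max_psum_nonneg[of T f n "T x"] by auto
      qed
    qed (use f in auto)
    have "0 \<le> (\<integral>x. ?D n x \<partial>M)" for n
    proof -
      have "(\<integral>x. ?D n x \<partial>M) = (\<integral>x. max_psum T f (Suc n) x - max_psum T f n (T x) \<partial>M)"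
        by (intro Bochner_Integration.integral_cong) auto
      also have "\<dots> = (\<integral>x. max_psum T f (Suc n) x \<partial>M) - (\<integral>x. max_psum T f n x \<partial>M)"
        using integrable_max_psum[OF f] integrable_T[OF integrable_max_psum[OF f]]
        by (simp add: integral_T del: max_psum.simps)
      also have "\<dots> \<ge> 0"
        using integral_mono[OF integrable_max_psum[OF f] integrable_max_psum[OF f] max_psum_mono]
        by (simp del: max_psum.simps)
      finally show ?thesis .
    qed
    then have "0 \<le> (\<integral>x. f x \<partial>M)" using lim by (auto intro: LIMSEQ_le_const)
    with neg show False by simp
  qed
  ultimately have "A \<in> null_sets M"
    using A by (auto simp: null_sets_def emeasure_eq_measure)
  then have "AE x in M. x \<notin> A" by (rule AE_not_in)
  then show ?thesis
    using AE_space
  proof eventually_elim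
    case (elim x)
    then obtain B where "\<not> (\<exists>n. B < max_psum T f n x)" unfolding bd by blast
    then show ?case by (auto simp: not_less)
  qed
qed

text \<open>The function \<open>f - c\<close> has negative mean, so its partial sums stay below some
  \<open>B\<close> depending on the point. The averages of \<open>f\<close> then exceed
  \<open>c\<close> by at most \<open>B / n\<close>.\<close>

lemma AE_eventually_avg_le:
  assumes f: "integrable M f" and c: "(\<integral>x. f x \<partial>M) < c"
  shows "AE x in M. \<forall>e>0. \<forall>\<^sub>F n in sequentially. (\<Sum>i<n. f ((T ^^ i) x)) / real n \<le> c + e"
proof -
  have "AE x in M. \<exists>B. \<forall>n. max_psum T (\<lambda>x. f x - c) n x \<le> B"
    by (rule AE_bounded_max_psum) (use f c in \<open>auto simp: prob_space\<close>)
  then show ?thesis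
  proof eventually_elim
    case (elim x)
    then obtain B where B: "\<And>n. max_psum T (\<lambda>x. f x - c) n x \<le> B" by blast
    show ?case
    proof (intro allI impI)
      fix e :: real assume "e > 0"
      have "((\<lambda>n. B / real n) \<longlongrightarrow> 0) sequentially" by (rule lim_const_over_n)
      then have "\<forall>\<^sub>F n in sequentially. B / real n < e" using \<open>e > 0\<close> by (rule order_tendstoD)
      with eventually_gt_at_top[of 0]
      show "\<forall>\<^sub>F n in sequentially. (\<Sum>i<n. f ((T ^^ i) x)) / real n \<le> c + e"
      proof eventually_elim
        case (elim n)
        have "(\<Sum>i<n. f ((T ^^ i) x) - c) \<le> B"
          using psum_le_max_psum[of "\<lambda>x. f x - c" T x n] B[of n] by linarith
        then have "(\<Sum>i<n. f ((T ^^ i) x)) \<le> B + real n * c" by (simp add: sum_subtractf)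
        then have "(\<Sum>i<n. f ((T ^^ i) x)) / real n \<le> (B + real n * c) / real n"
          by (rule divide_right_mono) simp
        with elim show ?case by (simp add: add_divide_distrib)
      qed
    qed
  qed
qed

text \<open>The one-sided bound for \<open>f\<close> and for \<open>- f\<close>, with
  \<open>c\<close> running through countably many values above the respective mean so that a single
  null set suffices.\<close>

theorem AE_ergodic_average:
  assumes f: "integrable M f"
  shows "AE x in M. (\<lambda>n. (\<Sum>i<n. f ((T ^^ i) x)) / real n) \<longlonglongrightarrow> (\<integral>x. f x \<partial>M)"
proof -
  let ?l = "\<integral>x. f x \<partial>M"
  have 1: "AE x in M. \<forall>k::nat. \<forall>e>0. \<forall>\<^sub>F n in sequentially.
      (\<Sum>i<n. f ((T ^^ i) x)) / real n \<le> (?l + 1 / Suc k) + e"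
    by (intro AE_all_countable[THEN iffD2] allI AE_eventually_avg_le f) auto
  have 2: "AE x in M. \<forall>k::nat. \<forall>e>0. \<forall>\<^sub>F n in sequentially.
      (\<Sum>i<n. - f ((T ^^ i) x)) / real n \<le> (- ?l + 1 / Suc k) + e"
    by (intro AE_all_countable[THEN iffD2] allI AE_eventually_avg_le Bochner_Integration.integrable_minus f) auto
  show ?thesis using 1 2
  proof eventually_elim
    case (elim x)
    show ?case
    proof (rule tendstoI)
      fix e :: real assume e: "e > 0"
      obtain k where k: "1 / real (Suc k) < e / 2"
        using nat_approx_posE[of "e/2"] e by auto
      \<comment> \<open>The excess over the mean is below \<open>e/2\<close> from the choice of
        \<open>k\<close>, plus \<open>e/3\<close>, and hence strictly below
        \<open>e\<close>.\<close>
      have "\<forall>\<^sub>F n in sequentially. (\<Sum>i<n. f ((T ^^ i) x)) / real n \<le> (?l + 1 / Suc k) + e/3"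
        using spec[OF elim(1), of k] e by simp
      moreover have "\<forall>\<^sub>F n in sequentially. (\<Sum>i<n. - f ((T ^^ i) x)) / real n \<le> (- ?l + 1 / Suc k) + e/3"
        using spec[OF elim(2), of k] e by simp
      ultimately show "\<forall>\<^sub>F n in sequentially. dist ((\<Sum>i<n. f ((T ^^ i) x)) / real n) ?l < e"
      proof eventually_elim
        case (elim n)
        then show ?case using k e by (auto simp: dist_real_def abs_less_iff sum_negf)
      qed
    qed
  qed
qed

end

section \<open>The path space of a Markov chain\<close>

abbreviation paths :: "(nat \<Rightarrow> 'a::topological_space) measure" where
  "paths \<equiv> PiM UNIV (\<lambda>_. borel)"

text \<open>All coordinates up to \<open>n\<close> are constrained, matching the events in
  \<open>markov_chain_law\<close>. Since \<open>UNIV\<close> is an admissible constraint, these sets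
  are stable under intersection and generate the product \<sigma>-algebra.\<close>

definition cyl :: "(nat \<Rightarrow> 'a set) \<Rightarrow> nat \<Rightarrow> (nat \<Rightarrow> 'a) set" where
  "cyl A n = {\<omega>. \<forall>k\<le>n. \<omega> k \<in> A k}"

definition cylinders :: "(nat \<Rightarrow> 'a::topological_space) set set" where
  "cylinders = {cyl A n | A n. \<forall>k. A k \<in> sets borel}"

definition shift :: "(nat \<Rightarrow> 'a) \<Rightarrow> nat \<Rightarrow> 'a" where
  "shift \<omega> = (\<lambda>n. \<omega> (Suc n))"

lemma space_paths[simp]: "space paths = UNIV"
  by (simp add: space_PiM)

lemma coord_measurable: "(\<lambda>\<omega>. \<omega> k) \<in> measurable paths borel"
  by (rule measurable_component_singleton) simp

lemma cyl_measurable: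
  assumes "\<And>k. A k \<in> sets borel"
  shows "cyl A n \<in> sets paths"
proof -
  have "cyl A n = (\<Inter>k\<in>{..n}. (\<lambda>\<omega>. \<omega> k) -` A k \<inter> space paths)"
    by (auto simp: cyl_def)
  also have "\<dots> \<in> sets paths"
    using assms by (intro sets.finite_INT measurable_sets[OF coord_measurable]) auto
  finally show ?thesis .
qed

lemma shift_measurable[measurable]: "shift \<in> measurable paths paths"
  unfolding shift_def by (rule measurable_PiM_single') (auto intro: coord_measurable)

lemma shift_funpow: "(shift ^^ i) \<omega> k = \<omega> (i + k)"
  by (induction i arbitrary: \<omega>) (auto simp: funpow_swap1 shift_def)

lemma Int_stable_cylinders: "Int_stable cylinders"
  unfolding Int_stable_def cylinders_def
proof safe
  fix A B :: "nat \<Rightarrow> 'a set" and n m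
  assume "\<forall>k. A k \<in> sets borel" "\<forall>k. B k \<in> sets borel"
  then show "\<exists>C l. cyl A n \<inter> cyl B m = cyl C l \<and> (\<forall>k. C k \<in> sets borel)"
    by (intro exI[of _ "\<lambda>k. (if k \<le> n then A k else UNIV) \<inter> (if k \<le> m then B k else UNIV)"]
        exI[of _ "max n m"]) (auto simp: cyl_def le_max_iff_disj)
qed

lemma sets_paths: "sets (paths :: (nat \<Rightarrow> 'a::topological_space) measure) = sigma_sets UNIV cylinders"
proof (rule antisym)
  have single: "{f. f i \<in> A} \<in> cylinders" if "A \<in> sets borel" for A :: "'a set" and i
    unfolding cylinders_def using that
    by (intro CollectI exI[of _ "\<lambda>k. if k = i then A else UNIV"] exI[of _ i]) (auto simp: cyl_def)
  show "sets (paths :: (nat \<Rightarrow> 'a) measure) \<subseteq> sigma_sets UNIV cylinders"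
    unfolding sets_PiM_single
  proof (simp, rule sigma_sets_mono, safe)
    fix i and A :: "'a set" assume "A \<in> sets borel"
    then show "{f. f i \<in> A} \<in> sigma_sets UNIV cylinders" by (intro sigma_sets.Basic single)
  qed
  have "sigma_sets (space paths) cylinders \<subseteq> sets paths"
    by (rule sets.sigma_sets_subset) (auto simp: cylinders_def cyl_measurable)
  then show "sigma_sets UNIV cylinders \<subseteq> sets paths" by simp
qed

lemma paths_measure_eqI:
  assumes "sets M = sets paths" "sets N = sets paths" "finite_measure M"
    and eq: "\<And>A n. (\<And>k. A k \<in> sets borel) \<Longrightarrow> emeasure M (cyl A n) = emeasure N (cyl A n)"
  shows "M = N"
proof (rule measure_eqI_generator_eq[OF Int_stable_cylinders])
  interpret M: finite_measure M by fact
  have "UNIV \<in> (cylinders :: (nat \<Rightarrow> 'a) set set)"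
    unfolding cylinders_def by (auto simp: cyl_def intro!: exI[of _ "\<lambda>_. UNIV"])
  then show "range (\<lambda>_::nat. UNIV) \<subseteq> (cylinders :: (nat \<Rightarrow> 'a) set set)" by auto
  show "emeasure M UNIV \<noteq> \<infinity>" by simp
qed (use assms in \<open>auto simp: cylinders_def sets_paths\<close>)

lemma fdd_shift: "fdd Q A m (Suc k) y = fdd Q (\<lambda>i. A (Suc i)) m k y"
proof (induction m arbitrary: k y)
  case (Suc m)
  then have "fdd Q A m (Suc (Suc k)) = fdd Q (\<lambda>i. A (Suc i)) m (Suc k)" by blast
  then show ?case by simp
qed simp

text \<open>The first term of a sequence does not affect its limit of averages. Both directions are
  required, because the convergence event has to be shift-invariant as a set.\<close>

lemma average_Suc_iff:
  fixes y :: "nat \<Rightarrow> real"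
  shows "(\<lambda>n. (\<Sum>i<n. y (Suc i)) / real n) \<longlonglongrightarrow> l \<longleftrightarrow> (\<lambda>n. (\<Sum>i<n. y i) / real n) \<longlonglongrightarrow> l"
proof -
  have *: "(\<lambda>n. real (Suc n) / real n) \<longlonglongrightarrow> 1" "(\<lambda>n. real n / real (Suc n)) \<longlonglongrightarrow> 1"
    using LIMSEQ_Suc_n_over_n LIMSEQ_n_over_Suc_n by auto
  have y0: "(\<lambda>n. y 0 / real n) \<longlonglongrightarrow> 0" "(\<lambda>n. y 0 / real (Suc n)) \<longlonglongrightarrow> 0"
    using lim_const_over_n LIMSEQ_Suc[OF lim_const_over_n] by auto
  have sum: "(\<Sum>i<Suc n. y i) = y 0 + (\<Sum>i<n. y (Suc i))" for n
    by (rule sum.lessThan_Suc_shift)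
  have "(\<lambda>n. (\<Sum>i<n. y i) / real n) \<longlonglongrightarrow> l \<longleftrightarrow> (\<lambda>n. (\<Sum>i<Suc n. y i) / real (Suc n)) \<longlonglongrightarrow> l"
    by (rule filterlim_sequentially_Suc[symmetric])
  also have "\<dots> \<longleftrightarrow> (\<lambda>n. (\<Sum>i<n. y (Suc i)) / real n) \<longlonglongrightarrow> l"
  proof
    assume A: "(\<lambda>n. (\<Sum>i<Suc n. y i) / real (Suc n)) \<longlonglongrightarrow> l"
    have "(\<lambda>n. (\<Sum>i<Suc n. y i) / real (Suc n) * (real (Suc n) / real n) - y 0 / real n) \<longlonglongrightarrow> l * 1 - 0"
      by (intro tendsto_intros A * y0)
    then have "(\<lambda>n. (\<Sum>i<Suc n. y i) / real (Suc n) * (real (Suc n) / real n) - y 0 / real n) \<longlonglongrightarrow> l" by simp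
    then show "(\<lambda>n. (\<Sum>i<n. y (Suc i)) / real n) \<longlonglongrightarrow> l"
      by (rule Lim_transform_eventually)
        (auto intro!: eventually_sequentiallyI[of 1] simp: sum field_simps simp del: sum.lessThan_Suc of_nat_Suc)
  next
    assume A: "(\<lambda>n. (\<Sum>i<n. y (Suc i)) / real n) \<longlonglongrightarrow> l"
    have "(\<lambda>n. (\<Sum>i<n. y (Suc i)) / real n * (real n / real (Suc n)) + y 0 / real (Suc n)) \<longlonglongrightarrow> l * 1 + 0"
      by (intro tendsto_intros A * y0)
    then have "(\<lambda>n. (\<Sum>i<n. y (Suc i)) / real n * (real n / real (Suc n)) + y 0 / real (Suc n)) \<longlonglongrightarrow> l" by simp
    then show "(\<lambda>n. (\<Sum>i<Suc n. y i) / real (Suc n)) \<longlonglongrightarrow> l"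
      by (rule Lim_transform_eventually)
        (auto intro!: eventually_sequentiallyI[of 1] simp: sum field_simps simp del: sum.lessThan_Suc of_nat_Suc)
  qed
  finally show ?thesis by simp
qed

text \<open>The number of \<open>i\<close> in \<open>1..m\<close> with \<open>i <= m * h x\<close>
  is the floor of \<open>m * h x\<close>. Hence \<open>m\<close> times the integral of
  \<open>h\<close> differs from a sum of \<open>m\<close> set measures by at most 1, uniformly over
  all probability measures, and setwise convergence handles the finite sum.\<close>

lemma tendsto_integral_of_setwise:
  fixes h :: "'a \<Rightarrow> real"
  assumes \<mu>: "\<And>n. prob_space (\<mu> n)" "\<And>n. sets (\<mu> n) = sets N" and \<nu>: "prob_space \<nu>" "sets \<nu> = sets N"
    and conv: "\<And>A. A \<in> sets N \<Longrightarrow> (\<lambda>n. measure (\<mu> n) A) \<longlonglongrightarrow> measure \<nu> A"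
    and h[measurable]: "h \<in> borel_measurable N" and h01: "\<And>x. 0 \<le> h x" "\<And>x. h x \<le> 1"
  shows "(\<lambda>n. \<integral>x. h x \<partial>\<mu> n) \<longlonglongrightarrow> (\<integral>x. h x \<partial>\<nu>)"
proof -
  define L where "L m i = {x \<in> space N. real i \<le> real m * h x}" for m i :: nat
  have L[measurable]: "L m i \<in> sets N" for m i unfolding L_def by measurable
  have approx: "\<bar>real m * (\<integral>x. h x \<partial>M) - (\<Sum>i=1..m. measure M (L m i))\<bar> \<le> 1"
    if M: "prob_space M" "sets M = sets N" for M m
  proof -
    interpret prob_space M by fact
    have sp: "space M = space N" using M(2) by (rule sets_eq_imp_space_eq)
    have [measurable]: "h \<in> borel_measurable M" using h M(2) by (simp cong: measurable_cong_sets)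
    have Lm: "L m i \<in> events" for i using M(2) by simp
    have ih: "integrable M h" by (rule integrable_const_bound[of _ 1]) (use h01 in auto)
    have "(\<Sum>i=1..m. measure M (L m i)) = (\<integral>x. (\<Sum>i=1..m. indicator (L m i) x) \<partial>M)"
      using Lm by (subst Bochner_Integration.integral_sum) (auto intro!: integrable_real_indicator simp: less_top[symmetric])
    moreover have si: "integrable M (\<lambda>x. (\<Sum>i=1..m. indicator (L m i) x :: real))"
      using Lm by (intro Bochner_Integration.integrable_sum integrable_real_indicator) (auto simp: less_top[symmetric])
    ultimately have "real m * (\<integral>x. h x \<partial>M) - (\<Sum>i=1..m. measure M (L m i)) =
        (\<integral>x. real m * h x - (\<Sum>i=1..m. indicator (L m i) x) \<partial>M)"
      using ih by simp
    also have "\<bar>\<dots>\<bar> \<le> (\<integral>x. \<bar>real m * h x - (\<Sum>i=1..m. indicator (L m i) x)\<bar> \<partial>M)"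
      by (rule integral_abs_bound)
    also have "\<dots> \<le> (\<integral>x. 1 \<partial>M)"
    proof (rule integral_mono)
      fix x assume x: "x \<in> space M"
      have "{1..m} \<inter> {i. x \<in> L m i} = {1..nat \<lfloor>real m * h x\<rfloor>}"
      proof -
        have "real m * h x \<le> real m" using h01(2)[of x] by (simp add: mult_left_le)
        then have "i \<le> m" if "real i \<le> real m * h x" for i using that by linarith
        moreover have "real i \<le> real m * h x \<longleftrightarrow> i \<le> nat \<lfloor>real m * h x\<rfloor>" for i
          using h01(1)[of x] by (simp add: le_nat_iff le_floor_iff)
        ultimately show ?thesis using x sp by (auto simp: L_def)
      qed
      then have "(\<Sum>i=1..m. indicator (L m i) x :: real) = real (nat \<lfloor>real m * h x\<rfloor>)"
        by (simp add: indicator_def sum.If_cases)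
      moreover have "real (nat \<lfloor>real m * h x\<rfloor>) \<le> real m * h x" "real m * h x \<le> real (nat \<lfloor>real m * h x\<rfloor>) + 1"
        using h01(1)[of x] by (auto simp: of_nat_nat)
      ultimately show "\<bar>real m * h x - (\<Sum>i=1..m. indicator (L m i) x)\<bar> \<le> 1" by linarith
    qed (use ih si in auto)
    finally show ?thesis by (simp add: prob_space)
  qed
  show ?thesis
  proof (rule tendstoI)
    fix e :: real assume e: "e > 0"
    \<comment> \<open>An approximation error of at most 1 for each of the two measures and a
      deviation below 1 of the finite sums add up to less than 3; dividing by \<open>m\<close>
      brings this below \<open>e\<close>.\<close>
    obtain m :: nat where m: "3 / e < real m" using reals_Archimedean2 by blast
    then have m0: "real m > 0" using e by (meson divide_pos_pos less_trans zero_less_numeral)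
    have "(\<lambda>n. \<Sum>i=1..m. measure (\<mu> n) (L m i)) \<longlonglongrightarrow> (\<Sum>i=1..m. measure \<nu> (L m i))"
      by (intro tendsto_sum conv L)
    then have "\<forall>\<^sub>F n in sequentially. dist (\<Sum>i=1..m. measure (\<mu> n) (L m i)) (\<Sum>i=1..m. measure \<nu> (L m i)) < 1"
      by (rule tendstoD) simp
    then show "\<forall>\<^sub>F n in sequentially. dist (\<integral>x. h x \<partial>\<mu> n) (\<integral>x. h x \<partial>\<nu>) < e"
    proof eventually_elim
      case (elim n)
      have "\<bar>real m * (\<integral>x. h x \<partial>\<mu> n) - real m * (\<integral>x. h x \<partial>\<nu>)\<bar> < 3"
        using elim approx[OF \<mu>(1)[of n] \<mu>(2)[of n], of m] approx[OF \<nu>, of m] by (simp add: dist_real_def)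
      then have "real m * \<bar>(\<integral>x. h x \<partial>\<mu> n) - (\<integral>x. h x \<partial>\<nu>)\<bar> < 3"
        using m0 by (simp add: abs_mult flip: right_diff_distrib)
      moreover have "3 < e * real m" using m e by (simp add: field_simps)
      ultimately have "real m * \<bar>(\<integral>x. h x \<partial>\<mu> n) - (\<integral>x. h x \<partial>\<nu>)\<bar> < real m * e" by (simp add: mult.commute)
      then show ?case using m0 by (simp add: dist_real_def)
    qed
  qed
qed

section \<open>The chain on path space and the Markov property\<close>

locale markov = transition_kernel Q for Q :: "'a::polish_space \<Rightarrow> 'a measure" +
  fixes Px :: "'a \<Rightarrow> 'b measure" and X :: "nat \<Rightarrow> 'b \<Rightarrow> 'a"
  assumes chain: "markov_chain_law Q Px X"
begin

text \<open>The abstract sample space \<open>'b\<close> carries no shift. On sequences there is one,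
  and there the law is determined by the cylinder probabilities.\<close>

definition path_law :: "'a \<Rightarrow> (nat \<Rightarrow> 'a) measure" where
  "path_law x = distr (Px x) paths (\<lambda>\<omega> t. X t \<omega>)"

lemma path_measurable: "(\<lambda>\<omega> t. X t \<omega>) \<in> measurable (Px x) paths"
  using chain by (intro measurable_PiM_single') (auto simp: markov_chain_law_def)

lemma sets_path_law[simp, measurable_cong]: "sets (path_law x) = sets paths"
  by (simp add: path_law_def)

lemma space_path_law[simp]: "space (path_law x) = UNIV"
  by (simp add: path_law_def)

lemma prob_space_path_law: "prob_space (path_law x)"
  unfolding path_law_def using chain path_measurable
  by (intro prob_space.prob_space_distr) (auto simp: markov_chain_law_def)

lemma measure_path_law_cyl:
  assumes "\<And>k. A k \<in> sets borel"
  shows "measure (path_law x) (cyl A n) = fdd Q A n 0 x"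
proof -
  have "measure (path_law x) (cyl A n) = measure (Px x) ((\<lambda>\<omega> t. X t \<omega>) -` cyl A n \<inter> space (Px x))"
    unfolding path_law_def by (rule measure_distr[OF path_measurable cyl_measurable[OF assms]])
  also have "(\<lambda>\<omega> t. X t \<omega>) -` cyl A n \<inter> space (Px x) = {\<omega> \<in> space (Px x). \<forall>k\<le>n. X k \<omega> \<in> A k}"
    by (auto simp: cyl_def)
  finally show ?thesis using chain assms by (simp add: markov_chain_law_def)
qed

lemma emeasure_path_law_cyl:
  assumes "\<And>k. A k \<in> sets borel"
  shows "emeasure (path_law x) (cyl A n) = ennreal (fdd Q A n 0 x)"
proof -
  interpret prob_space "path_law x" by (rule prob_space_path_law)
  have "measure (path_law x) (cyl A n) = fdd Q A n 0 x" using assms by (rule measure_path_law_cyl)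
  then show ?thesis by (simp add: emeasure_eq_measure)
qed

lemma fdd_bounds:
  assumes "\<And>k. A k \<in> sets borel"
  shows "0 \<le> fdd Q A n 0 x" "fdd Q A n 0 x \<le> 1"
proof -
  have "measure (path_law x) (cyl A n) = fdd Q A n 0 x" using assms by (rule measure_path_law_cyl)
  then show "0 \<le> fdd Q A n 0 x" "fdd Q A n 0 x \<le> 1"
    using prob_space.prob_le_1[OF prob_space_path_law, of x "cyl A n"] measure_nonneg[of "path_law x" "cyl A n"] by linarith+
qed

lemma fdd_measurable:
  assumes [measurable]: "\<And>k. A k \<in> sets borel"
  shows "fdd Q A n k \<in> borel_measurable borel"
proof (induction n arbitrary: k)
  case 0
  have "(\<lambda>y. indicator (A k) y) \<in> borel_measurable borel" by measurable
  then show ?case by (simp add: fun_eq_iff[symmetric] cong: measurable_cong)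
next
  case (Suc n)
  have [measurable]: "(\<lambda>M. integral\<^sup>L M (fdd Q A n (Suc k))) \<in> borel_measurable (subprob_algebra borel)"
    by (rule integral_measurable_subprob_algebra[OF Suc])
  have "(\<lambda>y. indicator (A k) y * integral\<^sup>L (Q y) (fdd Q A n (Suc k))) \<in> borel_measurable borel"
    by measurable
  then show ?case by (simp cong: measurable_cong)
qed

text \<open>Measurability in the starting point is obtained on the generating cylinders, whose
  probabilities are the functions \<open>fdd\<close>, themselves measurable by recursion through the
  kernel.\<close>

lemma path_law_measurable[measurable]: "path_law \<in> measurable borel (prob_algebra paths)"
proof (rule measurable_prob_algebra_generated[OF sets_paths Int_stable_cylinders])
  fix C :: "(nat \<Rightarrow> 'a) set" assume "C \<in> cylinders"
  then obtain A n where A: "C = cyl A n" "\<And>k. A k \<in> sets borel" by (auto simp: cylinders_def)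
  have [measurable]: "fdd Q A n 0 \<in> borel_measurable borel" using A(2) by (rule fdd_measurable)
  show "(\<lambda>x. emeasure (path_law x) C) \<in> borel_measurable borel"
    unfolding A(1) emeasure_path_law_cyl[OF A(2)] by measurable
qed (auto simp: prob_space_path_law)

lemma path_law_measurable_subprob[measurable]: "path_law \<in> measurable borel (subprob_algebra paths)"
  by (rule measurable_prob_algebraD) simp

lemma case_nat_measurable[measurable]: "case_nat x \<in> measurable paths (paths :: (nat \<Rightarrow> 'a) measure)"
proof -
  have "(\<lambda>\<omega>. case_nat x \<omega>) \<in> measurable paths (paths :: (nat \<Rightarrow> 'a) measure)" by measurable
  then show ?thesis by simp
qed

text \<open>The Markov property at time 1: a path from \<open>x\<close> is \<open>x\<close> put in
  front of a path whose starting point has law \<open>Q x\<close>. On cylinders this is the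
  recursion of \<open>fdd\<close>.\<close>

lemma path_law_decomp: "path_law x = bind (Q x) (\<lambda>y. distr (path_law y) paths (case_nat x))"
proof -
  let ?L = "\<lambda>y. distr (path_law y) paths (case_nat x)"
  have L: "?L \<in> measurable borel (prob_algebra paths)"
    by (rule measurable_compose[OF path_law_measurable measurable_distr_prob_space[OF case_nat_measurable]])
  show ?thesis
  proof (rule paths_measure_eqI)
    show "sets (bind (Q x) ?L) = sets paths" by (rule sets_bind'[OF Q_in_prob_algebra L])
    show "finite_measure (path_law x)" using prob_space_path_law by (rule prob_space.finite_measure)
    fix A :: "nat \<Rightarrow> 'a set" and n assume A: "\<And>k. A k \<in> sets borel"
    have cylA: "emeasure (path_law x) (cyl A n) = ennreal (fdd Q A n 0 x)" using A by (rule emeasure_path_law_cyl)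
    have "emeasure (bind (Q x) ?L) (cyl A n) = (\<integral>\<^sup>+y. emeasure (?L y) (cyl A n) \<partial>Q x)"
      by (rule emeasure_bind_prob_algebra[OF Q_in_prob_algebra L cyl_measurable[OF A]])
    also have "\<dots> = (\<integral>\<^sup>+y. emeasure (path_law y) (case_nat x -` cyl A n) \<partial>Q x)"
      using cyl_measurable[OF A] by (subst emeasure_distr) auto
    also have "\<dots> = emeasure (path_law x) (cyl A n)"
    proof (cases n)
      case 0
      have "case_nat x -` cyl A n = (if x \<in> A 0 then UNIV else {})" using 0 by (auto simp: cyl_def)
      then show ?thesis
        using cylA 0 prob_space.emeasure_space_1[OF prob_space_path_law]
          prob_space.emeasure_space_1[OF prob_space_Q, of x] by (auto simp: indicator_def)
    next
      case (Suc m)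
      let ?A = "\<lambda>k. A (Suc k)"
      have "case_nat x -` cyl A n = (if x \<in> A 0 then cyl ?A m else {})"
        using Suc by (auto simp: cyl_def less_Suc_eq_le[symmetric] All_less_Suc2 simp del: less_Suc_eq_le)
      then have "(\<integral>\<^sup>+y. emeasure (path_law y) (case_nat x -` cyl A n) \<partial>Q x) =
          indicator (A 0) x * (\<integral>\<^sup>+y. ennreal (fdd Q ?A m 0 y) \<partial>Q x)"
        using emeasure_path_law_cyl[of ?A] A by (auto simp: indicator_def)
      also have "(\<integral>\<^sup>+y. ennreal (fdd Q ?A m 0 y) \<partial>Q x) = ennreal (\<integral>y. fdd Q ?A m 0 y \<partial>Q x)"
      proof (rule nn_integral_eq_integral)
        interpret prob_space "Q x" by (rule prob_space_Q)
        show "integrable (Q x) (fdd Q ?A m 0)"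
          using fdd_bounds[of ?A m] fdd_measurable[of ?A m 0] A
          by (intro integrable_const_bound[of _ 1]) (auto cong: measurable_cong_sets)
      qed (use fdd_bounds[of ?A m] A in auto)
      also have "indicator (A 0) x * \<dots> = ennreal (fdd Q A n 0 x)"
        unfolding Suc fdd.simps fdd_shift by (auto simp: indicator_def)
      finally show ?thesis using cylA by simp
    qed
    finally show "emeasure (path_law x) (cyl A n) = emeasure (bind (Q x) ?L) (cyl A n)" ..
  qed simp
qed

lemma emeasure_path_law_decomp:
  assumes E: "E \<in> sets paths"
  shows "emeasure (path_law x) E = (\<integral>\<^sup>+y. emeasure (path_law y) (case_nat x -` E) \<partial>Q x)"
proof -
  let ?L = "\<lambda>y. distr (path_law y) paths (case_nat x)"
  have L: "?L \<in> measurable borel (prob_algebra paths)"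
    by (rule measurable_compose[OF path_law_measurable measurable_distr_prob_space[OF case_nat_measurable]])
  have "emeasure (path_law x) E = (\<integral>\<^sup>+y. emeasure (?L y) E \<partial>Q x)"
    by (subst path_law_decomp) (rule emeasure_bind_prob_algebra[OF Q_in_prob_algebra L E])
  also have "\<dots> = (\<integral>\<^sup>+y. emeasure (path_law y) (case_nat x -` E) \<partial>Q x)"
    using E by (subst emeasure_distr) auto
  finally show ?thesis .
qed

lemma emeasure_path_law_shift:
  assumes E: "E \<in> sets paths"
  shows "emeasure (path_law x) (shift -` E) = (\<integral>\<^sup>+y. emeasure (path_law y) E \<partial>Q x)"
proof -
  have "shift -` E \<in> sets paths" using measurable_sets[OF shift_measurable E] by simp
  moreover have "case_nat x -` (shift -` E) = E" by (auto simp: shift_def)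
  ultimately show ?thesis using emeasure_path_law_decomp by simp
qed

text \<open>The Markov property at time \<open>n\<close>. For shift-invariant \<open>E\<close> the
  left side does not depend on \<open>n\<close>, and the formula makes the probability of
  \<open>E\<close> harmonic.\<close>

lemma emeasure_path_law_funpow_shift:
  assumes E: "E \<in> sets paths"
  shows "emeasure (path_law x) ((shift ^^ n) -` E) = (\<integral>\<^sup>+y. emeasure (path_law y) E \<partial>kernel_pow Q n x)"
  using E
proof (induction n arbitrary: E)
  case 0
  then show ?case by (simp add: nn_integral_return)
next
  case (Suc n)
  have sE: "shift -` E \<in> sets paths" using measurable_sets[OF shift_measurable Suc(2)] by simp
  have [measurable]: "(\<lambda>y. emeasure (path_law y) E) \<in> borel_measurable borel"
    using Suc(2) by measurable
  have "(shift ^^ Suc n) -` E = (shift ^^ n) -` (shift -` E)" by (auto)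
  then have "emeasure (path_law x) ((shift ^^ Suc n) -` E) = (\<integral>\<^sup>+y. emeasure (path_law y) (shift -` E) \<partial>kernel_pow Q n x)"
    using Suc(1)[OF sE] by simp
  also have "\<dots> = (\<integral>\<^sup>+y. (\<integral>\<^sup>+z. emeasure (path_law z) E \<partial>Q y) \<partial>kernel_pow Q n x)"
    using Suc(2) by (simp add: emeasure_path_law_shift)
  also have "\<dots> = (\<integral>\<^sup>+y. emeasure (path_law y) E \<partial>kernel_pow Q (Suc n) x)"
    by (simp, subst nn_integral_bind[of _ borel]) (auto simp: measurable_cong_sets[OF sets_kernel_pow refl])
  finally show ?case .
qed

lemma distr_path_law_coord: "distr (path_law x) borel (\<lambda>\<omega>. \<omega> n) = kernel_pow Q n x"
proof (rule measure_eqI)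
  fix A assume "A \<in> sets (distr (path_law x) borel (\<lambda>\<omega>. \<omega> n))"
  then have A: "A \<in> sets borel" by simp
  have E: "(\<lambda>\<omega>. \<omega> 0) -` A \<in> sets (paths :: (nat \<Rightarrow> 'a) measure)"
    using measurable_sets[OF coord_measurable A, of 0] by simp
  have "emeasure (path_law y) ((\<lambda>\<omega>. \<omega> 0) -` A) = indicator A y" for y
  proof -
    have "(\<lambda>\<omega>. \<omega> 0) -` A = cyl (\<lambda>_. A) 0" by (auto simp: cyl_def)
    then show ?thesis using emeasure_path_law_cyl[of "\<lambda>_. A" y 0] A by (auto simp: indicator_def)
  qed
  moreover have "(\<lambda>\<omega>. \<omega> n) -` A = (shift ^^ n) -` ((\<lambda>\<omega>. \<omega> 0) -` A)"
    by (auto simp: shift_funpow)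
  ultimately show "emeasure (distr (path_law x) borel (\<lambda>\<omega>. \<omega> n)) A = emeasure (kernel_pow Q n x) A"
    using emeasure_path_law_funpow_shift[OF E, of x n] A by (simp add: emeasure_distr)
qed simp

lemma AE_path_law_start: "AE \<omega> in path_law x. \<omega> 0 = x"
proof -
  have "measure (path_law x) (cyl (\<lambda>_. {x}) 0) = fdd Q (\<lambda>_. {x}) 0 0 x"
    by (intro measure_path_law_cyl borel_closed closed_singleton)
  then have "measure (path_law x) (cyl (\<lambda>_. {x}) 0) = 1" by simp
  then have "AE \<omega> in path_law x. \<omega> \<in> cyl (\<lambda>_. {x}) 0"
    by (rule prob_space.AE_prob_1[OF prob_space_path_law])
  then show ?thesis by (simp add: cyl_def)
qed

end

section \<open>Zero-one law and ergodic averages from every starting point\<close>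

locale ergodic_markov = markov +
  fixes \<pi> :: "'a measure"
  assumes prob_space_pi: "prob_space \<pi>" and sets_pi[simp, measurable_cong]: "sets \<pi> = sets borel"
    and stationary: "\<And>A. A \<in> sets borel \<Longrightarrow> (\<integral>\<^sup>+x. emeasure (Q x) A \<partial>\<pi>) = emeasure \<pi> A"
    and setwise_conv: "\<And>x A. A \<in> sets borel \<Longrightarrow> (\<lambda>n. measure (kernel_pow Q n x) A) \<longlonglongrightarrow> measure \<pi> A"
begin

definition stat_law :: "(nat \<Rightarrow> 'a) measure" where
  "stat_law = bind \<pi> path_law"

lemma space_pi[simp]: "space \<pi> = UNIV"
  using sets_eq_imp_space_eq[OF sets_pi] by simp

lemma pi_in_prob_algebra: "\<pi> \<in> space (prob_algebra borel)"
  by (simp add: space_prob_algebra prob_space_pi)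

lemma sets_stat_law[simp, measurable_cong]: "sets stat_law = sets paths"
  unfolding stat_law_def by (rule sets_bind'[OF pi_in_prob_algebra path_law_measurable])

lemma space_stat_law[simp]: "space stat_law = UNIV"
  using sets_eq_imp_space_eq[OF sets_stat_law] by simp

lemma prob_space_stat_law: "prob_space stat_law"
  unfolding stat_law_def by (rule prob_space_bind'[OF pi_in_prob_algebra path_law_measurable])

lemma bind_pi_Q: "bind \<pi> Q = \<pi>"
proof (rule measure_eqI)
  fix A assume "A \<in> sets (bind \<pi> Q)"
  then have "A \<in> sets borel" using sets_bind'[OF pi_in_prob_algebra Q_measurable] by simp
  then show "emeasure (bind \<pi> Q) A = emeasure \<pi> A"
    using emeasure_bind_prob_algebra[OF pi_in_prob_algebra Q_measurable] stationary by simp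
qed (simp add: sets_bind'[OF pi_in_prob_algebra Q_measurable])

lemma emeasure_stat_law:
  "E \<in> sets paths \<Longrightarrow> emeasure stat_law E = (\<integral>\<^sup>+x. emeasure (path_law x) E \<partial>\<pi>)"
  unfolding stat_law_def by (rule emeasure_bind_prob_algebra[OF pi_in_prob_algebra path_law_measurable])

lemma distr_stat_law_shift: "distr stat_law stat_law shift = stat_law"
proof (rule measure_eqI)
  fix E assume "E \<in> sets (distr stat_law stat_law shift)"
  then have E: "E \<in> sets paths" by simp
  have sE: "shift -` E \<in> sets paths" using measurable_sets[OF shift_measurable E] by simp
  have [measurable]: "(\<lambda>x. emeasure (path_law x) E) \<in> borel_measurable borel" using E by measurable
  have "emeasure (distr stat_law stat_law shift) E = emeasure stat_law (shift -` E)"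
    using E by (subst emeasure_distr) (auto simp: measurable_cong_sets[OF sets_stat_law sets_stat_law])
  also have "\<dots> = (\<integral>\<^sup>+x. (\<integral>\<^sup>+y. emeasure (path_law y) E \<partial>Q x) \<partial>\<pi>)"
    using E by (simp add: emeasure_stat_law[OF sE] emeasure_path_law_shift)
  also have "\<dots> = (\<integral>\<^sup>+y. emeasure (path_law y) E \<partial>bind \<pi> Q)"
    by (subst nn_integral_bind[of _ borel]) (auto simp: measurable_cong_sets[OF sets_pi refl])
  also have "\<dots> = emeasure stat_law E" by (simp add: bind_pi_Q emeasure_stat_law[OF E])
  finally show "emeasure (distr stat_law stat_law shift) E = emeasure stat_law E" .
qed simp

lemma funpow_shift_invariant: "shift -` E = E \<Longrightarrow> (shift ^^ n) -` E = E"
proof (induction n)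
  case (Suc n)
  have "(shift ^^ Suc n) -` E = (shift ^^ n) -` (shift -` E)" by auto
  with Suc.IH[OF Suc.prems] Suc.prems show ?case by (simp only:)
qed simp

text \<open>The probability of an invariant event is a bounded harmonic function of the starting point,
  hence constant because the \<open>n\<close>-step laws converge to \<open>\<pi>\<close>.\<close>
lemma measure_invariant_event:
  assumes E: "E \<in> sets paths" and inv: "shift -` E = E"
  shows "measure (path_law x) E = measure stat_law E"
proof -
  define h where "h y = measure (path_law y) E" for y
  have h: "emeasure (path_law y) E = ennreal (h y)" "0 \<le> h y" "h y \<le> 1" for y
  proof -
    interpret prob_space "path_law y" by (rule prob_space_path_law)
    show "emeasure (path_law y) E = ennreal (h y)" "0 \<le> h y" "h y \<le> 1"
      by (auto simp: h_def emeasure_eq_measure)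
  qed
  have hm[measurable]: "h \<in> borel_measurable borel"
    unfolding h_def using E by measurable
  have eq: "(\<integral>\<^sup>+y. emeasure (path_law y) E \<partial>N) = ennreal (\<integral>y. h y \<partial>N)" if N: "prob_space N" "sets N = sets borel" for N
  proof -
    interpret prob_space N by fact
    have [measurable]: "h \<in> borel_measurable N" using hm N(2) by (simp cong: measurable_cong_sets)
    show ?thesis unfolding h(1)
      by (intro nn_integral_eq_integral integrable_const_bound[of _ 1]) (auto simp: h)
  qed
  have "h x = (\<integral>y. h y \<partial>kernel_pow Q n x)" for n
  proof -
    have "ennreal (h x) = ennreal (\<integral>y. h y \<partial>kernel_pow Q n x)"
      using emeasure_path_law_funpow_shift[OF E, of x n] eq[OF prob_space_kernel_pow sets_kernel_pow]
      by (simp add: funpow_shift_invariant[OF inv] h)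
    then show ?thesis using h by (simp add: integral_nonneg)
  qed
  moreover have "(\<lambda>n. \<integral>y. h y \<partial>kernel_pow Q n x) \<longlonglongrightarrow> (\<integral>y. h y \<partial>\<pi>)"
    by (rule tendsto_integral_of_setwise[where N=borel])
      (auto intro: prob_space_kernel_pow prob_space_pi setwise_conv h)
  ultimately have "h x = (\<integral>y. h y \<partial>\<pi>)" by (simp add: LIMSEQ_const_iff)
  moreover have "emeasure stat_law E = ennreal (\<integral>y. h y \<partial>\<pi>)"
    using eq[OF prob_space_pi sets_pi] by (simp add: emeasure_stat_law[OF E])
  then have "measure stat_law E = (\<integral>y. h y \<partial>\<pi>)"
    using h by (simp add: measure_def integral_nonneg)
  ultimately show ?thesis by (simp add: h_def)
qed

text \<open>All starting points give \<open>E\<close> the same probability \<open>c\<close>, and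
  prepending a state does not affect membership in \<open>E\<close>. By the Markov property
  \<open>E\<close> is then independent of every cylinder, hence of itself, and
  \<open>c = c * c\<close>.\<close>

lemma zero_one_law:
  assumes E: "E \<in> sets paths" and inv: "shift -` E = E"
  shows "measure stat_law E = 0 \<or> measure stat_law E = 1"
proof -
  define c where "c = measure stat_law E"
  have c: "emeasure (path_law x) E = ennreal c" for x
  proof -
    interpret prob_space "path_law x" by (rule prob_space_path_law)
    show ?thesis using measure_invariant_event[OF E inv] by (simp add: emeasure_eq_measure c_def)
  qed
  have indep: "emeasure (path_law x) (E \<inter> cyl A n) = ennreal c * emeasure (path_law x) (cyl A n)"
    if "\<And>k. A k \<in> sets borel" for A x n
    using that
  proof (induction n arbitrary: A x)
    have case_E: "case_nat x -` E = E" for x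
    proof -
      have "case_nat x -` E = case_nat x -` (shift -` E)" by (simp only: inv)
      also have "\<dots> = E" by (auto simp: shift_def)
      finally show ?thesis .
    qed
    {
      case 0
      have C: "cyl A 0 \<in> sets paths" using 0 by (rule cyl_measurable)
      have "emeasure (path_law x) (E \<inter> cyl A 0) = (\<integral>\<^sup>+y. emeasure (path_law y) (case_nat x -` (E \<inter> cyl A 0)) \<partial>Q x)"
        using E C by (intro emeasure_path_law_decomp) auto
      moreover have "case_nat x -` (E \<inter> cyl A 0) = (if x \<in> A 0 then E else {})"
        using case_E[of x] by (auto simp: cyl_def)
      moreover have "emeasure (path_law x) (cyl A 0) = ennreal (fdd Q A 0 0 x)" using 0 by (rule emeasure_path_law_cyl)
      ultimately show ?case using prob_space.emeasure_space_1[OF prob_space_Q, of x] by (simp add: c)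
    next
      case (Suc n)
      let ?A = "\<lambda>k. A (Suc k)"
      have A': "\<And>k. ?A k \<in> sets borel" using Suc(2) .
      have C: "cyl A (Suc n) \<in> sets paths" using Suc(2) by (rule cyl_measurable)
      have C': "cyl ?A n \<in> sets paths" using A' by (rule cyl_measurable)
      have cyl: "case_nat x -` cyl A (Suc n) = (if x \<in> A 0 then cyl ?A n else {})"
        by (auto simp: cyl_def less_Suc_eq_le[symmetric] All_less_Suc2 simp del: less_Suc_eq_le)
      have "emeasure (path_law x) (E \<inter> cyl A (Suc n)) = (\<integral>\<^sup>+y. emeasure (path_law y) (case_nat x -` (E \<inter> cyl A (Suc n))) \<partial>Q x)"
        using E C by (intro emeasure_path_law_decomp) auto
      also have "\<dots> = (\<integral>\<^sup>+y. ennreal c * emeasure (path_law y) (case_nat x -` cyl A (Suc n)) \<partial>Q x)"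
      proof (rule nn_integral_cong)
        fix y
        show "emeasure (path_law y) (case_nat x -` (E \<inter> cyl A (Suc n))) =
            ennreal c * emeasure (path_law y) (case_nat x -` cyl A (Suc n))"
        proof (cases "x \<in> A 0")
          case True
          then show ?thesis using Suc(1)[of ?A y, OF A'] by (simp only: vimage_Int case_E cyl if_True)
        next
          case False
          then show ?thesis by (simp only: vimage_Int cyl if_False Int_empty_right) simp
        qed
      qed
      also have "\<dots> = ennreal c * (\<integral>\<^sup>+y. emeasure (path_law y) (case_nat x -` cyl A (Suc n)) \<partial>Q x)"
      proof (rule nn_integral_cmult)
        have "(\<lambda>y. emeasure (path_law y) D) \<in> borel_measurable (Q x)" if "D \<in> sets paths" for D
        proof -
          have "(\<lambda>y. emeasure (path_law y) D) \<in> borel_measurable borel" using that by measurable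
          then show ?thesis by (simp add: measurable_cong_sets[OF sets_Q refl])
        qed
        then show "(\<lambda>y. emeasure (path_law y) (case_nat x -` cyl A (Suc n))) \<in> borel_measurable (Q x)"
          using measurable_sets[OF case_nat_measurable C, of x] by simp
      qed
      also have "\<dots> = ennreal c * emeasure (path_law x) (cyl A (Suc n))"
        using C by (simp add: emeasure_path_law_decomp)
      finally show ?case .
    }
  qed
  \<comment> \<open>Any starting point will do, \<open>c\<close> being the same for all of
    them.\<close>
  obtain x :: 'a where True by simp
  interpret x: prob_space "path_law x" by (rule prob_space_path_law)
  have dens: "emeasure (density (path_law x) (indicator E)) C = emeasure (path_law x) (E \<inter> C)" if "C \<in> sets paths" for C
  proof -
    have "emeasure (density (path_law x) (indicator E)) C = (\<integral>\<^sup>+\<omega>. indicator E \<omega> * indicator C \<omega> \<partial>path_law x)"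
      using E that by (intro emeasure_density) auto
    also have "\<dots> = (\<integral>\<^sup>+\<omega>. indicator (E \<inter> C) \<omega> \<partial>path_law x)" by (simp add: indicator_inter_arith)
    also have "\<dots> = emeasure (path_law x) (E \<inter> C)" using E that by (intro nn_integral_indicator) auto
    finally show ?thesis .
  qed
  \<comment> \<open>Independence of cylinders says that these two measures agree on an
    intersection-stable generator. Their equality extends independence to all events, in particular
    to \<open>E\<close>.\<close>
  have "density (path_law x) (indicator E) = density (path_law x) (\<lambda>_. ennreal c)"
  proof (rule paths_measure_eqI)
    show "finite_measure (density (path_law x) (indicator E))"
    proof (rule finite_measureI)
      have "(UNIV :: (nat \<Rightarrow> 'a) set) \<in> sets paths" using sets.top[of paths] by simp
      then show "emeasure (density (path_law x) (indicator E)) (space (density (path_law x) (indicator E))) \<noteq> \<infinity>"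
        by (simp add: dens)
    qed
    fix A :: "nat \<Rightarrow> 'a set" and n assume A: "\<And>k. A k \<in> sets borel"
    have C: "cyl A n \<in> sets paths" using A by (rule cyl_measurable)
    have "emeasure (density (path_law x) (indicator E)) (cyl A n) = emeasure (path_law x) (E \<inter> cyl A n)"
      using C by (rule dens)
    also have "\<dots> = ennreal c * emeasure (path_law x) (cyl A n)" using A by (rule indep)
    also have "\<dots> = emeasure (density (path_law x) (\<lambda>_. ennreal c)) (cyl A n)"
      using C by (simp add: emeasure_density_const)
    finally show "emeasure (density (path_law x) (indicator E)) (cyl A n) =
        emeasure (density (path_law x) (\<lambda>_. ennreal c)) (cyl A n)" .
  qed auto
  then have "emeasure (density (path_law x) (indicator E)) E = emeasure (density (path_law x) (\<lambda>_. ennreal c)) E"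
    by simp
  moreover have "emeasure (density (path_law x) (indicator E)) E = ennreal c"
    using dens[OF E] by (simp add: c)
  moreover have "emeasure (density (path_law x) (\<lambda>_. ennreal c)) E = ennreal c * ennreal c"
    using E by (simp add: emeasure_density_const c)
  ultimately have "ennreal c = ennreal (c * c)" by (simp add: ennreal_mult' c_def)
  then have "c = c * c" by (simp add: c_def)
  then show ?thesis by (auto simp: c_def[symmetric])
qed

sublocale stat: ergodic_mpt stat_law shift
proof (intro ergodic_mpt.intro mpt.intro prob_space_stat_law mpt_axioms.intro ergodic_mpt_axioms.intro)
  show "shift \<in> measurable stat_law stat_law" by (simp add: measurable_cong_sets[OF sets_stat_law sets_stat_law])
  show "distr stat_law stat_law shift = stat_law" by (rule distr_stat_law_shift)
  show "measure stat_law A = 0 \<or> measure stat_law A = 1"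
    if "A \<in> sets stat_law" "shift -` A \<inter> space stat_law = A" for A
    using zero_one_law[of A] that by simp
qed

text \<open>Under the stationary law the convergence event has probability 1 by the ergodic theorem,
  and it is exactly shift-invariant. Invariant events have one probability for all starting points,
  which replaces "almost every start" by "every start".\<close>

theorem AE_path_average:
  fixes f :: "(nat \<Rightarrow> 'a) \<Rightarrow> real"
  assumes f: "integrable stat_law f"
  shows "AE \<omega> in Px x. (\<lambda>n. (\<Sum>i<n. f (\<lambda>t. X (i + t) \<omega>)) / real n) \<longlonglongrightarrow> (\<integral>\<omega>. f \<omega> \<partial>stat_law)"
proof -
  define E where "E = {\<omega>. (\<lambda>n. (\<Sum>i<n. f ((shift ^^ i) \<omega>)) / real n) \<longlonglongrightarrow> (\<integral>\<omega>. f \<omega> \<partial>stat_law)}"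
  have [measurable]: "f \<in> borel_measurable paths" using f by (auto simp: measurable_cong_sets[OF sets_stat_law refl])
  have [measurable]: "(shift ^^ i) \<in> measurable paths paths" for i
    by (induction i) (auto intro: measurable_comp)
  have "{\<omega> \<in> space paths. (\<lambda>n. (\<Sum>i<n. f ((shift ^^ i) \<omega>)) / real n) \<longlonglongrightarrow> (\<integral>\<omega>. f \<omega> \<partial>stat_law)} \<in> sets paths"
    by measurable
  then have E: "E \<in> sets paths" by (simp add: E_def)
  have inv: "shift -` E = E"
  proof -
    have "f ((shift ^^ i) (shift \<omega>)) = f ((shift ^^ Suc i) \<omega>)" for i \<omega> by (simp add: funpow_swap1)
    then show ?thesis unfolding E_def
      using average_Suc_iff[of "\<lambda>i. f ((shift ^^ i) _)"] by (simp del: funpow.simps)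
  qed
  have "AE \<omega> in stat_law. \<omega> \<in> E" using stat.AE_ergodic_average[OF f] by (simp add: E_def)
  then have "measure stat_law E = 1" using E by (subst (asm) stat.AE_in_set_eq_1) auto
  then have "measure (path_law x) E = 1" using measure_invariant_event[OF E inv, of x] by simp
  then have "AE \<omega> in path_law x. \<omega> \<in> E" by (rule prob_space.AE_prob_1[OF prob_space_path_law])
  then have "AE \<omega> in Px x. (\<lambda>t. X t \<omega>) \<in> E"
    unfolding path_law_def using E by (subst (asm) AE_distr_iff[OF path_measurable]) auto
  then show ?thesis
    by (simp add: E_def shift_funpow[abs_def] cong: if_cong)
qed

end

section \<open>The Hausdorff moment problem on \<open>[-1, 1]\<close>\<close>

text \<open>The Riesz functional of the moment problem: the linear functional on polynomials with
  value \<open>\<gamma> k\<close> at the k-th power.\<close>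

definition poly_functional :: "(nat \<Rightarrow> real) \<Rightarrow> real poly \<Rightarrow> real" where
  "poly_functional \<gamma> p = (\<Sum>i\<le>degree p. coeff p i * \<gamma> i)"

lemma poly_functional_bound:
  assumes "degree p \<le> N" shows "poly_functional \<gamma> p = (\<Sum>i\<le>N. coeff p i * \<gamma> i)"
  unfolding poly_functional_def using assms
  by (intro sum.mono_neutral_left) (auto simp: coeff_eq_0)

lemma poly_functional_add: "poly_functional \<gamma> (p + q) = poly_functional \<gamma> p + poly_functional \<gamma> q"
proof -
  let ?N = "max (degree p) (degree q)"
  have "degree (p + q) \<le> ?N" by (rule degree_add_le_max)
  then show ?thesis
    by (simp add: poly_functional_bound[of _ ?N] sum.distrib distrib_right)
qed

lemma poly_functional_smult: "poly_functional \<gamma> (smult a p) = a * poly_functional \<gamma> p"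
proof -
  have "degree (smult a p) \<le> degree p" by (rule degree_smult_le)
  then have "poly_functional \<gamma> (smult a p) = (\<Sum>i\<le>degree p. coeff (smult a p) i * \<gamma> i)"
    by (rule poly_functional_bound)
  also have "\<dots> = a * poly_functional \<gamma> p"
    unfolding poly_functional_def sum_distrib_left coeff_smult by (simp only: mult.assoc)
  finally show ?thesis .
qed

lemma poly_functional_0: "poly_functional \<gamma> 0 = 0"
  by (simp add: poly_functional_def)

lemma poly_functional_diff: "poly_functional \<gamma> (p - q) = poly_functional \<gamma> p - poly_functional \<gamma> q"
proof -
  have "poly_functional \<gamma> (- q) = - poly_functional \<gamma> q" by (simp add: poly_functional_def sum_negf)
  then show ?thesis using poly_functional_add[of \<gamma> p "- q"] by simp
qed

lemma poly_functional_sum: "poly_functional \<gamma> (\<Sum>i\<in>I. f i) = (\<Sum>i\<in>I. poly_functional \<gamma> (f i))"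
  by (induction I rule: infinite_finite_induct) (auto simp: poly_functional_add poly_functional_0)

lemma poly_functional_monom: "poly_functional \<gamma> (monom a k) = a * \<gamma> k"
proof -
  have "poly_functional \<gamma> (monom a k) = (\<Sum>i\<le>k. coeff (monom a k) i * \<gamma> i)"
    by (rule poly_functional_bound[OF degree_monom_le])
  also have "\<dots> = (\<Sum>i\<le>k. if i = k then a * \<gamma> i else 0)" by (intro sum.cong) auto
  finally show ?thesis by simp
qed

lemma poly_functional_square:
  "poly_functional \<gamma> (p * p * monom 1 s) = hankel_form \<gamma> (coeff p) (degree p) s"
proof -
  have p: "p = (\<Sum>i\<le>degree p. monom (coeff p i) i)" by (simp add: poly_as_sum_of_monoms)
  have pp: "p * p = (\<Sum>i\<le>degree p. \<Sum>j\<le>degree p. monom (coeff p i) i * monom (coeff p j) j)"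
    by (subst (1 2) p) (rule sum_product)
  have "p * p * monom 1 s = (\<Sum>i\<le>degree p. \<Sum>j\<le>degree p. monom (coeff p i) i * monom (coeff p j) j * monom 1 s)"
    by (simp only: pp sum_distrib_right)
  also have "\<dots> = (\<Sum>i\<le>degree p. \<Sum>j\<le>degree p. monom (coeff p i * coeff p j) (i + j + s))"
    by (simp add: mult_monom)
  finally show ?thesis
    by (simp add: poly_functional_sum poly_functional_monom hankel_form_def)
qed

text \<open>In terms of the Riesz functional \<open>L\<close>, this reads
  \<open>|L(p^2 x^s)| <= L(p^2)\<close> for all polynomials \<open>p\<close>. It contains
  \<open>L(p^2) >= 0\<close>, and for a measure on \<open>[-1, 1]\<close> it holds because powers of
  \<open>x\<close> are bounded by 1 there.\<close>

definition hankel_bounded :: "(nat \<Rightarrow> real) \<Rightarrow> bool" where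
  "hankel_bounded \<gamma> \<longleftrightarrow> (\<forall>c N s. \<bar>hankel_form \<gamma> c N s\<bar> \<le> hankel_form \<gamma> c N 0)"

lemma hankel_bounded_abs_le:
  assumes "hankel_bounded \<gamma>" shows "\<bar>\<gamma> k\<bar> \<le> \<gamma> 0"
proof -
  have "\<bar>hankel_form \<gamma> (\<lambda>_. 1) 0 k\<bar> \<le> hankel_form \<gamma> (\<lambda>_. 1) 0 0"
    using assms by (simp add: hankel_bounded_def)
  then show ?thesis by (simp add: hankel_form_def)
qed

text \<open>The Riesz functional at a Bernstein basis polynomial in the variable
  \<open>y = (1 + x) / 2\<close>, which runs through \<open>[0, 1]\<close> as \<open>x\<close> runs
  through \<open>[-1, 1]\<close>.\<close>

definition bern_weight :: "(nat \<Rightarrow> real) \<Rightarrow> nat \<Rightarrow> nat \<Rightarrow> real" where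
  "bern_weight \<gamma> n k = real (n choose k) * poly_functional \<gamma> ([:1/2, 1/2:] ^ k * [:1/2, -1/2:] ^ (n - k))"

context
  fixes \<gamma> :: "nat \<Rightarrow> real" assumes \<gamma>: "hankel_bounded \<gamma>"
begin

lemma poly_functional_square_bound:
  "\<bar>poly_functional \<gamma> (p * p * monom 1 s)\<bar> \<le> poly_functional \<gamma> (p * p)"
proof -
  have "\<bar>hankel_form \<gamma> (coeff p) (degree p) s\<bar> \<le> hankel_form \<gamma> (coeff p) (degree p) 0"
    using \<gamma> unfolding hankel_bounded_def by blast
  moreover have "p * p * monom 1 0 = p * p" by (simp only: monom_eq_1 mult_1_right)
  ultimately show ?thesis by (simp only: poly_functional_square[symmetric])
qed

text \<open>Separating the parities of \<open>a\<close> and \<open>b\<close>, the polynomial is a square times one of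
  \<open>1\<close>, \<open>1 + x\<close>, \<open>1 - x\<close>, \<open>1 - x\<^sup>2\<close>.\<close>
lemma poly_functional_nonneg: "0 \<le> poly_functional \<gamma> ([:1, 1:] ^ a * [:1, -1:] ^ b)"
proof -
  let ?p = "[:1, 1:] ^ (a div 2) * [:1, -1:] ^ (b div 2) :: real poly"
  have x: "[:1, 1:] = 1 + monom (1::real) 1" "[:1, -1:] = 1 - monom (1::real) 1"
    by (simp_all add: monom_Suc one_pCons)
  have x2: "[:1, 1:] * [:1, -1:] = 1 - monom (1::real) 2"
    by (simp add: monom_Suc one_pCons numeral_2_eq_2)
  have split: "q ^ n = q ^ (n div 2) * q ^ (n div 2) * q ^ (n mod 2)" for q :: "real poly" and n
  proof -
    have "n = n div 2 + n div 2 + n mod 2" by presburger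
    from arg_cong[OF this, of "\<lambda>m. q ^ m"] show ?thesis by (simp only: power_add)
  qed
  have "[:1, 1:] ^ a * [:1, -1:] ^ b = ?p * ?p * ([:1, 1:] ^ (a mod 2) * [:1, -1:] ^ (b mod 2))"
    by (subst split[of _ a], subst split[of _ b]) (simp only: mult_ac)
  moreover have "a mod 2 = 0 \<or> a mod 2 = 1" "b mod 2 = 0 \<or> b mod 2 = 1" by auto
  then have "[:1, 1:] ^ (a mod 2) * [:1, -1:] ^ (b mod 2) \<in> {1, 1 + monom (1::real) 1, 1 - monom 1 1, 1 - monom 1 2}"
    using x x2 by auto
  ultimately have "\<exists>r \<in> {1, 1 + monom 1 1, 1 - monom 1 1, 1 - monom 1 2}. [:1, 1:] ^ a * [:1, -1:] ^ b = ?p * ?p * r"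
    by blast
  then obtain r where r: "r \<in> {1, 1 + monom 1 1, 1 - monom 1 1, 1 - monom 1 2}"
    and eq: "[:1, 1:] ^ a * [:1, -1:] ^ b = ?p * ?p * r" by blast
  define P where "P = ?p"
  have expand: "poly_functional \<gamma> (P * P * 1) = poly_functional \<gamma> (P * P)"
    "poly_functional \<gamma> (P * P * (1 + m)) = poly_functional \<gamma> (P * P) + poly_functional \<gamma> (P * P * m)"
    "poly_functional \<gamma> (P * P * (1 - m)) = poly_functional \<gamma> (P * P) - poly_functional \<gamma> (P * P * m)" for m
    by (simp_all only: poly_functional_add poly_functional_diff distrib_left right_diff_distrib mult_1_right)
  have "0 \<le> poly_functional \<gamma> (P * P * r)"
    using r poly_functional_square_bound[of P 1] poly_functional_square_bound[of P 2]
      expand(1) expand(2)[of "monom 1 1"] expand(3)[of "monom 1 1"] expand(3)[of "monom 1 2"]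
    unfolding insert_iff empty_iff abs_le_iff by (elim disjE FalseE) (hypsubst, linarith)+
  then show ?thesis by (simp only: eq P_def)
qed

lemma bern_weight_nonneg: "0 \<le> bern_weight \<gamma> n k"
proof -
  have "[:1/2, 1/2:] ^ k * [:1/2, -1/2:] ^ (n - k) = smult ((1/2) ^ k * (1/2) ^ (n - k)) ([:1, 1:] ^ k * [:1, -1:] ^ (n - k) :: real poly)"
  proof -
    have "[:1/2, 1/2:] = smult (1/2) [:1, 1::real:]" "[:1/2, -1/2:] = smult (1/2) [:1, -1::real:]" by simp_all
    then show ?thesis by (simp only: smult_power) (simp add: mult_ac)
  qed
  then show ?thesis
    using poly_functional_nonneg[of k "n - k"] by (simp add: bern_weight_def poly_functional_smult)
qed

end

text \<open>The factorial moments of the binomial distribution. The setting is a commutative ring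
  because \<open>Y\<close> and \<open>Z\<close> will be polynomials summing to 1.\<close>

lemma sum_choose_choose:
  fixes Y Z :: "'a::comm_ring_1"
  assumes YZ: "Y + Z = 1" and mn: "m \<le> n"
  shows "(\<Sum>k\<le>n. of_nat ((n choose k) * (k choose m)) * (Y ^ k * Z ^ (n - k))) = of_nat (n choose m) * Y ^ m"
proof -
  have "(\<Sum>k\<le>n. of_nat ((n choose k) * (k choose m)) * (Y ^ k * Z ^ (n - k))) =
      (\<Sum>k\<in>{m..n}. of_nat ((n choose k) * (k choose m)) * (Y ^ k * Z ^ (n - k)))"
    by (intro sum.mono_neutral_right) (auto simp: not_le binomial_eq_0)
  also have "\<dots> = (\<Sum>j\<le>n - m. of_nat ((n choose (j + m)) * ((j + m) choose m)) * (Y ^ (j + m) * Z ^ (n - (j + m))))"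
    using sum.shift_bounds_cl_nat_ivl[of "\<lambda>k. of_nat ((n choose k) * (k choose m)) * (Y ^ k * Z ^ (n - k))" 0 m "n - m"] mn
    by (simp add: atLeast0AtMost)
  also have "\<dots> = (\<Sum>j\<le>n - m. of_nat (n choose m) * Y ^ m * (of_nat ((n - m) choose j) * Y ^ j * Z ^ (n - m - j)))"
  proof (intro sum.cong refl)
    fix j assume "j \<in> {..n - m}"
    then have "(n choose (j + m)) * ((j + m) choose m) = (n choose m) * ((n - m) choose j)"
      using choose_mult[of m "j + m" n] mn by simp
    then show "of_nat ((n choose (j + m)) * ((j + m) choose m)) * (Y ^ (j + m) * Z ^ (n - (j + m))) =
        of_nat (n choose m) * Y ^ m * (of_nat ((n - m) choose j) * Y ^ j * Z ^ (n - m - j))"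
      by (simp add: power_add mult_ac add.commute)
  qed
  also have "\<dots> = of_nat (n choose m) * Y ^ m * (Y + Z) ^ (n - m)"
    by (simp add: binomial_ring sum_distrib_left)
  finally show ?thesis by (simp add: YZ)
qed

lemma sum_bern_weight_choose:
  assumes "m \<le> n"
  shows "(\<Sum>k\<le>n. real (k choose m) * bern_weight \<gamma> n k) = real (n choose m) * poly_functional \<gamma> ([:1/2, 1/2:] ^ m)"
proof -
  have YZ: "[:1/2, 1/2:] + [:1/2, -1/2:] = (1 :: real poly)" by (simp add: one_pCons)
  have sm: "of_nat c * p = smult (real c) p" for c and p :: "real poly" by (simp add: of_nat_poly)
  have "poly_functional \<gamma> (\<Sum>k\<le>n. of_nat ((n choose k) * (k choose m)) * ([:1/2, 1/2:] ^ k * [:1/2, -1/2:] ^ (n - k))) =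
      poly_functional \<gamma> (of_nat (n choose m) * [:1/2, 1/2:] ^ m)"
    by (simp only: sum_choose_choose[OF YZ assms])
  then have "(\<Sum>k\<le>n. real ((n choose k) * (k choose m)) * poly_functional \<gamma> ([:1/2, 1/2:] ^ k * [:1/2, -1/2:] ^ (n - k))) =
      real (n choose m) * poly_functional \<gamma> ([:1/2, 1/2:] ^ m)"
    by (simp only: sm poly_functional_sum poly_functional_smult)
  moreover have "real ((n choose k) * (k choose m)) * poly_functional \<gamma> ([:1/2, 1/2:] ^ k * [:1/2, -1/2:] ^ (n - k)) =
      real (k choose m) * bern_weight \<gamma> n k" for k
    by (simp add: bern_weight_def)
  ultimately show ?thesis by (simp only:)
qed

text \<open>Compares falling factorials with powers factor by factor. All factors have absolute
  value at most 1, so the difference of the products is at most the sum of the \<open>m\<close>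
  differences of factors, each of which is at most \<open>m / (n - m)\<close>.\<close>

lemma choose_ratio_approx:
  assumes "m < n" "2 * m \<le> n" "k \<le> n"
  shows "\<bar>real (k choose m) / real (n choose m) - (real k / real n) ^ m\<bar> \<le> real m * real m / (real n - real m)"
proof -
  have eq: "real (a choose m) = (\<Prod>i<m. real a - real i) / fact m" for a
    by (simp add: binomial_gbinomial gbinomial_prod_rev atLeast0LessThan)
  have ratio: "real (k choose m) / real (n choose m) = (\<Prod>i<m. (real k - real i) / (real n - real i))"
    by (simp add: eq prod_dividef)
  have fac: "norm ((real k - real i) / (real n - real i) - real k / real n) \<le> real m / (real n - real m)"
    "norm ((real k - real i) / (real n - real i)) \<le> 1" if "i < m" for i
  proof -
    have pos: "real n - real i > 0" "real n > 0" "real n - real m > 0" using that assms by auto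
    have "(real k - real i) / (real n - real i) - real k / real n = - (real i * (real n - real k) / (real n * (real n - real i)))"
      using pos by (simp add: field_simps)
    moreover have "real i * (real n - real k) / (real n * (real n - real i)) \<le> real m / (real n - real m)"
    proof -
      have "real i * (real n - real k) / (real n * (real n - real i)) = real i / (real n - real i) * ((real n - real k) / real n)"
        by simp
      also have "\<dots> \<le> real i / (real n - real i) * 1"
        using pos assms by (intro mult_left_mono) auto
      also have "\<dots> \<le> real m / (real n - real m)"
        using pos that by (simp, intro frac_le) auto
      finally show ?thesis .
    qed
    moreover have "real i * (real n - real k) / (real n * (real n - real i)) \<ge> 0" using pos assms by simp
    ultimately show "norm ((real k - real i) / (real n - real i) - real k / real n) \<le> real m / (real n - real m)"
      by (simp only: real_norm_def abs_minus_cancel abs_of_nonneg)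
    \<comment> \<open>The factor is negative when \<open>k < i\<close>; then
      \<open>i - k <= i <= n - i\<close>, and this is where \<open>2 * m <= n\<close>
      enters.\<close>
    have "real k \<le> real n" "2 * real i \<le> real n" "0 \<le> real k" using that assms by auto
    then have "\<bar>real k - real i\<bar> \<le> real n - real i" by linarith
    then show "norm ((real k - real i) / (real n - real i)) \<le> 1" using pos by simp
  qed
  have "norm ((\<Prod>i<m. (real k - real i) / (real n - real i)) - (\<Prod>i<m. real k / real n)) \<le>
      (\<Sum>i<m. norm ((real k - real i) / (real n - real i) - real k / real n))"
    using fac assms by (intro norm_prod_diff) auto
  also have "\<dots> \<le> (\<Sum>i<m. real m / (real n - real m))" using fac by (intro sum_mono) auto
  finally show ?thesis by (simp add: ratio)
qed

text \<open>The weights reproduce normalised factorial moments exactly. Passing to powers of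
  \<open>k / n\<close> costs an error uniform in \<open>k\<close>, which vanishes in the limit
  because the weights are nonnegative with total \<open>\<gamma> 0\<close>.\<close>

lemma bern_moment_tendsto:
  assumes \<gamma>: "hankel_bounded \<gamma>"
  shows "(\<lambda>n. \<Sum>k\<le>n. bern_weight \<gamma> n k * (real k / real n) ^ m) \<longlonglongrightarrow> poly_functional \<gamma> ([:1/2, 1/2:] ^ m)"
proof (rule LIM_zero_cancel, rule Lim_null_comparison)
  let ?L = "poly_functional \<gamma> ([:1/2, 1/2:] ^ m)"
  have total: "(\<Sum>k\<le>n. bern_weight \<gamma> n k) = \<gamma> 0" for n
    using sum_bern_weight_choose[of 0 n \<gamma>] by (simp add: poly_functional_def)
  have tendsto: "(\<lambda>n. \<gamma> 0 * (real m * real m / (real n - real m))) \<longlonglongrightarrow> 0"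
    by real_asymp
  then show "(\<lambda>n. \<gamma> 0 * (real m * real m / (real n - real m))) \<longlonglongrightarrow> 0" .
  show "\<forall>\<^sub>F n in sequentially. norm ((\<Sum>k\<le>n. bern_weight \<gamma> n k * (real k / real n) ^ m) - ?L) \<le> \<gamma> 0 * (real m * real m / (real n - real m))"
    using eventually_ge_at_top[of "2 * m + 1"]
  proof eventually_elim
    case (elim n)
    then have mn: "m < n" "2 * m \<le> n" by auto
    have "real (n choose m) > 0" using mn by simp
    then have L: "?L = (\<Sum>k\<le>n. bern_weight \<gamma> n k * (real (k choose m) / real (n choose m)))"
      using sum_bern_weight_choose[of m n \<gamma>] mn by (simp add: field_simps sum_divide_distrib[symmetric])
    have "norm ((\<Sum>k\<le>n. bern_weight \<gamma> n k * (real k / real n) ^ m) - ?L) =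
        norm (\<Sum>k\<le>n. bern_weight \<gamma> n k * ((real k / real n) ^ m - real (k choose m) / real (n choose m)))"
      unfolding L by (simp add: sum_subtractf right_diff_distrib)
    also have "\<dots> \<le> (\<Sum>k\<le>n. bern_weight \<gamma> n k * (real m * real m / (real n - real m)))"
    proof (rule sum_norm_le)
      fix k assume "k \<in> {..n}"
      then have "\<bar>real (k choose m) / real (n choose m) - (real k / real n) ^ m\<bar> \<le> real m * real m / (real n - real m)"
        using choose_ratio_approx[OF mn, of k] by simp
      from mult_left_mono[OF this bern_weight_nonneg[OF \<gamma>, of n k]]
      show "norm (bern_weight \<gamma> n k * ((real k / real n) ^ m - real (k choose m) / real (n choose m))) \<le>
          bern_weight \<gamma> n k * (real m * real m / (real n - real m))"
        using bern_weight_nonneg[OF \<gamma>, of n k] by (simp only: real_norm_def abs_mult abs_minus_commute abs_of_nonneg)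
    qed
    also have "\<dots> = \<gamma> 0 * (real m * real m / (real n - real m))"
      by (simp only: sum_distrib_right[symmetric] total)
    finally show ?case .
  qed
qed

lemma bern_centred_moment_tendsto:
  assumes \<gamma>: "hankel_bounded \<gamma>"
  shows "(\<lambda>n. \<Sum>k\<le>n. bern_weight \<gamma> n k * (2 * (real k / real n) - 1) ^ j) \<longlonglongrightarrow> \<gamma> j"
proof -
  \<comment> \<open>Kept polymorphic: the same expansion is used for real nodes and for polynomials,
    undoing \<open>y = (1 + x) / 2\<close> in both.\<close>
  have bin: "(2 * y - 1) ^ j = (\<Sum>i\<le>j. of_nat (j choose i) * 2 ^ i * (- 1) ^ (j - i) * y ^ i)" for y :: "'b::comm_ring_1"
    using binomial_ring[of "2 * y" "- 1" j] by (simp add: power_mult_distrib mult_ac)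
  have "(\<Sum>k\<le>n. bern_weight \<gamma> n k * (2 * (real k / real n) - 1) ^ j) =
      (\<Sum>i\<le>j. real (j choose i) * 2 ^ i * (- 1) ^ (j - i) * (\<Sum>k\<le>n. bern_weight \<gamma> n k * (real k / real n) ^ i))" for n
    unfolding bin by (simp add: sum_distrib_left mult_ac) (rule sum.swap)
  moreover have "(\<lambda>n. \<Sum>i\<le>j. real (j choose i) * 2 ^ i * (- 1) ^ (j - i) * (\<Sum>k\<le>n. bern_weight \<gamma> n k * (real k / real n) ^ i))
      \<longlonglongrightarrow> (\<Sum>i\<le>j. real (j choose i) * 2 ^ i * (- 1) ^ (j - i) * poly_functional \<gamma> ([:1/2, 1/2:] ^ i))"
    by (intro tendsto_sum tendsto_mult tendsto_const bern_moment_tendsto \<gamma>)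
  moreover have "(\<Sum>i\<le>j. real (j choose i) * 2 ^ i * (- 1) ^ (j - i) * poly_functional \<gamma> ([:1/2, 1/2:] ^ i)) = \<gamma> j"
  proof -
    have "2 * [:1/2, 1/2:] - 1 = (monom 1 1 :: real poly)" by (simp add: monom_Suc one_pCons numeral_poly)
    then have "monom 1 j = (2 * [:1/2, 1/2:] - 1 :: real poly) ^ j" by (simp add: monom_power)
    also have "\<dots> = (\<Sum>i\<le>j. smult (real (j choose i) * 2 ^ i * (- 1) ^ (j - i)) ([:1/2, 1/2:] ^ i))"
      unfolding bin
    proof (intro sum.cong refl)
      fix i
      have "of_nat (j choose i) * 2 ^ i * (- 1) ^ (j - i) = [:real (j choose i) * 2 ^ i * (- 1) ^ (j - i):]"
      proof -
        have c: "(-1 :: real poly) = [:-1:]" "(2 :: real poly) = [:2:]" by (simp_all add: one_pCons numeral_poly)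
        have pw: "[:c::real:] ^ l = [:c ^ l:]" for c l by (induction l) (simp_all add: one_pCons)
        show ?thesis by (simp only: c pw of_nat_poly) simp
      qed
      then show "of_nat (j choose i) * 2 ^ i * (- 1) ^ (j - i) * [:1/2, 1/2:] ^ i =
          smult (real (j choose i) * 2 ^ i * (- 1) ^ (j - i)) ([:1/2, 1/2:] ^ i :: real poly)" by simp
    qed
    finally have "poly_functional \<gamma> (monom 1 j) = (\<Sum>i\<le>j. real (j choose i) * 2 ^ i * (- 1) ^ (j - i) * poly_functional \<gamma> ([:1/2, 1/2:] ^ i))"
      by (simp only: poly_functional_sum poly_functional_smult)
    then show ?thesis by (simp add: poly_functional_monom)
  qed
  ultimately show ?thesis by simp
qed

section \<open>Representing measures: support, existence and uniqueness\<close>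

definition moment_rep :: "real \<Rightarrow> (nat \<Rightarrow> real) \<Rightarrow> real measure \<Rightarrow> bool" where
  "moment_rep b \<gamma> F \<longleftrightarrow> sets F = sets borel \<and> finite_measure F \<and> emeasure F (- {-b..b}) = 0 \<and>
     (\<forall>k. \<gamma> k = (\<integral>x. x ^ k \<partial>F))"

locale compact_measure = finite_measure F for F :: "real measure" +
  fixes b :: real
  assumes sets_F[simp, measurable_cong]: "sets F = sets borel"
    and null_outside: "emeasure F (- {-b..b}) = 0"
begin

lemma space_F[simp]: "space F = UNIV"
  using sets_eq_imp_space_eq[OF sets_F] by simp

lemma AE_abs_le: "AE x in F. \<bar>x\<bar> \<le> b"
proof -
  have "- {-b..b} \<in> null_sets F" using null_outside by (auto simp: null_sets_def)
  then have "AE x in F. x \<notin> - {-b..b}" by (rule AE_not_in)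
  then show ?thesis by eventually_elim auto
qed

lemma integrable_power: "integrable F (\<lambda>x. x ^ k)"
proof (rule integrable_const_bound[of _ "\<bar>b\<bar> ^ k"])
  show "AE x in F. norm (x ^ k) \<le> \<bar>b\<bar> ^ k"
    using AE_abs_le by eventually_elim (auto simp: power_abs intro!: power_mono)
qed simp

end

lemma moment_rep_compact: "moment_rep b \<gamma> F \<Longrightarrow> compact_measure F b"
  by (simp add: moment_rep_def compact_measure_def compact_measure_axioms_def)

lemma moment_rep_total: "moment_rep b \<gamma> F \<Longrightarrow> measure F UNIV = \<gamma> 0"
  using compact_measure.space_F[OF moment_rep_compact, of b \<gamma> F] by (simp add: moment_rep_def)

lemma moment_rep_abs_le:
  assumes F: "moment_rep b \<gamma> F" and b: "0 \<le> b"
  shows "\<bar>\<gamma> k\<bar> \<le> b ^ k * \<gamma> 0"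
proof -
  interpret compact_measure F b using F by (rule moment_rep_compact)
  have "\<bar>\<gamma> k\<bar> = \<bar>\<integral>x. x ^ k \<partial>F\<bar>" using F by (simp add: moment_rep_def)
  also have "\<dots> \<le> (\<integral>x. \<bar>x ^ k\<bar> \<partial>F)" by (rule integral_abs_bound)
  also have "\<dots> \<le> (\<integral>x. b ^ k \<partial>F)"
  proof (rule integral_mono_AE)
    show "AE x in F. \<bar>x ^ k\<bar> \<le> b ^ k"
      using AE_abs_le by eventually_elim (auto simp: power_abs intro!: power_mono)
  qed (use integrable_power in auto)
  also have "\<dots> = b ^ k * \<gamma> 0" using moment_rep_total[OF F] by simp
  finally show ?thesis .
qed

lemma moment_rep_hankel_bounded:
  assumes F: "moment_rep b \<gamma> F" and b: "0 \<le> b" "b \<le> 1"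
  shows "hankel_bounded \<gamma>"
  unfolding hankel_bounded_def
proof (intro allI)
  fix c N s
  interpret compact_measure F b using F by (rule moment_rep_compact)
  have \<gamma>: "\<gamma> k = (\<integral>x. x ^ k \<partial>F)" for k using F by (simp add: moment_rep_def)
  define v where "v x = (\<Sum>i\<le>N. c i * x ^ i)" for x :: real
  have vv: "(v x)\<^sup>2 * x ^ s = (\<Sum>i\<le>N. \<Sum>j\<le>N. c i * c j * x ^ (i + j + s))" for x s
    unfolding v_def power2_eq_square sum_product unfolding sum_distrib_right power_add by (simp only: mult_ac)
  have int: "integrable F (\<lambda>x. (v x)\<^sup>2 * x ^ s)" for s
    unfolding vv using integrable_power by simp
  have eq: "hankel_form \<gamma> c N s = (\<integral>x. (v x)\<^sup>2 * x ^ s \<partial>F)" for s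
    unfolding vv hankel_form_def \<gamma> using integrable_power by (simp add: Bochner_Integration.integral_sum)
  have "\<bar>hankel_form \<gamma> c N s\<bar> \<le> (\<integral>x. \<bar>(v x)\<^sup>2 * x ^ s\<bar> \<partial>F)"
    unfolding eq by (rule integral_abs_bound)
  also have "\<dots> \<le> (\<integral>x. (v x)\<^sup>2 * x ^ 0 \<partial>F)"
  proof (rule integral_mono_AE)
    show "AE x in F. \<bar>(v x)\<^sup>2 * x ^ s\<bar> \<le> (v x)\<^sup>2 * x ^ 0"
      using AE_abs_le
    proof eventually_elim
      case (elim x)
      then have "\<bar>x\<bar> ^ s \<le> 1" using b by (intro power_le_one) auto
      then show ?case by (simp add: abs_mult power_abs mult_left_le)
    qed
  qed (use int[of 0] int[of s] in auto)
  also have "\<dots> = hankel_form \<gamma> c N 0" by (rule eq[symmetric])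
  finally show "\<bar>hankel_form \<gamma> c N s\<bar> \<le> hankel_form \<gamma> c N 0" .
qed

text \<open>Markov's inequality with even powers: mass at \<open>|x| >= c > a\<close> is at most
  \<open>C * (a / c)^(2n)\<close>, which tends to 0. Even powers are nonnegative, so no cancellation
  can hide that mass, and the constant \<open>C\<close> is irrelevant.\<close>

lemma moment_rep_shrink:
  assumes F: "moment_rep b \<gamma> F" and a: "0 \<le> a" and bound: "\<And>n. \<gamma> (2 * n) \<le> C * a ^ (2 * n)"
  shows "moment_rep a \<gamma> F"
proof -
  interpret compact_measure F b using F by (rule moment_rep_compact)
  have null: "measure F {x. c \<le> \<bar>x\<bar>} = 0" if c: "a < c" for c
  proof -
    have "c > 0" using a c by simp
    have [measurable]: "{x. c \<le> \<bar>x\<bar>} \<in> sets borel" by measurable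
    have "measure F {x. c \<le> \<bar>x\<bar>} \<le> C * (a / c) ^ (2 * n)" for n
    proof -
      have "c ^ (2 * n) * measure F {x. c \<le> \<bar>x\<bar>} = (\<integral>x. c ^ (2 * n) * indicator {x. c \<le> \<bar>x\<bar>} x \<partial>F)" by simp
      also have "\<dots> \<le> (\<integral>x. x ^ (2 * n) \<partial>F)"
      proof (rule integral_mono)
        show "integrable F (\<lambda>x. c ^ (2 * n) * indicator {x. c \<le> \<bar>x\<bar>} x)"
          by (intro integrable_mult_right integrable_real_indicator) (auto simp: less_top[symmetric])
        fix x :: real
        have "c ^ (2 * n) \<le> \<bar>x\<bar> ^ (2 * n)" if "c \<le> \<bar>x\<bar>" using that \<open>c > 0\<close> by (intro power_mono) auto
        then show "c ^ (2 * n) * indicator {x. c \<le> \<bar>x\<bar>} x \<le> x ^ (2 * n)"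
          by (auto simp: indicator_def power_mult)
      qed (rule integrable_power)
      also have "\<dots> \<le> C * a ^ (2 * n)" using F bound[of n] by (simp add: moment_rep_def)
      finally show ?thesis using \<open>c > 0\<close> by (simp add: power_divide field_simps)
    qed
    moreover have "(\<lambda>n. C * (a / c) ^ (2 * n)) \<longlonglongrightarrow> C * 0"
    proof (intro tendsto_mult tendsto_const)
      have "(\<lambda>n. ((a / c)\<^sup>2) ^ n) \<longlonglongrightarrow> 0"
        using a c by (intro LIMSEQ_power_zero) (simp add: power_divide abs_square_less_1 power_strict_mono)
      then show "(\<lambda>n. (a / c) ^ (2 * n)) \<longlonglongrightarrow> 0" by (simp add: power_mult)
    qed
    ultimately have "measure F {x. c \<le> \<bar>x\<bar>} \<le> 0" by (intro LIMSEQ_le_const) auto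
    then show ?thesis using measure_nonneg[of F] by (simp add: order_antisym)
  qed
  have "- {-a..a} = (\<Union>j. {x. a + 1 / real (Suc j) \<le> \<bar>x\<bar>})"
  proof (intro set_eqI iffI)
    fix x assume "x \<in> - {-a..a}"
    then have "0 < \<bar>x\<bar> - a" using a by auto
    then obtain j where "1 / real (Suc j) < \<bar>x\<bar> - a" using nat_approx_posE by blast
    then show "x \<in> (\<Union>j. {x. a + 1 / real (Suc j) \<le> \<bar>x\<bar>})" by (intro UN_I[of j]) auto
  next
    fix x assume "x \<in> (\<Union>j. {x. a + 1 / real (Suc j) \<le> \<bar>x\<bar>})"
    then obtain j where "a + 1 / real (Suc j) \<le> \<bar>x\<bar>" by blast
    moreover have "1 / real (Suc j) > 0" by simp
    ultimately have "a < \<bar>x\<bar>" by linarith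
    then show "x \<in> - {-a..a}" by auto
  qed
  also have "emeasure F \<dots> = 0"
    using null by (intro emeasure_UN_eq_0) (auto simp: emeasure_eq_measure)
  finally show ?thesis using F by (simp add: moment_rep_def)
qed

text \<open>The complement of the support is a union of null balls, in general uncountably many; the
  Lindelof property leaves countably many.\<close>

lemma null_outside_msupport:
  assumes "sets F = sets borel"
  shows "- msupport F \<in> null_sets F"
proof -
  let ?\<U> = "{ball x e |x e. e > 0 \<and> emeasure F (ball x e) = 0}"
  obtain \<V> where \<V>: "\<V> \<subseteq> ?\<U>" "countable \<V>" "\<Union>\<V> = \<Union>?\<U>"
    using Lindelof[of ?\<U>] by auto
  have "\<Union>\<V> \<in> null_sets F"
  proof -
    have "\<And>V. V \<in> \<V> \<Longrightarrow> V \<in> null_sets F" using \<V>(1) assms by (auto simp: null_sets_def)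
    then have "(\<Union>V\<in>\<V>. V) \<in> null_sets F" by (rule null_sets_UN'[OF \<V>(2)])
    then show ?thesis by simp
  qed
  moreover have "- msupport F \<subseteq> \<Union>?\<U>"
  proof
    fix x assume "x \<in> - msupport F"
    then obtain e where e: "e > 0" "emeasure F (ball x e) = 0" by (auto simp: msupport_def)
    then have "ball x e \<in> ?\<U>" by blast
    moreover have "x \<in> ball x e" using e by simp
    ultimately show "x \<in> \<Union>?\<U>" by (rule UnionI)
  qed
  moreover have "- msupport F = \<Union>?\<U>"
  proof
    show "\<Union>?\<U> \<subseteq> - msupport F"
    proof safe
      fix y x :: real and e :: real
      assume e: "0 < e" "emeasure F (ball x e) = 0" and y: "y \<in> ball x e" "y \<in> msupport F"
      obtain r where r: "r > 0" "ball y r \<subseteq> ball x e" using openE[OF open_ball y(1)] .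
      then have "emeasure F (ball y r) \<le> emeasure F (ball x e)" using assms by (intro emeasure_mono) auto
      then have "emeasure F (ball y r) = 0" using e by simp
      with y(2) r show False by (auto simp: msupport_def)
    qed
  qed fact
  ultimately show ?thesis using \<V>(3) by simp
qed

lemma moment_rep_spec_gap:
  assumes F: "moment_rep 1 \<gamma> F" and \<delta>: "\<delta> \<le> spec_gap F"
  shows "\<delta> \<le> 1" "moment_rep (1 - \<delta>) \<gamma> F"
proof -
  interpret compact_measure F 1 using F by (rule moment_rep_compact)
  have supp: "msupport F \<subseteq> {-1..1}"
  proof
    fix x assume x: "x \<in> msupport F"
    show "x \<in> {-1..1}"
    proof (rule ccontr)
      assume "x \<notin> {-1..1}"
      moreover have "open (- {-1..1::real})" by (intro open_Compl closed_real_atLeastAtMost)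
      ultimately obtain e where e: "e > 0" "ball x e \<subseteq> - {-1..1}" using open_contains_ball by blast
      then have "emeasure F (ball x e) \<le> emeasure F (- {-1..1})" by (intro emeasure_mono) auto
      then have "emeasure F (ball x e) = 0" using null_outside by simp
      with x e show False by (auto simp: msupport_def)
    qed
  qed
  have bdd: "bdd_above (abs ` msupport F)" using supp by (intro bdd_aboveI[of _ 1]) (auto simp: abs_le_iff dest!: subsetD)
  have le: "\<bar>x\<bar> \<le> 1 - \<delta>" if "x \<in> msupport F" for x
  proof -
    have "\<bar>x\<bar> \<le> Sup (abs ` msupport F)" using that bdd by (intro cSup_upper) auto
    moreover have "msupport F \<noteq> {}" using that by blast
    ultimately show ?thesis using \<delta> by (simp add: spec_gap_def)
  qed
  \<comment> \<open>For empty support the gap is 1 by convention. Otherwise a point of the support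
    shows that \<open>1 - \<delta>\<close> is nonnegative, so \<open>1 - \<delta>\<close> can serve
    as a radius.\<close>
  show "\<delta> \<le> 1"
  proof (cases "msupport F = {}")
    case True then show ?thesis using \<delta> by (simp add: spec_gap_def)
  next
    case False
    then obtain x where "x \<in> msupport F" by blast
    from le[OF this] show ?thesis by simp
  qed
  have "- {- (1 - \<delta>)..1 - \<delta>} \<subseteq> - msupport F" using le by (auto simp: abs_le_iff) (force dest: le simp: abs_le_iff)+
  then have "emeasure F (- {- (1 - \<delta>)..1 - \<delta>}) \<le> emeasure F (- msupport F)"
    using null_outside_msupport[of F] by (intro emeasure_mono) auto
  then have "emeasure F (- {- (1 - \<delta>)..1 - \<delta>}) = 0" using null_outside_msupport[of F] by auto
  then show "moment_rep (1 - \<delta>) \<gamma> F" using F by (simp add: moment_rep_def)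
qed

lemma discrete_distribution:
  fixes p x :: "nat \<Rightarrow> real"
  assumes p: "\<And>k. 0 \<le> p k" and total: "(\<Sum>k\<le>n. p k) = 1"
  defines "D \<equiv> distr (density (count_space {..n}) (\<lambda>k. ennreal (p k))) borel x"
  shows "real_distribution D"
    and "f \<in> borel_measurable borel \<Longrightarrow> (\<integral>y. f y \<partial>D) = (\<Sum>k\<le>n. p k * f (x k) :: real)"
proof -
  have "emeasure (density (count_space {..n}) (\<lambda>k. ennreal (p k))) {..n} = (\<Sum>k\<le>n. ennreal (p k))"
    by (subst emeasure_density) (auto simp: nn_integral_count_space_finite intro!: sum.cong)
  then have "prob_space (density (count_space {..n}) (\<lambda>k. ennreal (p k)))"
    using p total by (intro prob_spaceI) (simp add: sum_ennreal)
  then show "real_distribution D"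
    unfolding D_def by (intro prob_space.real_distribution_distr) auto
  assume f: "f \<in> borel_measurable borel"
  then have "(\<integral>y. f y \<partial>D) = (\<integral>k. f (x k) \<partial>density (count_space {..n}) (\<lambda>k. ennreal (p k)))"
    unfolding D_def by (intro integral_distr) auto
  also have "\<dots> = (\<integral>k. p k *\<^sub>R f (x k) \<partial>count_space {..n})"
    using p by (intro integral_density) auto
  also have "\<dots> = (\<Sum>k\<le>n. p k * f (x k))"
    by (simp add: lebesgue_integral_count_space_finite)
  finally show "(\<integral>y. f y \<partial>D) = (\<Sum>k\<le>n. p k * f (x k))" .
qed

text \<open>A weak limit of the discrete Bernstein measures, which exists by Helly's theorem, has the given moments.\<close>
lemma hausdorff_moment_prob:
  assumes \<gamma>: "hankel_bounded \<gamma>" and one: "\<gamma> 0 = 1"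
  shows "\<exists>F. moment_rep 1 \<gamma> F"
proof -
  let ?x = "\<lambda>n k. 2 * (real k / real n) - 1 :: real"
  let ?p = "\<lambda>n k. bern_weight \<gamma> n k"
  define \<mu> where "\<mu> n = distr (density (count_space {..n}) (\<lambda>k. ennreal (?p n k))) borel (?x n)" for n
  have total: "(\<Sum>k\<le>n. ?p n k) = 1" for n
    using sum_bern_weight_choose[of 0 n \<gamma>] one by (simp add: poly_functional_def)
  \<comment> \<open>For \<open>n = 0\<close> the quotient is 0 by convention and the only node is
    -1, still inside the interval.\<close>
  have x: "?x n k \<in> {-1..1}" if "k \<le> n" for n k
    using that by (cases "n = 0") (auto simp: field_simps)
  have rd: "real_distribution (\<mu> n)" for n
    unfolding \<mu>_def by (rule discrete_distribution(1)[OF bern_weight_nonneg[OF \<gamma>] total])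
  have int: "(\<integral>y. f y \<partial>\<mu> n) = (\<Sum>k\<le>n. ?p n k * f (?x n k))" if "f \<in> borel_measurable borel" for f and n :: nat
    unfolding \<mu>_def by (rule discrete_distribution(2)[OF bern_weight_nonneg[OF \<gamma>] total that])
  have "tight \<mu>"
    unfolding tight_def
  proof (intro conjI allI impI rd)
    fix \<epsilon> :: real assume "\<epsilon> > 0"
    \<comment> \<open>Tightness is phrased with intervals open on the left. The node -1 occurs, so
      the left end is moved to -2.\<close>
    have "measure (\<mu> n) {-2<..1} = 1" for n
    proof -
      interpret real_distribution "\<mu> n" by (rule rd)
      have "measure (\<mu> n) {-2<..1} = (\<integral>y. indicator {-2<..1} y \<partial>\<mu> n)" by simp
      also have "\<dots> = (\<Sum>k\<le>n. ?p n k * indicator {-2<..1} (?x n k))" by (rule int) simp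
      also have "\<dots> = (\<Sum>k\<le>n. ?p n k)"
      proof (intro sum.cong refl)
        fix k assume "k \<in> {..n}"
        then have "?x n k \<in> {-1..1}" by (intro x) simp
        then have "?x n k \<in> {-2<..1}" unfolding atLeastAtMost_iff greaterThanAtMost_iff by linarith
        then show "?p n k * indicator {-2<..1} (?x n k) = ?p n k" by (simp only: indicator_simps mult_1_right)
      qed
      finally show ?thesis using total by simp
    qed
    then show "\<exists>a b. a < b \<and> (\<forall>n. 1 - \<epsilon> < measure (\<mu> n) {a<..b})"
      using \<open>\<epsilon> > 0\<close> by (intro exI[of _ "-2"] exI[of _ "1"]) auto
  qed
  then obtain r M where r: "strict_mono r" and M: "real_distribution M" and conv: "weak_conv_m (\<mu> \<circ> id \<circ> r) M"
    using tight_imp_convergent_subsubsequence[of \<mu> id] by (auto simp: strict_mono_id)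
  interpret M: real_distribution M by fact
  \<comment> \<open>Weak convergence tests only bounded continuous functions, and powers are
    unbounded. Clamping to \<open>[-1, 1]\<close> changes nothing at the nodes, and the image of the
    limit under \<open>cl\<close> is automatically concentrated on \<open>[-1, 1]\<close>.\<close>
  define cl where "cl y = max (-1) (min 1 y)" for y :: real
  have cl_cont: "isCont cl y" for y unfolding cl_def by (intro continuous_intros)
  have cl_meas[measurable]: "cl \<in> borel_measurable borel" unfolding cl_def by measurable
  have mom: "(\<integral>y. cl y ^ j \<partial>M) = \<gamma> j" for j
  proof -
    have bound: "norm (cl y ^ j) \<le> 1" for y
    proof -
      have "\<bar>cl y\<bar> \<le> 1" by (auto simp: cl_def)
      then show ?thesis by (simp add: power_abs power_le_one)
    qed
    have "(\<lambda>n. \<integral>y. cl y ^ j \<partial>(\<mu> \<circ> id \<circ> r) n) \<longlonglongrightarrow> (\<integral>y. cl y ^ j \<partial>M)"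
      by (rule weak_conv_imp_integral_bdd_continuous_conv[OF _ M conv _ bound])
        (use rd cl_cont in \<open>auto intro!: continuous_intros\<close>)
    moreover have "(\<integral>y. cl y ^ j \<partial>(\<mu> \<circ> id \<circ> r) n) = (\<Sum>k\<le>r n. ?p (r n) k * ?x (r n) k ^ j)" for n
    proof -
      have "(\<integral>y. cl y ^ j \<partial>(\<mu> \<circ> id \<circ> r) n) = (\<Sum>k\<le>r n. ?p (r n) k * cl (?x (r n) k) ^ j)"
        using int[of "\<lambda>y. cl y ^ j" "r n"] by simp
      also have "\<dots> = (\<Sum>k\<le>r n. ?p (r n) k * ?x (r n) k ^ j)"
      proof (intro sum.cong refl)
        fix k assume "k \<in> {..r n}"
        then have "cl (?x (r n) k) = ?x (r n) k" using x[of k "r n"] by (auto simp: cl_def)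
        then show "?p (r n) k * cl (?x (r n) k) ^ j = ?p (r n) k * ?x (r n) k ^ j" by simp
      qed
      finally show ?thesis .
    qed
    ultimately have "(\<lambda>n. \<Sum>k\<le>r n. ?p (r n) k * ?x (r n) k ^ j) \<longlonglongrightarrow> (\<integral>y. cl y ^ j \<partial>M)" by simp
    moreover have "(\<lambda>n. \<Sum>k\<le>r n. ?p (r n) k * ?x (r n) k ^ j) \<longlonglongrightarrow> \<gamma> j"
      using LIMSEQ_subseq_LIMSEQ[OF bern_centred_moment_tendsto[OF \<gamma>, of j] r] by (simp add: comp_def)
    ultimately show ?thesis by (rule LIMSEQ_unique)
  qed
  have "moment_rep 1 \<gamma> (distr M borel cl)"
    unfolding moment_rep_def
  proof (intro conjI allI)
    show "finite_measure (distr M borel cl)"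
      by (intro prob_space.finite_measure M.prob_space_distr) simp
    have "cl -` (- {-1..1}) \<inter> space M = {}" by (auto simp: cl_def)
    then show "emeasure (distr M borel cl) (- {-1..1}) = 0" by (subst emeasure_distr) auto
    show "\<gamma> k = (\<integral>x. x ^ k \<partial>distr M borel cl)" for k
      by (subst integral_distr) (auto simp: mom)
  qed simp
  then show ?thesis ..
qed

lemma moment_rep_density:
  assumes F: "moment_rep b \<gamma> F" and c: "0 \<le> c"
  shows "moment_rep b (\<lambda>k. c * \<gamma> k) (density F (\<lambda>_. ennreal c))"
proof -
  interpret compact_measure F b using F by (rule moment_rep_compact)
  show ?thesis unfolding moment_rep_def
  proof (intro conjI allI)
    show "finite_measure (density F (\<lambda>_. ennreal c))"
      by (intro finite_measureI) (simp add: emeasure_density_const ennreal_mult_eq_top_iff)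
    show "emeasure (density F (\<lambda>_. ennreal c)) (- {-b..b}) = 0"
      using null_outside by (simp add: emeasure_density_const)
    show "c * \<gamma> k = (\<integral>x. x ^ k \<partial>density F (\<lambda>_. ennreal c))" for k
      using F c by (subst integral_density) (auto simp: moment_rep_def)
  qed simp
qed

theorem hausdorff_moment:
  assumes \<gamma>: "hankel_bounded \<gamma>"
  shows "\<exists>F. moment_rep 1 \<gamma> F"
proof (cases "\<gamma> 0 = 0")
  case True
  then have "\<gamma> k = 0" for k using hankel_bounded_abs_le[OF \<gamma>, of k] by simp
  then have "moment_rep 1 \<gamma> (null_measure borel)"
    by (auto simp: moment_rep_def intro!: finite_measureI)
  then show ?thesis ..
next
  case False
  then have pos: "\<gamma> 0 > 0" using hankel_bounded_abs_le[OF \<gamma>, of 0] by simp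
  have h: "hankel_form (\<lambda>k. \<gamma> k / \<gamma> 0) c N s = hankel_form \<gamma> c N s / \<gamma> 0" for c N s
    by (simp add: hankel_form_def sum_divide_distrib)
  have "hankel_bounded (\<lambda>k. \<gamma> k / \<gamma> 0)"
    using \<gamma> pos unfolding hankel_bounded_def h by (simp add: divide_right_mono)
  then obtain F where "moment_rep 1 (\<lambda>k. \<gamma> k / \<gamma> 0) F"
    using hausdorff_moment_prob[of "\<lambda>k. \<gamma> k / \<gamma> 0"] pos by auto
  from moment_rep_density[OF this, of "\<gamma> 0"] show ?thesis using pos by auto
qed

text \<open>On \<open>[-1, 1]\<close> all absolute moments are at most 1, so the Taylor series of
  the characteristic function converges and is determined by the moments; Levy's uniqueness theorem
  does the rest. Uniqueness is what makes \<open>spectral_measure\<close> well defined.\<close>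

lemma moment_rep_unique_prob:
  assumes F: "moment_rep 1 \<gamma> F" and G: "moment_rep 1 \<gamma> G" and one: "\<gamma> 0 = 1"
  shows "F = G"
proof -
  have rd: "real_distribution M" and lim: "(\<lambda>n. \<Sum>k\<le>n. (\<i> * complex_of_real t) ^ k / fact k * \<gamma> k) \<longlonglongrightarrow> char M t"
    if M: "moment_rep 1 \<gamma> M" for M t
  proof -
    interpret compact_measure M 1 using M by (rule moment_rep_compact)
    show "real_distribution M"
    proof (intro real_distribution.intro real_distribution_axioms.intro prob_spaceI)
      show "emeasure M (space M) = 1" using moment_rep_total[OF M] one by (simp add: emeasure_eq_measure)
    qed simp
    then interpret M: real_distribution M .
    have \<gamma>: "(\<integral>x. x ^ k \<partial>M) = \<gamma> k" for k using M by (simp add: moment_rep_def)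
    show "(\<lambda>n. \<Sum>k\<le>n. (\<i> * complex_of_real t) ^ k / fact k * \<gamma> k) \<longlonglongrightarrow> char M t"
    proof (rule LIM_zero_cancel, rule Lim_null_comparison)
      have "(\<lambda>n. 2 * (inverse (fact n) * \<bar>t\<bar> ^ n)) \<longlonglongrightarrow> 2 * 0"
        by (intro tendsto_mult tendsto_const summable_LIMSEQ_zero[OF summable_exp])
      then show "(\<lambda>n. 2 * \<bar>t\<bar> ^ n / fact n) \<longlonglongrightarrow> 0" by (simp add: field_simps)
      show "\<forall>\<^sub>F n in sequentially. norm ((\<Sum>k\<le>n. (\<i> * complex_of_real t) ^ k / fact k * \<gamma> k) - char M t) \<le> 2 * \<bar>t\<bar> ^ n / fact n"
      proof (rule always_eventually, rule allI)
        fix n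
        have "norm (char M t - (\<Sum>k\<le>n. (\<i> * complex_of_real t) ^ k / fact k * \<gamma> k)) \<le> (2 * \<bar>t\<bar> ^ n / fact n) * (\<integral>x. \<bar>x\<bar> ^ n \<partial>M)"
          using M.char_approx1[of n t] integrable_power by (simp add: \<gamma>)
        also have "(\<integral>x. \<bar>x\<bar> ^ n \<partial>M) \<le> (\<integral>x. 1 \<partial>M)"
        proof (rule integral_mono_AE)
          show "integrable M (\<lambda>x. \<bar>x\<bar> ^ n)" using integrable_abs[OF integrable_power[of n]] by (simp add: power_abs)
          show "AE x in M. \<bar>x\<bar> ^ n \<le> 1" using AE_abs_le by eventually_elim (auto intro: power_le_one)
        qed simp
        then have "(2 * \<bar>t\<bar> ^ n / fact n) * (\<integral>x. \<bar>x\<bar> ^ n \<partial>M) \<le> (2 * \<bar>t\<bar> ^ n / fact n) * 1"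
          using M.prob_space by (intro mult_left_mono) auto
        finally show "norm ((\<Sum>k\<le>n. (\<i> * complex_of_real t) ^ k / fact k * \<gamma> k) - char M t) \<le> 2 * \<bar>t\<bar> ^ n / fact n"
          by (simp add: norm_minus_commute)
      qed
    qed
  qed
  have "char F = char G"
    using LIMSEQ_unique[OF lim[OF F] lim[OF G]] by (simp add: fun_eq_iff)
  then show ?thesis using Levy_uniqueness rd F G by blast
qed

theorem moment_rep_unique:
  assumes F: "moment_rep 1 \<gamma> F" and G: "moment_rep 1 \<gamma> G"
  shows "F = G"
proof (cases "\<gamma> 0 = 0")
  case True
  have "emeasure M A = 0" if M: "moment_rep 1 \<gamma> M" for M A
  proof -
    interpret compact_measure M 1 using M by (rule moment_rep_compact)
    have "emeasure M UNIV = 0" using moment_rep_total[OF M] True by (simp add: emeasure_eq_measure)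
    then show ?thesis using emeasure_space[of M A] by simp
  qed
  then show ?thesis using F G by (intro measure_eqI) (auto simp: moment_rep_def)
next
  case False
  then have pos: "\<gamma> 0 > 0" using moment_rep_abs_le[OF F, of 0] by simp
  let ?N = "\<lambda>M. density M (\<lambda>_. ennreal (1 / \<gamma> 0))"
  have "?N F = ?N G"
    using moment_rep_density[OF F, of "1 / \<gamma> 0"] moment_rep_density[OF G, of "1 / \<gamma> 0"] pos
    by (intro moment_rep_unique_prob[of "\<lambda>k. \<gamma> k / \<gamma> 0"]) auto
  moreover have "density (?N M) (\<lambda>_. ennreal (\<gamma> 0)) = M" if "sets M = sets borel" for M
  proof -
    have "density (?N M) (\<lambda>_. ennreal (\<gamma> 0)) = density M (\<lambda>_. ennreal (1 / \<gamma> 0) * ennreal (\<gamma> 0))"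
      by (rule density_density_eq) auto
    also have "ennreal (1 / \<gamma> 0) * ennreal (\<gamma> 0) = 1"
      using pos by (simp add: ennreal_mult[symmetric])
    finally show ?thesis by (simp add: density_1)
  qed
  ultimately show ?thesis using F G unfolding moment_rep_def by metis
qed

section \<open>Projection onto moment sequences\<close>

text \<open>A description without measures: the first condition yields a measure on
  \<open>[-1, 1]\<close>, the second confines it to \<open>[-b, b]\<close>. Each inequality involves
  finitely many values linearly, hence survives pointwise limits.\<close>

definition moment_cone :: "real \<Rightarrow> (nat \<Rightarrow> real) \<Rightarrow> bool" where
  "moment_cone b \<gamma> \<longleftrightarrow> hankel_bounded \<gamma> \<and> (\<forall>n. \<gamma> (2 * n) \<le> b ^ (2 * n) * \<gamma> 0)"

lemma moment_rep_imp_cone: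
  assumes "moment_rep b \<gamma> F" "0 \<le> b" "b \<le> 1" shows "moment_cone b \<gamma>"
  unfolding moment_cone_def
  using moment_rep_hankel_bounded[OF assms] moment_rep_abs_le[OF assms(1,2)] by (auto simp: abs_le_iff)

lemma moment_cone_imp_rep:
  assumes "moment_cone b \<gamma>" "0 \<le> b" shows "\<exists>F. moment_rep b \<gamma> F"
proof -
  obtain F where "moment_rep 1 \<gamma> F" using hausdorff_moment[of \<gamma>] assms(1) unfolding moment_cone_def by blast
  then have "moment_rep b \<gamma> F"
    by (rule moment_rep_shrink[where C="\<gamma> 0"]) (use assms in \<open>simp_all add: moment_cone_def mult.commute\<close>)
  then show ?thesis ..
qed

lemma moment_seqs_iff:
  assumes "0 \<le> b" "b \<le> 1"
  shows "m \<in> moment_seqs b \<longleftrightarrow> (\<exists>\<gamma>. moment_cone b \<gamma> \<and> m = (\<lambda>k. \<gamma> (nat \<bar>k\<bar>)))"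
proof
  assume "m \<in> moment_seqs b"
  then obtain F where F: "sets F = sets borel" "finite_measure F" "emeasure F (- {-b..b}) = 0"
    and m: "\<And>k. m k = (\<integral>x. x ^ nat \<bar>k\<bar> \<partial>F)" by (auto simp: moment_seqs_def)
  then have "moment_rep b (\<lambda>k. \<integral>x. x ^ k \<partial>F) F" by (simp add: moment_rep_def)
  then show "\<exists>\<gamma>. moment_cone b \<gamma> \<and> m = (\<lambda>k. \<gamma> (nat \<bar>k\<bar>))"
    using moment_rep_imp_cone[OF _ assms] m by blast
next
  assume "\<exists>\<gamma>. moment_cone b \<gamma> \<and> m = (\<lambda>k. \<gamma> (nat \<bar>k\<bar>))"
  then obtain \<gamma> F where "moment_rep b \<gamma> F" "m = (\<lambda>k. \<gamma> (nat \<bar>k\<bar>))"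
    using moment_cone_imp_rep assms(1) by blast
  then show "m \<in> moment_seqs b" by (auto simp: moment_seqs_def moment_rep_def)
qed

lemma hankel_form_combination:
  "hankel_form (\<lambda>k. a * \<gamma> k + b * \<gamma>' k) c N s = a * hankel_form \<gamma> c N s + b * hankel_form \<gamma>' c N s"
  by (simp add: hankel_form_def sum_distrib_left sum.distrib distrib_left mult_ac)

lemma moment_cone_midpoint:
  assumes "moment_cone b \<gamma>" "moment_cone b \<gamma>'"
  shows "moment_cone b (\<lambda>k. (\<gamma> k + \<gamma>' k) / 2)"
proof -
  have h: "hankel_form (\<lambda>k. (\<gamma> k + \<gamma>' k) / 2) c N s = (hankel_form \<gamma> c N s + hankel_form \<gamma>' c N s) / 2" for c N s
    using hankel_form_combination[of "1/2" \<gamma> "1/2" \<gamma>' c N s] by (simp add: add_divide_distrib)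
  have "\<bar>(hankel_form \<gamma> c N s + hankel_form \<gamma>' c N s) / 2\<bar> \<le> (hankel_form \<gamma> c N 0 + hankel_form \<gamma>' c N 0) / 2" for c N s
  proof -
    have "\<bar>hankel_form \<gamma> c N s\<bar> \<le> hankel_form \<gamma> c N 0" "\<bar>hankel_form \<gamma>' c N s\<bar> \<le> hankel_form \<gamma>' c N 0"
      using assms unfolding moment_cone_def hankel_bounded_def by blast+
    then show ?thesis by (simp add: abs_le_iff)
  qed
  moreover have "(\<gamma> (2 * n) + \<gamma>' (2 * n)) / 2 \<le> b ^ (2 * n) * ((\<gamma> 0 + \<gamma>' 0) / 2)" for n
  proof -
    have "\<gamma> (2 * n) \<le> b ^ (2 * n) * \<gamma> 0" "\<gamma>' (2 * n) \<le> b ^ (2 * n) * \<gamma>' 0"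
      using assms unfolding moment_cone_def by blast+
    then have "\<gamma> (2 * n) + \<gamma>' (2 * n) \<le> b ^ (2 * n) * (\<gamma> 0 + \<gamma>' 0)" by (simp add: distrib_left)
    then show ?thesis by simp
  qed
  ultimately show ?thesis unfolding moment_cone_def hankel_bounded_def h by blast
qed

lemma moment_cone_closed:
  assumes cone: "\<And>n. moment_cone b (\<Gamma> n)" and lim: "\<And>k. (\<lambda>n. \<Gamma> n k) \<longlonglongrightarrow> \<gamma> k"
  shows "moment_cone b \<gamma>"
  unfolding moment_cone_def hankel_bounded_def
proof (intro conjI allI)
  fix c N s
  have h: "(\<lambda>n. hankel_form (\<Gamma> n) c N s) \<longlonglongrightarrow> hankel_form \<gamma> c N s" for s
    unfolding hankel_form_def by (intro tendsto_intros lim)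
  show "\<bar>hankel_form \<gamma> c N s\<bar> \<le> hankel_form \<gamma> c N 0"
    by (rule LIMSEQ_le[OF tendsto_rabs[OF h] h]) (use cone in \<open>simp add: moment_cone_def hankel_bounded_def\<close>)
next
  fix n
  show "\<gamma> (2 * n) \<le> b ^ (2 * n) * \<gamma> 0"
    by (rule LIMSEQ_le[OF lim tendsto_mult[OF tendsto_const lim]]) (use cone in \<open>simp add: moment_cone_def\<close>)
qed

lemma moment_cone_zero: "moment_cone b (\<lambda>_. 0)"
  by (simp add: moment_cone_def hankel_bounded_def hankel_form_def)

lemma moment_cone_nonneg: "moment_cone b \<gamma> \<Longrightarrow> 0 \<le> \<gamma> 0"
  using hankel_bounded_abs_le[of \<gamma> 0] by (auto simp: moment_cone_def)

lemma moment_cone_abs_le: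
  assumes "moment_cone b \<gamma>" "0 \<le> b" shows "\<bar>\<gamma> k\<bar> \<le> b ^ k * \<gamma> 0"
proof -
  obtain F where "moment_rep b \<gamma> F" using moment_cone_imp_rep assms by blast
  then show ?thesis using assms by (intro moment_rep_abs_le)
qed

abbreviation int_seq :: "(nat \<Rightarrow> real) \<Rightarrow> int \<Rightarrow> real" where
  "int_seq \<gamma> \<equiv> (\<lambda>k. \<gamma> (nat \<bar>k\<bar>))"

lemma point_le_sqdist: "ennreal ((r k - m k)\<^sup>2) \<le> sqdist r m"
  unfolding sqdist_def by (rule nn_integral_ge_point) simp

lemma sqdist_commute: "sqdist r m = sqdist m r"
  by (simp add: sqdist_def power2_commute)

text \<open>Written additively, so that it holds in the extended nonnegative reals without any
  assumption of finiteness.\<close>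

lemma sqdist_parallelogram:
  "sqdist m m' + 4 * sqdist r (\<lambda>k. (m k + m' k) / 2) = 2 * sqdist r m + 2 * sqdist r m'"
proof -
  have "ennreal ((m k - m' k)\<^sup>2) + 4 * ennreal ((r k - (m k + m' k) / 2)\<^sup>2) =
      2 * ennreal ((r k - m k)\<^sup>2) + 2 * ennreal ((r k - m' k)\<^sup>2)" for k
  proof -
    have "(m k - m' k)\<^sup>2 + 4 * (r k - (m k + m' k) / 2)\<^sup>2 = 2 * (r k - m k)\<^sup>2 + 2 * (r k - m' k)\<^sup>2"
      by (simp add: power2_eq_square field_simps)
    from arg_cong[OF this, of ennreal] show ?thesis
      by (simp add: ennreal_plus ennreal_mult')
  qed
  then have "(\<integral>\<^sup>+k. ennreal ((m k - m' k)\<^sup>2) + 4 * ennreal ((r k - (m k + m' k) / 2)\<^sup>2) \<partial>count_space UNIV) =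
      (\<integral>\<^sup>+k. 2 * ennreal ((r k - m k)\<^sup>2) + 2 * ennreal ((r k - m' k)\<^sup>2) \<partial>count_space UNIV)"
    by simp
  then show ?thesis
    by (simp add: sqdist_def nn_integral_add nn_integral_cmult)
qed

locale projection =
  fixes b :: real and r :: "int \<Rightarrow> real"
  assumes b: "0 \<le> b" "b \<le> 1" and finite_norm: "sqdist r (\<lambda>_. 0) < \<infinity>"
begin

definition minval :: ennreal where
  "minval = (INF m \<in> moment_seqs b. sqdist r m)"

lemma minval_le: "m \<in> moment_seqs b \<Longrightarrow> minval \<le> sqdist r m"
  unfolding minval_def by (rule INF_lower)

lemma minval_finite: "minval < \<infinity>"
proof -
  have "(\<lambda>_. 0) \<in> moment_seqs b"
    using moment_cone_zero by (subst moment_seqs_iff[OF b]) (auto intro!: exI[of _ "\<lambda>_. 0"])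
  from minval_le[OF this] finite_norm show ?thesis by (rule le_less_trans)
qed

lemma midpoint_mem:
  assumes "m \<in> moment_seqs b" "m' \<in> moment_seqs b" shows "(\<lambda>k. (m k + m' k) / 2) \<in> moment_seqs b"
proof -
  obtain \<gamma> \<gamma>' where "moment_cone b \<gamma>" "m = int_seq \<gamma>" "moment_cone b \<gamma>'" "m' = int_seq \<gamma>'"
    using assms unfolding moment_seqs_iff[OF b] by blast
  then show ?thesis
    unfolding moment_seqs_iff[OF b] by (intro exI[of _ "\<lambda>k. (\<gamma> k + \<gamma>' k) / 2"]) (simp add: moment_cone_midpoint)
qed

text \<open>The midpoint of two near-minimisers again lies in the cone and cannot beat the minimum,
  so the parallelogram identity forces them to be close. With zero excess this is uniqueness; with
  vanishing excess it is the Cauchy property.\<close>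

lemma sqdist_le_excess:
  assumes "m \<in> moment_seqs b" "m' \<in> moment_seqs b"
    and "sqdist r m \<le> minval + e" "sqdist r m' \<le> minval + e'"
  shows "sqdist m m' \<le> 2 * e + 2 * e'"
proof -
  have "sqdist m m' + 4 * minval \<le> sqdist m m' + 4 * sqdist r (\<lambda>k. (m k + m' k) / 2)"
    by (intro add_left_mono mult_left_mono minval_le midpoint_mem assms) auto
  also have "\<dots> = 2 * sqdist r m + 2 * sqdist r m'" by (rule sqdist_parallelogram)
  also have "\<dots> \<le> 2 * (minval + e) + 2 * (minval + e')"
    by (intro add_mono mult_left_mono assms) auto
  also have "\<dots> = (2 * e + 2 * e') + 4 * minval"
  proof -
    have "(4::ennreal) = 2 + 2" by simp
    then show ?thesis by (simp only: distrib_left distrib_right add_ac)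
  qed
  finally have "4 * minval + sqdist m m' \<le> 4 * minval + (2 * e + 2 * e')" by (simp only: add.commute)
  then show ?thesis
    using minval_finite by (subst (asm) ennreal_add_left_cancel_le) (auto simp: ennreal_mult_eq_top_iff)
qed

lemma minimizer_unique:
  assumes "m \<in> moment_seqs b" "m' \<in> moment_seqs b" "sqdist r m \<le> minval" "sqdist r m' \<le> minval"
  shows "m = m'"
proof
  fix k
  have "ennreal ((m k - m' k)\<^sup>2) \<le> sqdist m m'" by (rule point_le_sqdist)
  also have "\<dots> \<le> 2 * 0 + 2 * 0" using assms by (intro sqdist_le_excess) auto
  finally show "m k = m' k" by simp
qed

text \<open>A minimising sequence is Cauchy at every lag. Its limit is taken pointwise, stays in the
  closed cone, and attains the minimum by Fatou's lemma, so completeness of the sequence space does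
  not enter.\<close>

lemma minimizer_exists: "\<exists>m \<in> moment_seqs b. sqdist r m \<le> minval"
proof -
  have "\<exists>m \<in> moment_seqs b. sqdist r m < minval + ennreal (1 / Suc n)" for n
  proof -
    obtain v where "minval = ennreal v" "0 \<le> v" using minval_finite by (cases minval) auto
    then have "minval < minval + ennreal (1 / Suc n)"
      by (simp add: ennreal_less_iff flip: ennreal_plus)
    then have "(INF m \<in> moment_seqs b. sqdist r m) < minval + ennreal (1 / Suc n)" by (simp only: minval_def)
    then show ?thesis by (simp only: INF_less_iff)
  qed
  note near_min = this
  have "\<exists>\<gamma>. moment_cone b \<gamma> \<and> sqdist r (int_seq \<gamma>) < minval + ennreal (1 / Suc n)" for n
  proof -
    obtain m where m: "m \<in> moment_seqs b" "sqdist r m < minval + ennreal (1 / Suc n)" using near_min[of n] by blast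
    then obtain \<gamma> where "moment_cone b \<gamma>" "m = int_seq \<gamma>" unfolding moment_seqs_iff[OF b] by blast
    with m show ?thesis by blast
  qed
  then obtain \<Gamma> where cone: "\<And>n. moment_cone b (\<Gamma> n)" and near: "\<And>n. sqdist r (int_seq (\<Gamma> n)) < minval + ennreal (1 / Suc n)"
    by metis
  have mem: "int_seq (\<Gamma> n) \<in> moment_seqs b" for n
    using cone unfolding moment_seqs_iff[OF b] by blast
  have close: "(\<Gamma> n k - \<Gamma> l k)\<^sup>2 \<le> 2 * (1 / Suc n) + 2 * (1 / Suc l)" for n l k
  proof -
    have "ennreal ((int_seq (\<Gamma> n) (int k) - int_seq (\<Gamma> l) (int k))\<^sup>2) \<le> sqdist (int_seq (\<Gamma> n)) (int_seq (\<Gamma> l))"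
      by (rule point_le_sqdist)
    also have "\<dots> \<le> 2 * ennreal (1 / Suc n) + 2 * ennreal (1 / Suc l)"
      by (intro sqdist_le_excess mem less_imp_le[OF near])
    also have "\<dots> = ennreal (2 * (1 / Suc n) + 2 * (1 / Suc l))"
    proof -
      have "2 * ennreal x = ennreal (2 * x)" if "0 \<le> x" for x using that by (simp add: ennreal_mult')
      then show ?thesis by simp
    qed
    finally show ?thesis by (simp flip: ennreal_plus)
  qed
  have "Cauchy (\<lambda>n. \<Gamma> n k)" for k
  proof (rule metric_CauchyI)
    fix e :: real assume e: "e > 0"
    obtain N where N: "1 / real (Suc N) < e\<^sup>2 / 4" using nat_approx_posE[of "e\<^sup>2 / 4"] e by auto
    show "\<exists>M. \<forall>m\<ge>M. \<forall>n\<ge>M. dist (\<Gamma> m k) (\<Gamma> n k) < e"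
    proof (intro exI[of _ N] allI impI)
      fix m n assume "N \<le> m" "N \<le> n"
      then have "1 / real (Suc m) \<le> 1 / real (Suc N)" "1 / real (Suc n) \<le> 1 / real (Suc N)"
        by (auto intro!: divide_left_mono)
      then have "(\<Gamma> m k - \<Gamma> n k)\<^sup>2 < e\<^sup>2" using close[of m k n] N by linarith
      then have "\<bar>\<Gamma> m k - \<Gamma> n k\<bar> < e" using e by (simp add: abs_square_less_1 power2_less_imp_less[of "\<bar>\<Gamma> m k - \<Gamma> n k\<bar>"])
      then show "dist (\<Gamma> m k) (\<Gamma> n k) < e" by (simp add: dist_real_def)
    qed
  qed
  then have "\<exists>l. (\<lambda>n. \<Gamma> n k) \<longlonglongrightarrow> l" for k
    using Cauchy_convergent convergent_def by blast
  then obtain \<gamma> where lim: "\<And>k. (\<lambda>n. \<Gamma> n k) \<longlonglongrightarrow> \<gamma> k" by metis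
  have "moment_cone b \<gamma>" using cone lim by (rule moment_cone_closed)
  moreover have "sqdist r (int_seq \<gamma>) \<le> minval"
  proof -
    have "sqdist r (int_seq \<gamma>) = (\<integral>\<^sup>+k. liminf (\<lambda>n. ennreal ((r k - \<Gamma> n (nat \<bar>k\<bar>))\<^sup>2)) \<partial>count_space UNIV)"
      unfolding sqdist_def
    proof (intro nn_integral_cong)
      fix k
      have "(\<lambda>n. ennreal ((r k - \<Gamma> n (nat \<bar>k\<bar>))\<^sup>2)) \<longlonglongrightarrow> ennreal ((r k - \<gamma> (nat \<bar>k\<bar>))\<^sup>2)"
        by (intro tendsto_ennrealI tendsto_intros lim)
      then show "ennreal ((r k - \<gamma> (nat \<bar>k\<bar>))\<^sup>2) = liminf (\<lambda>n. ennreal ((r k - \<Gamma> n (nat \<bar>k\<bar>))\<^sup>2))"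
        by (intro lim_imp_Liminf[symmetric]) auto
    qed
    also have "\<dots> \<le> liminf (\<lambda>n. sqdist r (int_seq (\<Gamma> n)))"
      unfolding sqdist_def by (rule nn_integral_liminf) simp
    also have "\<dots> \<le> liminf (\<lambda>n. minval + ennreal (1 / Suc n))"
      by (intro Liminf_mono always_eventually allI less_imp_le[OF near])
    also have "\<dots> = minval"
    proof -
      have "(\<lambda>n. ennreal (1 / Suc n)) \<longlonglongrightarrow> 0"
        using tendsto_ennrealI[OF LIMSEQ_Suc[OF lim_1_over_n]] by simp
      then have "(\<lambda>n. minval + ennreal (1 / Suc n)) \<longlonglongrightarrow> minval + 0"
        by (intro tendsto_add tendsto_const) 
      then show ?thesis by (intro lim_imp_Liminf) auto
    qed
    finally show ?thesis .
  qed
  ultimately show ?thesis by (intro bexI[of _ "int_seq \<gamma>"]) (auto simp: moment_seqs_iff[OF b])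
qed

text \<open>Existence and uniqueness of the minimiser give the definite description in
  \<open>proj\<close> its meaning.\<close>

lemma
  shows proj_mem: "proj (1 - b) r \<in> moment_seqs b"
    and sqdist_proj_le: "m \<in> moment_seqs b \<Longrightarrow> sqdist r (proj (1 - b) r) \<le> sqdist r m"
proof -
  let ?P = "\<lambda>m. m \<in> moment_seqs b \<and> (\<forall>m' \<in> moment_seqs b. sqdist r m \<le> sqdist r m')"
  have "\<exists>!m. ?P m"
  proof (rule ex_ex1I)
    obtain m where "m \<in> moment_seqs b" "sqdist r m \<le> minval" using minimizer_exists by blast
    then show "\<exists>m. ?P m" using minval_le order_trans by blast
    fix m m' assume "?P m" "?P m'"
    then show "m = m'" by (intro minimizer_unique) (auto simp: minval_def intro: INF_greatest)
  qed
  then have "?P (THE m. ?P m)" by (rule theI')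
  moreover have "proj (1 - b) r = (THE m. ?P m)" by (simp add: proj_def)
  ultimately show "proj (1 - b) r \<in> moment_seqs b" "m \<in> moment_seqs b \<Longrightarrow> sqdist r (proj (1 - b) r) \<le> sqdist r m"
    by auto
qed

text \<open>Minimality is tested only at the midpoint of the projection and \<open>m\<close>, giving
  \<open>d + 2a <= 2g\<close>; expanding the square gives \<open>g + d <= a + 2n\<close>. Together
  they yield \<open>3d <= 4n\<close>, and the 2 in the statement is a convenient larger constant.
  All quantities are first shown finite so that the inequalities can be combined by
  subtraction.\<close>

lemma sqdist_proj_target_le:
  assumes m: "m \<in> moment_seqs b" and fin: "sqdist r m < \<infinity>"
  shows "sqdist (proj (1 - b) r) m \<le> 2 * (\<integral>\<^sup>+k. ennreal (\<bar>proj (1 - b) r k - m k\<bar> * \<bar>r k - m k\<bar>) \<partial>count_space UNIV)"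
proof -
  let ?p = "proj (1 - b) r"
  let ?N = "\<integral>\<^sup>+k. ennreal (\<bar>?p k - m k\<bar> * \<bar>r k - m k\<bar>) \<partial>count_space UNIV"
  let ?A = "sqdist r ?p" and ?G = "sqdist r m" and ?D = "sqdist ?p m"
  have A: "?A \<le> ?G" by (rule sqdist_proj_le[OF m])
  have Afin: "?A < \<infinity>" using A fin by (rule le_less_trans)
  have "?D + 4 * ?A \<le> ?D + 4 * sqdist r (\<lambda>k. (?p k + m k) / 2)"
    by (intro add_left_mono mult_left_mono sqdist_proj_le midpoint_mem proj_mem m) auto
  also have "\<dots> = 2 * ?A + 2 * ?G" by (rule sqdist_parallelogram)
  finally have 1: "?D + 4 * ?A \<le> 2 * ?A + 2 * ?G" .
  have "ennreal ((r k - m k)\<^sup>2) + ennreal ((?p k - m k)\<^sup>2) \<le>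
      ennreal ((r k - ?p k)\<^sup>2) + 2 * ennreal (\<bar>?p k - m k\<bar> * \<bar>r k - m k\<bar>)" for k
  proof -
    have "(r k - m k)\<^sup>2 + (?p k - m k)\<^sup>2 = (r k - ?p k)\<^sup>2 + 2 * ((?p k - m k) * (r k - m k))"
      by (simp add: power2_eq_square algebra_simps)
    also have "\<dots> \<le> (r k - ?p k)\<^sup>2 + 2 * (\<bar>?p k - m k\<bar> * \<bar>r k - m k\<bar>)"
      by (simp flip: abs_mult)
    finally have "ennreal ((r k - m k)\<^sup>2 + (?p k - m k)\<^sup>2) \<le> ennreal ((r k - ?p k)\<^sup>2 + 2 * (\<bar>?p k - m k\<bar> * \<bar>r k - m k\<bar>))"
      by (rule ennreal_leI)
    then show ?thesis by (simp add: ennreal_plus ennreal_mult')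
  qed
  then have "(\<integral>\<^sup>+k. ennreal ((r k - m k)\<^sup>2) + ennreal ((?p k - m k)\<^sup>2) \<partial>count_space UNIV) \<le>
      (\<integral>\<^sup>+k. ennreal ((r k - ?p k)\<^sup>2) + 2 * ennreal (\<bar>?p k - m k\<bar> * \<bar>r k - m k\<bar>) \<partial>count_space UNIV)"
    by (intro nn_integral_mono) auto
  then have 2: "?G + ?D \<le> ?A + 2 * ?N"
    by (simp add: sqdist_def nn_integral_add nn_integral_cmult)
  show ?thesis
  proof (cases "?N = \<infinity>")
    case False
    obtain a where a: "?A = ennreal a" "0 \<le> a" using Afin by (cases "?A") auto
    obtain g where g: "?G = ennreal g" "0 \<le> g" using fin by (cases "?G") auto
    obtain n where n: "?N = ennreal n" "0 \<le> n" using False by (cases "?N") auto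
    have "?D \<le> ?A + 2 * ?N" by (rule order_trans[OF _ 2]) (simp add: add_increasing)
    also have "?A + 2 * ?N < \<infinity>" unfolding a(1) n(1) by (simp add: ennreal_mult_less_top)
    finally obtain d where d: "?D = ennreal d" "0 \<le> d" by (cases "?D") auto
    have two: "2 * ennreal x = ennreal (2 * x)" "4 * ennreal x = ennreal (4 * x)" if "0 \<le> x" for x
      using that by (simp_all add: ennreal_mult')
    have "d + 4 * a \<le> 2 * a + 2 * g"
      using 1 a(2) g(2) d(2) unfolding a(1) g(1) d(1) by (simp add: two flip: ennreal_plus)
    moreover have "g + d \<le> a + 2 * n"
      using 2 a(2) g(2) d(2) n(2) unfolding a(1) g(1) d(1) n(1) by (simp add: two flip: ennreal_plus)
    ultimately have "d \<le> 2 * n" using n(2) by linarith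
    then show ?thesis unfolding d(1) n(1) using n(2) by (simp add: two)
  qed (simp add: ennreal_mult_top)
qed

end

section \<open>Convergence of the projections in l1\<close>

definition l1dist :: "(int \<Rightarrow> real) \<Rightarrow> (int \<Rightarrow> real) \<Rightarrow> ennreal" where
  "l1dist f g = (\<integral>\<^sup>+k. ennreal \<bar>f k - g k\<bar> \<partial>count_space UNIV)"

text \<open>Only an inequality, since 0 belongs to both half-lines and is counted twice.\<close>

lemma nn_integral_int_even_le:
  fixes f :: "nat \<Rightarrow> ennreal"
  shows "(\<integral>\<^sup>+k. f (nat \<bar>k\<bar>) \<partial>count_space (UNIV :: int set)) \<le> 2 * (\<Sum>n. f n)"
proof -
  let ?f = "\<lambda>k::int. f (nat \<bar>k\<bar>)"
  have bij: "bij_betw int UNIV {0..}" "bij_betw (\<lambda>n. - int n) UNIV {..0}"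
    by (auto simp: bij_betw_def inj_on_def image_iff intro: exI[of _ "nat _"])
      (metis abs_of_nonneg nat_0_le, metis minus_equation_iff nat_0_le neg_0_le_iff_le)
  have half: "(\<integral>\<^sup>+k. ?f k * indicator A k \<partial>count_space UNIV) = (\<Sum>n. f n)" if "A = {0..} \<or> A = {..0}" for A
  proof -
    have "(\<integral>\<^sup>+k. ?f k \<partial>count_space {0..}) = (\<integral>\<^sup>+n. f n \<partial>count_space UNIV)"
      using nn_integral_bij_count_space[OF bij(1), of ?f] by simp
    moreover have "(\<integral>\<^sup>+k. ?f k \<partial>count_space {..0}) = (\<integral>\<^sup>+n. f n \<partial>count_space UNIV)"
      using nn_integral_bij_count_space[OF bij(2), of ?f] by simp
    ultimately show ?thesis using that by (auto simp: nn_integral_count_space_indicator nn_integral_count_space_nat)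
  qed
  have "(\<integral>\<^sup>+k. ?f k \<partial>count_space UNIV) \<le> (\<integral>\<^sup>+k. ?f k * indicator {0..} k + ?f k * indicator {..0} k \<partial>count_space UNIV)"
    by (intro nn_integral_mono) (auto simp: indicator_def)
  also have "\<dots> = (\<Sum>n. f n) + (\<Sum>n. f n)"
    by (simp add: nn_integral_add half)
  finally show ?thesis by (simp add: mult_2)
qed

lemma geometric_int_finite:
  fixes b :: real assumes "0 \<le> b" "b < 1"
  shows "(\<integral>\<^sup>+k. ennreal (b ^ nat \<bar>k\<bar>) \<partial>count_space (UNIV :: int set)) < \<infinity>"
proof -
  have "(\<Sum>n. ennreal (b ^ n)) = ennreal (\<Sum>n. b ^ n)"
    using assms by (intro suminf_ennreal2) (auto intro: summable_geometric)
  then have "(\<integral>\<^sup>+k. ennreal (b ^ nat \<bar>k\<bar>) \<partial>count_space (UNIV :: int set)) \<le> 2 * ennreal (\<Sum>n. b ^ n)"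
    using nn_integral_int_even_le[of "\<lambda>n. ennreal (b ^ n)"] by simp
  also have "\<dots> < \<infinity>" by (simp add: ennreal_mult_less_top)
  finally show ?thesis .
qed

text \<open>One of the two factors in each square is bounded by the whole l1 sum.\<close>

lemma sqdist_le_l1dist: "sqdist f g \<le> l1dist f g * l1dist f g"
proof -
  have "sqdist f g = (\<integral>\<^sup>+k. ennreal \<bar>f k - g k\<bar> * ennreal \<bar>f k - g k\<bar> \<partial>count_space UNIV)"
    unfolding sqdist_def by (intro nn_integral_cong) (simp add: power2_eq_square flip: ennreal_mult)
  also have "\<dots> \<le> (\<integral>\<^sup>+k. l1dist f g * ennreal \<bar>f k - g k\<bar> \<partial>count_space UNIV)"
    unfolding l1dist_def by (intro nn_integral_mono mult_right_mono nn_integral_ge_point) auto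
  also have "\<dots> = l1dist f g * l1dist f g"
    by (simp add: nn_integral_cmult l1dist_def)
  finally show ?thesis .
qed

text \<open>The geometric decay of the cone acts as a weight on \<open>r M - \<gamma>\<close>: the
  weighted l1 distance \<open>E M\<close> tends to 0 by dominated convergence, although nothing
  controls the unweighted one. This bounds the squared distance up to the factor
  \<open>P M 0 + \<gamma> 0\<close>. Once that factor is under control, the projections converge at
  each lag, and a second dominated convergence, again under a geometric bound, gives l1.\<close>

theorem proj_l1_tendsto:
  assumes \<delta>: "0 < \<delta>" "\<delta> \<le> 1" and \<gamma>: "moment_cone (1 - \<delta>) \<gamma>"
    and fin: "\<And>M. sqdist (r M) (\<lambda>_. 0) < \<infinity>"
    and lim: "\<And>k. (\<lambda>M. r M k) \<longlonglongrightarrow> int_seq \<gamma> k"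
    and bound: "\<And>M k. \<bar>r M k\<bar> \<le> r M 0"
  shows "(\<lambda>M. l1dist (proj \<delta> (r M)) (int_seq \<gamma>)) \<longlonglongrightarrow> 0"
proof -
  define b where "b = 1 - \<delta>"
  have b: "0 \<le> b" "b \<le> 1" "b < 1" using \<delta> by (auto simp: b_def)
  have \<delta>b: "\<delta> = 1 - b" by (simp add: b_def)
  have proj: "projection b (r M)" for M using b fin by unfold_locales auto
  have cone_\<gamma>: "moment_cone b \<gamma>" using \<gamma> by (simp add: b_def)
  have mem: "int_seq \<gamma> \<in> moment_seqs b" using cone_\<gamma> moment_seqs_iff[OF b(1,2)] by blast
  have "\<exists>P. moment_cone b P \<and> proj \<delta> (r M) = int_seq P" for M
    using projection.proj_mem[OF proj[of M]] moment_seqs_iff[OF b(1,2)] by (simp add: \<delta>b)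
  then obtain P where coneP: "\<And>M. moment_cone b (P M)" and P: "\<And>M. proj \<delta> (r M) = int_seq (P M)" by metis
  let ?G = "\<gamma> 0"
  have G: "0 \<le> ?G" using cone_\<gamma> by (rule moment_cone_nonneg)
  have diff: "\<bar>P M k - \<gamma> k\<bar> \<le> b ^ k * (P M 0 + ?G)" for M k
    using moment_cone_abs_le[OF coneP[of M] b(1), of k] moment_cone_abs_le[OF cone_\<gamma> b(1), of k]
    by (simp add: distrib_left abs_le_iff)
  obtain B where B: "\<And>M. r M 0 \<le> B"
    using convergent_imp_Bseq[OF convergentI[OF lim[of 0]]] by (auto simp: Bseq_def abs_le_iff)
  define E where "E M = (\<integral>\<^sup>+k. ennreal (b ^ nat \<bar>k\<bar> * \<bar>r M k - int_seq \<gamma> k\<bar>) \<partial>count_space UNIV)" for M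
  have wfin: "(\<integral>\<^sup>+k. ennreal (b ^ nat \<bar>k\<bar> * c) \<partial>count_space (UNIV :: int set)) < \<infinity>" for c
  proof -
    have "(\<integral>\<^sup>+k. ennreal (b ^ nat \<bar>k\<bar> * c) \<partial>count_space (UNIV :: int set)) = (\<integral>\<^sup>+k. ennreal (b ^ nat \<bar>k\<bar>) * ennreal c \<partial>count_space (UNIV :: int set))"
      using b by (intro nn_integral_cong) (simp add: ennreal_mult')
    also have "\<dots> = (\<integral>\<^sup>+k. ennreal (b ^ nat \<bar>k\<bar>) \<partial>count_space (UNIV :: int set)) * ennreal c"
      by (simp add: nn_integral_multc)
    also have "\<dots> < \<infinity>" using geometric_int_finite[OF b(1,3)] by (simp add: ennreal_mult_less_top)
    finally show ?thesis .
  qed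
  have rbound: "\<bar>r M k - int_seq \<gamma> k\<bar> \<le> B + ?G" for M k
  proof -
    have "\<bar>\<gamma> (nat \<bar>k\<bar>)\<bar> \<le> ?G"
      using cone_\<gamma> hankel_bounded_abs_le by (simp add: moment_cone_def)
    then show ?thesis using bound[of M k] B[of M] by linarith
  qed
  have E_le: "ennreal (b ^ nat \<bar>k\<bar> * \<bar>r M k - int_seq \<gamma> k\<bar>) \<le> ennreal (b ^ nat \<bar>k\<bar> * (B + ?G))" for M k
    using rbound b by (intro ennreal_leI mult_left_mono) auto
  have Efin: "E M < \<infinity>" for M
    unfolding E_def by (rule le_less_trans[OF nn_integral_mono[OF E_le] wfin])
  have Elim: "E \<longlonglongrightarrow> (\<integral>\<^sup>+k. 0 \<partial>count_space (UNIV :: int set))"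
    unfolding E_def[abs_def]
  proof (rule nn_integral_dominated_convergence[OF _ _ _ _ wfin])
    show "AE k in count_space UNIV. (\<lambda>M. ennreal (b ^ nat \<bar>k\<bar> * \<bar>r M k - int_seq \<gamma> k\<bar>)) \<longlonglongrightarrow> 0"
    proof (rule AE_I2)
      fix k
      have "(\<lambda>M. b ^ nat \<bar>k\<bar> * \<bar>r M k - int_seq \<gamma> k\<bar>) \<longlonglongrightarrow> b ^ nat \<bar>k\<bar> * \<bar>int_seq \<gamma> k - int_seq \<gamma> k\<bar>"
        by (intro tendsto_intros lim)
      from tendsto_ennrealI[OF this] show "(\<lambda>M. ennreal (b ^ nat \<bar>k\<bar> * \<bar>r M k - int_seq \<gamma> k\<bar>)) \<longlonglongrightarrow> 0" by simp
    qed
  qed (use E_le in auto)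
  define e where "e M = enn2real (E M)" for M
  have Ee: "E M = ennreal (e M)" and e0: "0 \<le> e M" for M
    using Efin[of M] by (auto simp: e_def)
  have elim: "e \<longlonglongrightarrow> 0"
    using Elim e0 by (simp add: Ee[abs_def] ennreal_tendsto_0_iff)
  \<comment> \<open>A polynomial in \<open>e M\<close> without constant term that bounds
    \<open>(P M 0 + ?G) * e M\<close>. Its coefficients result from the estimate of \<open>x\<close>
    below, and no prior bound on \<open>P M 0\<close> is used.\<close>
  define D where "D M = 4 * (e M)\<^sup>2 * e M + 8 * ?G * e M * e M + e M + 4 * ?G * e M" for M
  have sq: "sqdist (proj \<delta> (r M)) (int_seq \<gamma>) \<le> ennreal (2 * (D M))" for M
  proof -
    interpret projection b "r M" by (rule proj)
    have "sqdist (r M) (int_seq \<gamma>) < \<infinity>"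
    proof -
      have g: "sqdist (int_seq \<gamma>) (\<lambda>_. 0) < \<infinity>"
      proof -
        have "sqdist (int_seq \<gamma>) (\<lambda>_. 0) \<le> (\<integral>\<^sup>+k. ennreal (b ^ nat \<bar>k\<bar> * (?G * ?G)) \<partial>count_space UNIV)"
          unfolding sqdist_def
        proof (intro nn_integral_mono ennreal_leI)
          fix k :: int
          have 1: "\<bar>\<gamma> (nat \<bar>k\<bar>)\<bar> \<le> b ^ nat \<bar>k\<bar> * ?G" using moment_cone_abs_le[OF cone_\<gamma> b(1)] .
          have 2: "\<bar>\<gamma> (nat \<bar>k\<bar>)\<bar> \<le> ?G" using cone_\<gamma> hankel_bounded_abs_le by (simp add: moment_cone_def)
          have "\<bar>\<gamma> (nat \<bar>k\<bar>)\<bar> * \<bar>\<gamma> (nat \<bar>k\<bar>)\<bar> \<le> (b ^ nat \<bar>k\<bar> * ?G) * ?G"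
            using 1 2 b(1) G by (intro mult_mono) auto
          then show "(int_seq \<gamma> k - 0)\<^sup>2 \<le> b ^ nat \<bar>k\<bar> * (?G * ?G)" by (simp add: power2_eq_square mult_ac)
        qed
        also have "\<dots> < \<infinity>" by (rule wfin)
        finally show ?thesis .
      qed
      \<comment> \<open>The parallelogram identity around the zero sequence bounds the squared norm
        of a difference by twice the sum of the squared norms.\<close>
      have "sqdist (r M) (int_seq \<gamma>) \<le> sqdist (r M) (int_seq \<gamma>) + 4 * sqdist (\<lambda>_. 0) (\<lambda>k. (r M k + int_seq \<gamma> k) / 2)"
        by (rule add_increasing2) auto
      also have "\<dots> = 2 * sqdist (r M) (\<lambda>_. 0) + 2 * sqdist (int_seq \<gamma>) (\<lambda>_. 0)"
        using sqdist_parallelogram[of "r M" "int_seq \<gamma>" "\<lambda>_. 0"] by (simp only: sqdist_commute[of "\<lambda>_. 0"])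
      also have "\<dots> < \<infinity>" using g finite_norm by (simp add: ennreal_mult_less_top)
      finally show ?thesis .
    qed
    from sqdist_proj_target_le[OF mem this]
    have "sqdist (proj \<delta> (r M)) (int_seq \<gamma>) \<le> 2 * (\<integral>\<^sup>+k. ennreal (\<bar>proj \<delta> (r M) k - int_seq \<gamma> k\<bar> * \<bar>r M k - int_seq \<gamma> k\<bar>) \<partial>count_space UNIV)"
      by (simp only: \<delta>b)
    also have "\<dots> \<le> 2 * (\<integral>\<^sup>+k. ennreal (P M 0 + ?G) * ennreal (b ^ nat \<bar>k\<bar> * \<bar>r M k - int_seq \<gamma> k\<bar>) \<partial>count_space UNIV)"
    proof (intro mult_left_mono nn_integral_mono)
      fix k
      have "\<bar>P M (nat \<bar>k\<bar>) - \<gamma> (nat \<bar>k\<bar>)\<bar> * \<bar>r M k - int_seq \<gamma> k\<bar> \<le> b ^ nat \<bar>k\<bar> * (P M 0 + ?G) * \<bar>r M k - int_seq \<gamma> k\<bar>"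
        using diff by (intro mult_right_mono) auto
      also have "\<dots> = (P M 0 + ?G) * (b ^ nat \<bar>k\<bar> * \<bar>r M k - int_seq \<gamma> k\<bar>)" by (simp add: mult_ac)
      finally show "ennreal (\<bar>proj \<delta> (r M) k - int_seq \<gamma> k\<bar> * \<bar>r M k - int_seq \<gamma> k\<bar>) \<le>
          ennreal (P M 0 + ?G) * ennreal (b ^ nat \<bar>k\<bar> * \<bar>r M k - int_seq \<gamma> k\<bar>)"
        using moment_cone_nonneg[OF coneP[of M]] G b unfolding P
        by (subst ennreal_mult[symmetric]) (auto intro: ennreal_leI)
    qed auto
    also have "\<dots> = 2 * (ennreal (P M 0 + ?G) * E M)"
      by (simp add: nn_integral_cmult E_def)
    also have "\<dots> = ennreal (2 * ((P M 0 + ?G) * e M))"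
      using moment_cone_nonneg[OF coneP[of M]] G e0[of M] by (simp add: Ee ennreal_mult')
    finally have S: "sqdist (proj \<delta> (r M)) (int_seq \<gamma>) \<le> ennreal (2 * ((P M 0 + ?G) * e M))" .
    \<comment> \<open>The term at lag 0 gives \<open>x^2 <= 2 x e + 4 G e\<close>, an inequality in
      which \<open>x\<close> bounds itself. Absorbing \<open>2 x e\<close> into half of
      \<open>x^2\<close> yields \<open>x^2 <= 4 e^2 + 8 G e\<close>, and \<open>x <= x^2 + 1\<close>
      removes the square.\<close>
    define x where "x = \<bar>P M 0 - ?G\<bar>"
    have "ennreal ((proj \<delta> (r M) 0 - int_seq \<gamma> 0)\<^sup>2) \<le> ennreal (2 * ((P M 0 + ?G) * e M))"
      using point_le_sqdist S by (rule order_trans)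
    then have "x\<^sup>2 \<le> 2 * ((P M 0 + ?G) * e M)"
      using moment_cone_nonneg[OF coneP[of M]] G e0[of M] by (simp add: P x_def)
    moreover have "(P M 0 + ?G) * e M \<le> (x + 2 * ?G) * e M"
      using e0[of M] by (intro mult_right_mono) (auto simp: x_def)
    ultimately have x1: "x\<^sup>2 \<le> 2 * x * e M + 4 * ?G * e M" by (simp add: distrib_right)
    have "2 * x * (2 * e M) \<le> x\<^sup>2 + (2 * e M)\<^sup>2" by (rule sum_squares_bound)
    then have x2: "x\<^sup>2 \<le> 4 * (e M)\<^sup>2 + 8 * ?G * e M" using x1 by (simp add: power_mult_distrib)
    have "0 \<le> x" by (simp add: x_def)
    then have "x \<le> x\<^sup>2 + 1" using sum_squares_bound[of x 1] by (simp only: mult_1_right power_one)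
    then have "x \<le> 4 * (e M)\<^sup>2 + 8 * ?G * e M + 1" using x2 by linarith
    then have "(x + 2 * ?G) * e M \<le> (4 * (e M)\<^sup>2 + 8 * ?G * e M + 1 + 4 * ?G) * e M"
      using e0[of M] G by (intro mult_right_mono) auto
    also have "\<dots> = D M" by (simp add: D_def algebra_simps)
    finally have "(P M 0 + ?G) * e M \<le> D M" using \<open>(P M 0 + ?G) * e M \<le> (x + 2 * ?G) * e M\<close> by linarith
    then show ?thesis using S by (intro order_trans[OF S] ennreal_leI) simp
  qed
  have Dlim: "D \<longlonglongrightarrow> 4 * 0\<^sup>2 * 0 + 8 * ?G * 0 * 0 + 0 + 4 * ?G * 0"
    unfolding D_def[abs_def] by (intro tendsto_intros elim)
  have pt: "(\<lambda>M. \<bar>P M k - \<gamma> k\<bar>) \<longlonglongrightarrow> 0" for k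
  proof -
    have Dnn: "0 \<le> D M" for M using e0[of M] G by (simp add: D_def)
    have "(P M k - \<gamma> k)\<^sup>2 \<le> 2 * D M" for M
    proof -
      have "ennreal ((proj \<delta> (r M) (int k) - int_seq \<gamma> (int k))\<^sup>2) \<le> ennreal (2 * D M)"
        using point_le_sqdist sq by (rule order_trans)
      then show ?thesis using Dnn[of M] by (simp add: P)
    qed
    then have le: "\<bar>P M k - \<gamma> k\<bar> \<le> sqrt (2 * D M)" for M by (metis real_sqrt_abs real_sqrt_le_mono)
    have "(\<lambda>M. sqrt (2 * D M)) \<longlonglongrightarrow> sqrt (2 * 0)"
      using Dlim by (intro tendsto_intros) simp
    then have "(\<lambda>M. sqrt (2 * D M)) \<longlonglongrightarrow> 0" by simp
    then show ?thesis
    proof (rule Lim_null_comparison[rotated])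
      show "\<forall>\<^sub>F M in sequentially. norm \<bar>P M k - \<gamma> k\<bar> \<le> sqrt (2 * D M)"
        using le by (intro always_eventually allI) (simp only: real_norm_def abs_idempotent)
    qed
  qed
  \<comment> \<open>Convergence at lag 0 bounds \<open>P M 0\<close> uniformly in \<open>M\<close>,
    and with it all sequences \<open>P M\<close> by one geometric sequence.\<close>
  obtain C where C: "\<And>M. P M 0 \<le> C"
  proof -
    have "(\<lambda>M. P M 0) \<longlonglongrightarrow> ?G" by (rule LIM_zero_cancel[OF tendsto_rabs_zero_cancel[OF pt]])
    from convergent_imp_Bseq[OF convergentI[OF this]] obtain C where "\<And>M. norm (P M 0) \<le> C" by (auto simp: Bseq_def)
    then have "\<And>M. P M 0 \<le> C" unfolding real_norm_def abs_le_iff by blast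
    then show ?thesis by (rule that)
  qed
  have "(\<lambda>M. l1dist (proj \<delta> (r M)) (int_seq \<gamma>)) \<longlonglongrightarrow> (\<integral>\<^sup>+k. 0 \<partial>count_space (UNIV :: int set))"
    unfolding l1dist_def P
  proof (rule nn_integral_dominated_convergence[OF _ _ _ _ wfin[of "C + ?G"]])
    show "AE k in count_space UNIV. ennreal \<bar>P M (nat \<bar>k\<bar>) - \<gamma> (nat \<bar>k\<bar>)\<bar> \<le> ennreal (b ^ nat \<bar>k\<bar> * (C + ?G))" for M
    proof (intro AE_I2 ennreal_leI)
      fix k :: int
      have "b ^ nat \<bar>k\<bar> * (P M 0 + ?G) \<le> b ^ nat \<bar>k\<bar> * (C + ?G)" using C b by (intro mult_left_mono) auto
      then show "\<bar>P M (nat \<bar>k\<bar>) - \<gamma> (nat \<bar>k\<bar>)\<bar> \<le> b ^ nat \<bar>k\<bar> * (C + ?G)" using diff by (rule order_trans[rotated])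
    qed
    show "AE k in count_space UNIV. (\<lambda>M. ennreal \<bar>P M (nat \<bar>k\<bar>) - \<gamma> (nat \<bar>k\<bar>)\<bar>) \<longlonglongrightarrow> 0"
      using tendsto_ennrealI[OF pt] by (intro AE_I2) simp
  qed auto
  then show ?thesis by simp
qed

lemma moment_cone_l1_finite:
  assumes "moment_cone b \<gamma>" "0 \<le> b" "b < 1" shows "l1dist (int_seq \<gamma>) (\<lambda>_. 0) < \<infinity>"
proof -
  have "l1dist (int_seq \<gamma>) (\<lambda>_. 0) \<le> (\<integral>\<^sup>+k. ennreal (b ^ nat \<bar>k\<bar>) * ennreal (\<gamma> 0) \<partial>count_space (UNIV :: int set))"
    unfolding l1dist_def using moment_cone_abs_le[OF assms(1,2)] assms(2)
    by (intro nn_integral_mono) (simp add: ennreal_leI flip: ennreal_mult')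
  also have "\<dots> = (\<integral>\<^sup>+k. ennreal (b ^ nat \<bar>k\<bar>) \<partial>count_space (UNIV :: int set)) * ennreal (\<gamma> 0)"
    by (simp add: nn_integral_multc)
  also have "\<dots> < \<infinity>" using geometric_int_finite[OF assms(2,3)] by (simp add: ennreal_mult_less_top)
  finally show ?thesis .
qed

section \<open>Sample autocovariances\<close>

text \<open>Truncated subtraction empties the range for \<open>h >= M\<close>, so the case
  distinction of \<open>sample_acov\<close> disappears. Two sequences are allowed because
  combinations produce cross terms.\<close>

definition sample_cov :: "nat \<Rightarrow> (nat \<Rightarrow> real) \<Rightarrow> (nat \<Rightarrow> real) \<Rightarrow> nat \<Rightarrow> real" where
  "sample_cov M a b h =
    (\<Sum>t<M - h. (a t - (\<Sum>t<M. a t) / real M) * (b (t + h) - (\<Sum>t<M. b t) / real M)) / real M"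

lemma sample_acov_eq: "sample_acov M y k = sample_cov M y y (nat \<bar>k\<bar>)"
  by (simp add: sample_acov_def sample_cov_def Let_def)

text \<open>The coefficients \<open>u\<close> and \<open>v\<close> will be random and change with
  \<open>M\<close>. Expanding isolates them from sample covariances of fixed functions, to which the
  ergodic theorem applies.\<close>

lemma sample_cov_combination:
  "sample_cov M (\<lambda>t. u * a t + v * b t) (\<lambda>t. u * a t + v * b t) h =
    u\<^sup>2 * sample_cov M a a h + u * v * (sample_cov M a b h + sample_cov M b a h) + v\<^sup>2 * sample_cov M b b h"
proof -
  let ?A = "(\<Sum>t<M. a t) / real M" and ?B = "(\<Sum>t<M. b t) / real M"
  have mean: "(\<Sum>t<M. u * a t + v * b t) / real M = u * ?A + v * ?B"
    by (simp add: sum.distrib sum_distrib_left add_divide_distrib)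
  have "(u * a t + v * b t - (u * ?A + v * ?B)) * (u * a (t + h) + v * b (t + h) - (u * ?A + v * ?B)) =
      u\<^sup>2 * ((a t - ?A) * (a (t + h) - ?A)) + u * v * ((a t - ?A) * (b (t + h) - ?B))
      + u * v * ((b t - ?B) * (a (t + h) - ?A)) + v\<^sup>2 * ((b t - ?B) * (b (t + h) - ?B))" for t
    by (simp only: power2_eq_square) algebra
  then show ?thesis
    unfolding sample_cov_def mean
    by (simp only: sum.distrib sum_distrib_left[symmetric] add_divide_distrib distrib_left times_divide_eq_right add.assoc)
qed

text \<open>Relies on the division by \<open>M\<close> at every lag: dropping terms from the sums of
  squares can then only decrease them. It supplies the uniform bound for dominated convergence in
  \<open>proj_l1_tendsto\<close>.\<close>

lemma abs_sample_cov_le: "\<bar>sample_cov M y y h\<bar> \<le> sample_cov M y y 0"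
proof -
  define z where "z t = y t - (\<Sum>t<M. y t) / real M" for t
  have "\<bar>\<Sum>t<M - h. z t * z (t + h)\<bar> \<le> (\<Sum>t<M - h. \<bar>z t * z (t + h)\<bar>)" by (rule sum_abs)
  also have "\<dots> \<le> (\<Sum>t<M - h. ((z t)\<^sup>2 + (z (t + h))\<^sup>2) / 2)"
  proof (rule sum_mono)
    fix t
    show "\<bar>z t * z (t + h)\<bar> \<le> ((z t)\<^sup>2 + (z (t + h))\<^sup>2) / 2"
      using sum_squares_bound[of "\<bar>z t\<bar>" "\<bar>z (t + h)\<bar>"] by (simp add: abs_mult)
  qed
  also have "\<dots> = ((\<Sum>t<M - h. (z t)\<^sup>2) + (\<Sum>t<M - h. (z (t + h))\<^sup>2)) / 2"
    by (simp add: sum.distrib flip: sum_divide_distrib)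
  also have "\<dots> \<le> ((\<Sum>t<M. (z t)\<^sup>2) + (\<Sum>t<M. (z t)\<^sup>2)) / 2"
  proof -
    have "(\<Sum>t<M - h. (z t)\<^sup>2) \<le> (\<Sum>t<M. (z t)\<^sup>2)" by (intro sum_mono2) auto
    moreover have "(\<Sum>t<M - h. (z (t + h))\<^sup>2) = (\<Sum>t\<in>(\<lambda>t. t + h) ` {..<M - h}. (z t)\<^sup>2)"
      by (subst sum.reindex) auto
    moreover have "\<dots> \<le> (\<Sum>t<M. (z t)\<^sup>2)" by (intro sum_mono2) auto
    ultimately have "(\<Sum>t<M - h. (z t)\<^sup>2) \<le> (\<Sum>t<M. (z t)\<^sup>2)" "(\<Sum>t<M - h. (z (t + h))\<^sup>2) \<le> (\<Sum>t<M. (z t)\<^sup>2)"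
      by simp_all
    then show ?thesis by (intro divide_right_mono add_mono) simp_all
  qed
  finally have "\<bar>\<Sum>t<M - h. z t * z (t + h)\<bar> \<le> (\<Sum>t<M - 0. z t * z (t + 0))"
    by (simp add: power2_eq_square)
  then have "\<bar>\<Sum>t<M - h. z t * z (t + h)\<bar> / real M \<le> (\<Sum>t<M - 0. z t * z (t + 0)) / real M"
    by (rule divide_right_mono) simp
  then show ?thesis unfolding sample_cov_def z_def by simp
qed

lemma average_shift:
  fixes b :: "nat \<Rightarrow> real"
  assumes "(\<lambda>n. (\<Sum>t<n. b t) / real n) \<longlonglongrightarrow> B"
  shows "(\<lambda>n. (\<Sum>t<n. b (t + h)) / real n) \<longlonglongrightarrow> B"
proof (induction h)
  case (Suc h)
  then show ?case using average_Suc_iff[of "\<lambda>t. b (t + h)" B] by simp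
qed (use assms in simp)

lemma truncated_average:
  fixes x :: "nat \<Rightarrow> real"
  assumes "(\<lambda>n. (\<Sum>t<n. x t) / real n) \<longlonglongrightarrow> l"
  shows "(\<lambda>M. (\<Sum>t<M - h. x t) / real M) \<longlonglongrightarrow> l"
proof (rule LIMSEQ_offset[where k=h])
  have r: "(\<lambda>n. real n / real (n + h)) \<longlonglongrightarrow> 1" by real_asymp
  have "(\<lambda>n. (\<Sum>t<n. x t) / real n * (real n / real (n + h))) \<longlonglongrightarrow> l * 1"
    by (intro tendsto_mult assms r)
  then have "(\<lambda>n. (\<Sum>t<n. x t) / real n * (real n / real (n + h))) \<longlonglongrightarrow> l" by simp
  then show "(\<lambda>M. (\<Sum>t<M + h - h. x t) / real (M + h)) \<longlonglongrightarrow> l"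
    by (rule Lim_transform_eventually) (auto intro!: eventually_sequentiallyI[of 1])
qed

lemma sample_cov_tendsto:
  assumes a: "(\<lambda>n. (\<Sum>t<n. a t) / real n) \<longlonglongrightarrow> A" and b: "(\<lambda>n. (\<Sum>t<n. b t) / real n) \<longlonglongrightarrow> B"
    and c: "(\<lambda>n. (\<Sum>t<n. a t * b (t + h)) / real n) \<longlonglongrightarrow> C"
  shows "(\<lambda>M. sample_cov M a b h) \<longlonglongrightarrow> C - A * B"
proof -
  let ?A = "\<lambda>M. (\<Sum>t<M. a t) / real M" and ?B = "\<lambda>M. (\<Sum>t<M. b t) / real M"
  have "sample_cov M a b h = (\<Sum>t<M - h. a t * b (t + h)) / real M - ?B M * ((\<Sum>t<M - h. a t) / real M)
      - ?A M * ((\<Sum>t<M - h. b (t + h)) / real M) + ?A M * ?B M * ((\<Sum>t<M - h. 1) / real M)" for M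
  proof -
    have "(a t - ?A M) * (b (t + h) - ?B M) = a t * b (t + h) - ?B M * a t - ?A M * b (t + h) + ?A M * ?B M * 1" for t
      by (simp add: left_diff_distrib right_diff_distrib mult.commute)
    then show ?thesis unfolding sample_cov_def
      by (simp only: sum.distrib sum_subtractf sum_distrib_left[symmetric] add_divide_distrib diff_divide_distrib times_divide_eq_right)
  qed
  moreover have one: "(\<lambda>n. (\<Sum>t<n. 1) / real n) \<longlonglongrightarrow> 1"
  proof -
    have "(\<lambda>n. (1::real)) \<longlonglongrightarrow> 1" by (rule tendsto_const)
    then show ?thesis by (rule Lim_transform_eventually) (auto intro!: eventually_sequentiallyI[of 1])
  qed
  have "(\<lambda>M. (\<Sum>t<M - h. a t * b (t + h)) / real M - ?B M * ((\<Sum>t<M - h. a t) / real M)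
      - ?A M * ((\<Sum>t<M - h. b (t + h)) / real M) + ?A M * ?B M * ((\<Sum>t<M - h. 1) / real M))
      \<longlonglongrightarrow> C - B * A - A * B + A * B * 1"
    by (intro tendsto_add tendsto_diff tendsto_mult a b c one truncated_average average_shift)
  ultimately show ?thesis by (simp add: mult.commute)
qed

lemma sqdist_zero_finite:
  assumes "finite {k. r k \<noteq> 0}" shows "sqdist r (\<lambda>_. 0) < \<infinity>"
proof -
  have "{k. 0 < ennreal ((r k)\<^sup>2)} = {k. r k \<noteq> 0}" by auto
  then have "sqdist r (\<lambda>_. 0) = (\<Sum>k | r k \<noteq> 0. ennreal ((r k)\<^sup>2))"
    unfolding sqdist_def using assms by (subst nn_integral_count_space) auto
  also have "\<dots> < \<infinity>" using assms by (auto simp: sum_ennreal)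
  finally show ?thesis .
qed

lemma l1dist_summable:
  assumes "l1dist f (\<lambda>_. 0) < \<infinity>"
  shows "f summable_on UNIV" "\<bar>\<Sum>\<^sub>\<infinity>k. f k\<bar> \<le> enn2real (l1dist f (\<lambda>_. 0))"
proof -
  have int: "integrable (count_space UNIV) f"
    using assms by (intro integrableI_bounded) (simp_all add: l1dist_def)
  then have "(\<lambda>k. norm (f k)) summable_on UNIV"
    using abs_summable_equivalent[of f UNIV] by (simp add: Infinite_Set_Sum.abs_summable_on_def)
  then show "f summable_on UNIV" by (rule abs_summable_summable)
  have "(\<Sum>\<^sub>\<infinity>k. f k) = (\<integral>k. f k \<partial>count_space UNIV)"
    using infsetsum_infsum[of f UNIV] int by (simp add: Infinite_Set_Sum.abs_summable_on_def infsetsum_def)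
  moreover have "\<bar>\<integral>k. f k \<partial>count_space UNIV\<bar> \<le> (\<integral>k. \<bar>f k\<bar> \<partial>count_space UNIV)"
    by (rule integral_abs_bound)
  moreover have "(\<integral>k. \<bar>f k\<bar> \<partial>count_space UNIV) = enn2real (l1dist f (\<lambda>_. 0))"
    by (subst integral_eq_nn_integral) (auto simp: l1dist_def)
  ultimately show "\<bar>\<Sum>\<^sub>\<infinity>k. f k\<bar> \<le> enn2real (l1dist f (\<lambda>_. 0))" by simp
qed

lemma l1dist_triangle: "l1dist f h \<le> l1dist f g + l1dist g h"
proof -
  have "l1dist f h \<le> (\<integral>\<^sup>+k. ennreal \<bar>f k - g k\<bar> + ennreal \<bar>g k - h k\<bar> \<partial>count_space UNIV)"
    unfolding l1dist_def by (intro nn_integral_mono) (simp flip: ennreal_plus)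
  then show ?thesis by (simp add: l1dist_def nn_integral_add)
qed

text \<open>The l1 distance controls both the squared l2 distance and the difference of the sums.
  Once it is below 1 its square is below itself; before that it may be infinite, so summability of
  \<open>f M\<close> is claimed only eventually.\<close>

lemma l1_convergence_consequences:
  assumes lim: "(\<lambda>M. l1dist (f M) g) \<longlonglongrightarrow> 0" and g: "l1dist g (\<lambda>_. 0) < \<infinity>"
  shows "(\<lambda>M. sqdist (f M) g) \<longlonglongrightarrow> 0"
    and "g summable_on UNIV"
    and "\<forall>\<^sub>F M in sequentially. f M summable_on UNIV"
    and "(\<lambda>M. \<bar>(\<Sum>\<^sub>\<infinity>k. f M k) - (\<Sum>\<^sub>\<infinity>k. g k)\<bar>) \<longlonglongrightarrow> 0"
proof -
  have "\<forall>\<^sub>F M in sequentially. l1dist (f M) g < 1" using lim by (rule order_tendstoD) simp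
  then have fin: "\<forall>\<^sub>F M in sequentially. l1dist (f M) g < \<infinity> \<and> l1dist (f M) g < 1"
    by eventually_elim (auto intro: less_trans)
  show "(\<lambda>M. sqdist (f M) g) \<longlonglongrightarrow> 0"
  proof (rule tendsto_sandwich[OF _ _ tendsto_const lim])
    show "\<forall>\<^sub>F M in sequentially. sqdist (f M) g \<le> l1dist (f M) g"
      using fin
    proof eventually_elim
      case (elim M)
      have "sqdist (f M) g \<le> l1dist (f M) g * l1dist (f M) g" by (rule sqdist_le_l1dist)
      also have "\<dots> \<le> 1 * l1dist (f M) g" using elim by (intro mult_right_mono) auto
      finally show ?case by simp
    qed
  qed simp
  show gs: "g summable_on UNIV" using g by (rule l1dist_summable)
  show fs: "\<forall>\<^sub>F M in sequentially. f M summable_on UNIV"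
    using fin
  proof eventually_elim
    case (elim M)
    have "l1dist (f M) (\<lambda>_. 0) \<le> l1dist (f M) g + l1dist g (\<lambda>_. 0)" by (rule l1dist_triangle)
    also have "\<dots> < \<infinity>" using elim g by simp
    finally show ?case by (rule l1dist_summable)
  qed
  show "(\<lambda>M. \<bar>(\<Sum>\<^sub>\<infinity>k. f M k) - (\<Sum>\<^sub>\<infinity>k. g k)\<bar>) \<longlonglongrightarrow> 0"
  proof (rule tendsto_sandwich[OF _ _ tendsto_const])
    show "(\<lambda>M. enn2real (l1dist (f M) g)) \<longlonglongrightarrow> 0"
      using tendsto_enn2real[OF _ , of "\<lambda>M. l1dist (f M) g" 0 sequentially] lim by simp
    show "\<forall>\<^sub>F M in sequentially. \<bar>(\<Sum>\<^sub>\<infinity>k. f M k) - (\<Sum>\<^sub>\<infinity>k. g k)\<bar> \<le> enn2real (l1dist (f M) g)"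
      using fin fs
    proof eventually_elim
      case (elim M)
      have "l1dist (\<lambda>k. f M k - g k) (\<lambda>_. 0) = l1dist (f M) g" by (simp add: l1dist_def)
      moreover have "(\<Sum>\<^sub>\<infinity>k. f M k) - (\<Sum>\<^sub>\<infinity>k. g k) = (\<Sum>\<^sub>\<infinity>k. f M k - g k)"
        using infsum_add[of "f M" UNIV "\<lambda>k. - g k"] elim gs by (simp add: infsum_uminus summable_on_uminus)
      ultimately show ?case using l1dist_summable(2)[of "\<lambda>k. f M k - g k"] elim by simp
    qed
  qed simp
qed

lemma l1dist_scaled_difference:
  assumes p: "(\<lambda>M. l1dist (pM M) p) \<longlonglongrightarrow> 0" and q: "(\<lambda>M. l1dist (qM M) q) \<longlonglongrightarrow> 0"
    and pfin: "l1dist p (\<lambda>_. 0) < \<infinity>" and qfin: "l1dist q (\<lambda>_. 0) < \<infinity>"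
    and c: "cM \<longlonglongrightarrow> c" and c0: "(c::real) \<noteq> 0"
  shows "(\<lambda>M. l1dist (\<lambda>k. (pM M k - qM M k) / cM M) (\<lambda>k. (p k - q k) / c)) \<longlonglongrightarrow> 0"
proof -
  define B where "B = \<bar>1 / c\<bar> + 1"
  have inv: "(\<lambda>M. 1 / cM M) \<longlonglongrightarrow> 1 / c" using c c0 by (intro tendsto_intros)
  have ev: "\<forall>\<^sub>F M in sequentially. \<bar>1 / cM M\<bar> < B"
    using tendsto_rabs[OF inv] by (rule order_tendstoD) (simp add: B_def)
  let ?K = "l1dist p (\<lambda>_. 0) + l1dist q (\<lambda>_. 0)"
  obtain K where K: "?K = ennreal K" "0 \<le> K" using pfin qfin by (cases ?K) auto
  have le: "l1dist (\<lambda>k. (pM M k - qM M k) / cM M) (\<lambda>k. (p k - q k) / c) \<le>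
      ennreal B * (l1dist (pM M) p + l1dist (qM M) q) + ennreal (\<bar>1 / cM M - 1 / c\<bar> * K)" if "\<bar>1 / cM M\<bar> < B" for M
  proof -
    have "ennreal \<bar>(pM M k - qM M k) / cM M - (p k - q k) / c\<bar> \<le>
        ennreal B * (ennreal \<bar>pM M k - p k\<bar> + ennreal \<bar>qM M k - q k\<bar>)
        + ennreal \<bar>1 / cM M - 1 / c\<bar> * (ennreal \<bar>p k - 0\<bar> + ennreal \<bar>q k - 0\<bar>)" for k
    proof -
      have "(pM M k - qM M k) / cM M - (p k - q k) / c =
          1 / cM M * (pM M k - p k) - 1 / cM M * (qM M k - q k) + (1 / cM M - 1 / c) * (p k - q k)"
        by (simp add: diff_divide_distrib left_diff_distrib right_diff_distrib)
      then have "\<bar>(pM M k - qM M k) / cM M - (p k - q k) / c\<bar> \<le>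
          \<bar>1 / cM M\<bar> * \<bar>pM M k - p k\<bar> + \<bar>1 / cM M\<bar> * \<bar>qM M k - q k\<bar> + \<bar>1 / cM M - 1 / c\<bar> * \<bar>p k - q k\<bar>"
        by (simp only: abs_mult[symmetric])
      also have "\<dots> \<le> B * \<bar>pM M k - p k\<bar> + B * \<bar>qM M k - q k\<bar> + \<bar>1 / cM M - 1 / c\<bar> * (\<bar>p k\<bar> + \<bar>q k\<bar>)"
        using that by (intro add_mono mult_right_mono mult_left_mono) auto
      finally have "ennreal \<bar>(pM M k - qM M k) / cM M - (p k - q k) / c\<bar> \<le>
          ennreal (B * (\<bar>pM M k - p k\<bar> + \<bar>qM M k - q k\<bar>) + \<bar>1 / cM M - 1 / c\<bar> * (\<bar>p k\<bar> + \<bar>q k\<bar>))"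
        by (intro ennreal_leI) (simp add: distrib_left)
      also have "\<dots> = ennreal B * (ennreal \<bar>pM M k - p k\<bar> + ennreal \<bar>qM M k - q k\<bar>)
        + ennreal \<bar>1 / cM M - 1 / c\<bar> * (ennreal \<bar>p k - 0\<bar> + ennreal \<bar>q k - 0\<bar>)"
        by (simp add: B_def ennreal_mult)
      finally show ?thesis .
    qed
    then have "l1dist (\<lambda>k. (pM M k - qM M k) / cM M) (\<lambda>k. (p k - q k) / c) \<le>
        (\<integral>\<^sup>+k. ennreal B * (ennreal \<bar>pM M k - p k\<bar> + ennreal \<bar>qM M k - q k\<bar>)
        + ennreal \<bar>1 / cM M - 1 / c\<bar> * (ennreal \<bar>p k - 0\<bar> + ennreal \<bar>q k - 0\<bar>) \<partial>count_space UNIV)"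
      unfolding l1dist_def by (rule nn_integral_mono)
    also have "\<dots> = ennreal B * (l1dist (pM M) p + l1dist (qM M) q) + ennreal \<bar>1 / cM M - 1 / c\<bar> * ?K"
      unfolding l1dist_def by (subst nn_integral_add; simp add: nn_integral_add nn_integral_cmult)
    finally show ?thesis using K by (simp add: ennreal_mult)
  qed
  have "(\<lambda>M. ennreal B * (l1dist (pM M) p + l1dist (qM M) q) + ennreal (\<bar>1 / cM M - 1 / c\<bar> * K))
      \<longlonglongrightarrow> ennreal B * (0 + 0) + ennreal (\<bar>1 / c - 1 / c\<bar> * K)"
    by (intro tendsto_add ennreal_tendsto_cmult tendsto_ennrealI tendsto_mult tendsto_rabs tendsto_diff tendsto_const inv p q) simp
  then have lim: "(\<lambda>M. ennreal B * (l1dist (pM M) p + l1dist (qM M) q) + ennreal (\<bar>1 / cM M - 1 / c\<bar> * K)) \<longlonglongrightarrow> 0"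
    by simp
  show ?thesis
  proof (rule tendsto_sandwich[OF _ _ tendsto_const lim])
    show "\<forall>\<^sub>F M in sequentially. l1dist (\<lambda>k. (pM M k - qM M k) / cM M) (\<lambda>k. (p k - q k) / c) \<le>
      ennreal B * (l1dist (pM M) p + l1dist (qM M) q) + ennreal (\<bar>1 / cM M - 1 / c\<bar> * K)"
      using ev by eventually_elim (rule le)
  qed simp
qed

text \<open>Any constant \<open>C\<close> is good enough: the rate alone confines the representing
  measure, and the measure then improves the constant to \<open>\<gamma> 0\<close>. For combinations
  of functions the available constant is not the value at lag 0.\<close>

lemma moment_cone_of_decay:
  fixes \<gamma> :: "nat \<Rightarrow> real"
  assumes h: "hankel_bounded \<gamma>" and b: "0 \<le> b" "b \<le> 1" and decay: "\<And>n. \<gamma> (2 * n) \<le> C * b ^ (2 * n)"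
  shows "moment_cone b \<gamma>"
proof -
  obtain F where "moment_rep 1 \<gamma> F" using hausdorff_moment[OF h] by blast
  then have "moment_rep b \<gamma> F" using b(1) decay by (rule moment_rep_shrink)
  then show ?thesis using b by (rule moment_rep_imp_cone)
qed

lemma moment_cone_mono:
  assumes "moment_cone a \<gamma>" "0 \<le> a" "a \<le> b" shows "moment_cone b \<gamma>"
  unfolding moment_cone_def
proof (intro conjI allI)
  show "hankel_bounded \<gamma>" using assms(1) by (simp add: moment_cone_def)
  fix n
  have "\<gamma> (2 * n) \<le> a ^ (2 * n) * \<gamma> 0" using assms(1) unfolding moment_cone_def by blast
  also have "\<dots> \<le> b ^ (2 * n) * \<gamma> 0"
    using assms moment_cone_nonneg[OF assms(1)] by (intro mult_right_mono power_mono) auto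
  finally show "\<gamma> (2 * n) \<le> b ^ (2 * n) * \<gamma> 0" .
qed

lemma spectral_rep_iff: "spectral_rep (int_seq \<gamma>) F \<longleftrightarrow> moment_rep 1 \<gamma> F"
proof -
  have "(\<forall>k::int. \<gamma> (nat \<bar>k\<bar>) = (\<integral>x. x ^ nat \<bar>k\<bar> \<partial>F)) \<longleftrightarrow> (\<forall>k. \<gamma> k = (\<integral>x. x ^ k \<partial>F))"
    by (metis abs_of_nat nat_int)
  then show ?thesis by (simp add: spectral_rep_def moment_rep_def)
qed

text \<open>Existence and uniqueness identify the definite description in
  \<open>spectral_measure\<close>; only then does the gap turn into decay of \<gamma>.\<close>

lemma spec_gap_cone:
  assumes h: "hankel_bounded \<gamma>" and \<delta>: "0 < \<delta>" "\<delta> \<le> spec_gap (spectral_measure (int_seq \<gamma>))"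
  shows "\<delta> \<le> 1" "moment_cone (1 - \<delta>) \<gamma>"
proof -
  obtain F where F: "moment_rep 1 \<gamma> F" using hausdorff_moment[OF h] by blast
  have "spectral_measure (int_seq \<gamma>) = F"
    unfolding spectral_measure_def spectral_rep_iff using F moment_rep_unique by (intro the_equality) auto
  with \<delta> have gap: "\<delta> \<le> spec_gap F" by simp
  show d1: "\<delta> \<le> 1" by (rule moment_rep_spec_gap(1)[OF F gap])
  show "moment_cone (1 - \<delta>) \<gamma>"
    using moment_rep_spec_gap(2)[OF F gap] d1 \<delta>(1) by (intro moment_rep_imp_cone) auto
qed

lemma l1dist_scaled_difference_le:
  "l1dist (\<lambda>k. (p k - q k) / c) (\<lambda>_. 0) \<le> ennreal \<bar>1 / c\<bar> * (l1dist p (\<lambda>_. 0) + l1dist q (\<lambda>_. 0))"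
proof -
  have "ennreal \<bar>(p k - q k) / c - 0\<bar> \<le> ennreal \<bar>1 / c\<bar> * (ennreal \<bar>p k - 0\<bar> + ennreal \<bar>q k - 0\<bar>)" for k
  proof -
    have "\<bar>(p k - q k) / c - 0\<bar> = \<bar>1 / c\<bar> * \<bar>p k - q k\<bar>" by simp
    also have "\<dots> \<le> \<bar>1 / c\<bar> * (\<bar>p k - 0\<bar> + \<bar>q k - 0\<bar>)" by (intro mult_left_mono) auto
    finally have "ennreal \<bar>(p k - q k) / c - 0\<bar> \<le> ennreal (\<bar>1 / c\<bar> * (\<bar>p k - 0\<bar> + \<bar>q k - 0\<bar>))" by (rule ennreal_leI)
    also have "\<dots> = ennreal \<bar>1 / c\<bar> * (ennreal \<bar>p k - 0\<bar> + ennreal \<bar>q k - 0\<bar>)"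
      by (subst ennreal_mult) auto
    finally show ?thesis .
  qed
  then have "l1dist (\<lambda>k. (p k - q k) / c) (\<lambda>_. 0) \<le>
      (\<integral>\<^sup>+k. ennreal \<bar>1 / c\<bar> * (ennreal \<bar>p k - 0\<bar> + ennreal \<bar>q k - 0\<bar>) \<partial>count_space UNIV)"
    unfolding l1dist_def by (rule nn_integral_mono)
  then show ?thesis by (simp add: l1dist_def nn_integral_cmult nn_integral_add)
qed

section \<open>The estimator along the path of the chain\<close>

locale stationary_reversible_markov = markov Q Px X + reversible_chain Q \<pi>
  for Q :: "'a::polish_space \<Rightarrow> 'a measure" and Px :: "'a \<Rightarrow> 'b measure" and X and \<pi> +
  assumes setwise_conv: "\<And>x A. A \<in> sets borel \<Longrightarrow> (\<lambda>n. measure (kernel_pow Q n x) A) \<longlonglongrightarrow> measure \<pi> A"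
begin

sublocale erg: ergodic_markov Q Px X \<pi>
proof (intro ergodic_markov.intro ergodic_markov_axioms.intro markov_axioms prob_space_pi sets_pi)
  interpret Q: kernel_pair \<pi> Q by (rule kernel_pair_Q)
  show "(\<integral>\<^sup>+x. emeasure (Q x) A \<partial>\<pi>) = emeasure \<pi> A" if "A \<in> sets borel" for A
    using Q.stationary[of "indicator A"] that by simp
qed (rule setwise_conv)

lemma distr_stat_law_coord: "distr erg.stat_law borel (\<lambda>\<omega>. \<omega> n) = \<pi>"
proof -
  have "distr erg.stat_law borel (\<lambda>\<omega>. \<omega> n) = bind \<pi> (\<lambda>x. distr (path_law x) borel (\<lambda>\<omega>. \<omega> n))"
    unfolding erg.stat_law_def
    by (rule distr_bind[where K=paths]) (auto simp: measurable_cong_sets[OF sets_pi refl])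
  also have "\<dots> = \<pi>" unfolding distr_path_law_coord by (rule pow.bind_pi_P)
  finally show ?thesis .
qed

lemma stat_law_product:
  assumes f: "pow.L2 f" and g: "pow.L2 g"
  shows "integrable erg.stat_law (\<lambda>\<omega>. f (\<omega> 0) * g (\<omega> h))"
    and "(\<integral>\<omega>. f (\<omega> 0) * g (\<omega> h) \<partial>erg.stat_law) = form f h g"
proof -
  note [measurable] = pow.L2_measurable[OF f] pow.L2_measurable[OF g]
  have sq: "integrable erg.stat_law (\<lambda>\<omega>. (u (\<omega> n))\<^sup>2)" if u: "pow.L2 u" for u n
  proof -
    note [measurable] = pow.L2_measurable[OF u]
    have "integrable (distr erg.stat_law borel (\<lambda>\<omega>. \<omega> n)) (\<lambda>x. (u x)\<^sup>2)"
      unfolding distr_stat_law_coord by (rule pow.L2_square_integrable[OF u])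
    then show ?thesis by (subst (asm) integrable_distr_eq) auto
  qed
  show int: "integrable erg.stat_law (\<lambda>\<omega>. f (\<omega> 0) * g (\<omega> h))"
  proof (rule Bochner_Integration.integrable_bound)
    show "integrable erg.stat_law (\<lambda>\<omega>. (f (\<omega> 0))\<^sup>2 + (g (\<omega> h))\<^sup>2)" using sq[OF f] sq[OF g] by simp
    show "AE \<omega> in erg.stat_law. norm (f (\<omega> 0) * g (\<omega> h)) \<le> norm ((f (\<omega> 0))\<^sup>2 + (g (\<omega> h))\<^sup>2)"
      using abs_mult_le_sum_squares by simp
  qed measurable
  have start: "(\<integral>\<omega>. f (\<omega> 0) * g (\<omega> h) \<partial>path_law x) = f x * op h g x" for x
  proof -
    have "(\<integral>\<omega>. f (\<omega> 0) * g (\<omega> h) \<partial>path_law x) = (\<integral>\<omega>. f x * g (\<omega> h) \<partial>path_law x)"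
      using AE_path_law_start[of x] by (intro integral_cong_AE) auto
    also have "(\<integral>\<omega>. g (\<omega> h) \<partial>path_law x) = op h g x"
      unfolding op_def distr_path_law_coord[symmetric] by (subst integral_distr) auto
    then have "(\<integral>\<omega>. f x * g (\<omega> h) \<partial>path_law x) = f x * op h g x" by simp
    finally show ?thesis .
  qed
  have "path_law \<in> measurable \<pi> (subprob_algebra paths)"
    by (simp add: measurable_cong_sets[OF sets_pi refl])
  from integral_bind_integrable[OF this _ int[unfolded erg.stat_law_def]]
  show "(\<integral>\<omega>. f (\<omega> 0) * g (\<omega> h) \<partial>erg.stat_law) = form f h g"
    by (simp add: erg.stat_law_def start form_def)
qed

lemma AE_average_product:
  assumes "pow.L2 f" "pow.L2 g"
  shows "AE \<omega> in Px x. (\<lambda>n. (\<Sum>t<n. f (X t \<omega>) * g (X (t + h) \<omega>)) / real n) \<longlonglongrightarrow> form f h g"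
  using erg.AE_path_average[OF stat_law_product(1)[OF assms, of h], of x] stat_law_product(2)[OF assms, of h]
  by simp

lemma AE_average:
  assumes f: "pow.L2 f"
  shows "AE \<omega> in Px x. (\<lambda>n. (\<Sum>t<n. f (X t \<omega>)) / real n) \<longlonglongrightarrow> (\<integral>x. f x \<partial>\<pi>)"
proof -
  have "form f 0 (\<lambda>_. 1) = (\<integral>x. f x \<partial>\<pi>)" by (simp add: form_def op_0)
  then show ?thesis using AE_average_product[OF f pow.L2_const[of 1], where x=x and h=0] by simp
qed

lemma AE_sample_cov:
  assumes f: "pow.L2 f" and g: "pow.L2 g"
  shows "AE \<omega> in Px x. \<forall>h. (\<lambda>M. sample_cov M (\<lambda>t. f (X t \<omega>)) (\<lambda>t. g (X t \<omega>)) h) \<longlonglongrightarrow> cov_lag \<pi> Q f g h"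
proof -
  have "AE \<omega> in Px x. \<forall>h. (\<lambda>n. (\<Sum>t<n. f (X t \<omega>) * g (X (t + h) \<omega>)) / real n) \<longlonglongrightarrow> form f h g"
    by (intro AE_all_countable[THEN iffD2] allI AE_average_product f g)
  then show ?thesis
    using AE_average[OF f] AE_average[OF g]
  proof eventually_elim
    case (elim \<omega>)
    then show ?case
      unfolding cov_lag_eq_form(2)[OF f g] by (intro allI sample_cov_tendsto) auto
  qed
qed

lemma cov_lag_cone:
  assumes g: "pow.L2 g" and \<delta>: "0 < \<delta>" "\<delta> \<le> spec_gap (spectral_measure (acov \<pi> Q g g))"
  shows "\<delta> \<le> 1" "moment_cone (1 - \<delta>) (cov_lag \<pi> Q g g)"
proof -
  have "acov \<pi> Q g g = int_seq (cov_lag \<pi> Q g g)" using g by (simp add: fun_eq_iff acov_eq_cov_lag)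
  moreover have "hankel_bounded (cov_lag \<pi> Q g g)"
    using abs_hankel_form_cov_le[OF g] by (simp add: hankel_bounded_def)
  ultimately show "\<delta> \<le> 1" "moment_cone (1 - \<delta>) (cov_lag \<pi> Q g g)"
    using spec_gap_cone[of "cov_lag \<pi> Q g g" \<delta>] \<delta> by simp_all
qed

text \<open>The parallelogram identity bounds the even autocovariances of a combination by those of \<open>f\<close> and \<open>g\<close>,
  so the spectral measure of the combination lives on the same interval.\<close>
lemma cov_lag_combination_cone:
  assumes f: "pow.L2 f" and g: "pow.L2 g" and b: "0 \<le> b" "b \<le> 1"
    and cf: "moment_cone b (cov_lag \<pi> Q f f)" and cg: "moment_cone b (cov_lag \<pi> Q g g)"
  shows "moment_cone b (cov_lag \<pi> Q (\<lambda>x. u * f x + v * g x) (\<lambda>x. u * f x + v * g x))"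
proof (rule moment_cone_of_decay[OF _ b])
  have L: "pow.L2 (\<lambda>x. u * f x + v * g x)" "pow.L2 (\<lambda>x. u * f x + (- v) * g x)"
    by (rule pow.L2_add[OF pow.L2_cmult[OF f] pow.L2_cmult[OF g]])+
  show "hankel_bounded (cov_lag \<pi> Q (\<lambda>x. u * f x + v * g x) (\<lambda>x. u * f x + v * g x))"
    using abs_hankel_form_cov_le[OF L(1)] by (simp add: hankel_bounded_def)
  fix n
  let ?F = "cov_lag \<pi> Q f f" and ?G = "cov_lag \<pi> Q g g"
  have "0 \<le> cov_lag \<pi> Q (\<lambda>x. u * f x + (- v) * g x) (\<lambda>x. u * f x + (- v) * g x) (2 * n)"
    by (rule cov_lag_even_nonneg[OF L(2)])
  then have "cov_lag \<pi> Q (\<lambda>x. u * f x + v * g x) (\<lambda>x. u * f x + v * g x) (2 * n) \<le>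
      2 * u\<^sup>2 * ?F (2 * n) + 2 * v\<^sup>2 * ?G (2 * n)"
    unfolding cov_lag_combination[OF f g] by simp
  also have "\<dots> \<le> 2 * u\<^sup>2 * (b ^ (2 * n) * ?F 0) + 2 * v\<^sup>2 * (b ^ (2 * n) * ?G 0)"
    using cf cg by (intro add_mono mult_left_mono) (auto simp: moment_cone_def)
  also have "\<dots> = (2 * u\<^sup>2 * ?F 0 + 2 * v\<^sup>2 * ?G 0) * b ^ (2 * n)" by (simp add: algebra_simps)
  finally show "cov_lag \<pi> Q (\<lambda>x. u * f x + v * g x) (\<lambda>x. u * f x + v * g x) (2 * n) \<le>
      (2 * u\<^sup>2 * ?F 0 + 2 * v\<^sup>2 * ?G 0) * b ^ (2 * n)" .
qed

text \<open>Deterministic along one path \<open>xs\<close>: all randomness is contained in the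
  convergence of four sample covariances, and the weights are ordinary convergent sequences, free to
  depend on the path.\<close>

lemma proj_sample_acov_tendsto:
  assumes f: "pow.L2 f" and g: "pow.L2 g" and \<delta>: "0 < \<delta>" "\<delta> \<le> 1"
    and cf: "moment_cone (1 - \<delta>) (cov_lag \<pi> Q f f)" and cg: "moment_cone (1 - \<delta>) (cov_lag \<pi> Q g g)"
    and u: "u \<longlonglongrightarrow> u0" and v: "v \<longlonglongrightarrow> v0"
    and ff: "\<And>h. (\<lambda>M. sample_cov M (\<lambda>t. f (xs t)) (\<lambda>t. f (xs t)) h) \<longlonglongrightarrow> cov_lag \<pi> Q f f h"
    and fg: "\<And>h. (\<lambda>M. sample_cov M (\<lambda>t. f (xs t)) (\<lambda>t. g (xs t)) h) \<longlonglongrightarrow> cov_lag \<pi> Q f g h"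
    and gf: "\<And>h. (\<lambda>M. sample_cov M (\<lambda>t. g (xs t)) (\<lambda>t. f (xs t)) h) \<longlonglongrightarrow> cov_lag \<pi> Q g f h"
    and gg: "\<And>h. (\<lambda>M. sample_cov M (\<lambda>t. g (xs t)) (\<lambda>t. g (xs t)) h) \<longlonglongrightarrow> cov_lag \<pi> Q g g h"
  defines "\<Gamma> \<equiv> cov_lag \<pi> Q (\<lambda>x. u0 * f x + v0 * g x) (\<lambda>x. u0 * f x + v0 * g x)"
  shows "(\<lambda>M. l1dist (proj \<delta> (sample_acov M (\<lambda>t. u M * f (xs t) + v M * g (xs t)))) (int_seq \<Gamma>)) \<longlonglongrightarrow> 0"
    and "l1dist (int_seq \<Gamma>) (\<lambda>_. 0) < \<infinity>"
proof -
  let ?r = "\<lambda>M. sample_acov M (\<lambda>t. u M * f (xs t) + v M * g (xs t))"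
  have cone: "moment_cone (1 - \<delta>) \<Gamma>"
    unfolding \<Gamma>_def using \<delta> by (intro cov_lag_combination_cone f g cf cg) auto
  then show "l1dist (int_seq \<Gamma>) (\<lambda>_. 0) < \<infinity>"
    using \<delta> by (intro moment_cone_l1_finite) auto
  show "(\<lambda>M. l1dist (proj \<delta> (?r M)) (int_seq \<Gamma>)) \<longlonglongrightarrow> 0"
  proof (rule proj_l1_tendsto[OF \<delta> cone])
    fix M
    have "{k. ?r M k \<noteq> 0} \<subseteq> {- int M..int M}"
      by (auto simp: sample_acov_def Let_def split: if_splits)
    then have "finite {k. ?r M k \<noteq> 0}" by (rule finite_subset) simp
    then show "sqdist (?r M) (\<lambda>_. 0) < \<infinity>" by (rule sqdist_zero_finite)
    show "\<bar>?r M k\<bar> \<le> ?r M 0" for k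
      using abs_sample_cov_le by (simp add: sample_acov_eq)
  next
    fix k :: int
    let ?h = "nat \<bar>k\<bar>"
    have "(\<lambda>M. ?r M k) \<longlonglongrightarrow> u0\<^sup>2 * cov_lag \<pi> Q f f ?h + u0 * v0 * (cov_lag \<pi> Q f g ?h + cov_lag \<pi> Q g f ?h)
        + v0\<^sup>2 * cov_lag \<pi> Q g g ?h"
      unfolding sample_acov_eq sample_cov_combination by (intro tendsto_intros u v ff fg gf gg)
    then show "(\<lambda>M. ?r M k) \<longlonglongrightarrow> int_seq \<Gamma> k"
      using cov_lag_commute[OF g f] unfolding \<Gamma>_def cov_lag_combination[OF f g] by (simp add: algebra_simps)
  qed
qed

lemma hat_gamma_l1_tendsto:
  assumes L2: "\<And>i. i \<in> I \<Longrightarrow> pow.L2 (g i)"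
    and \<delta>: "\<And>i. i \<in> I \<Longrightarrow> 0 < \<delta> i \<and> \<delta> i \<le> spec_gap (spectral_measure (acov \<pi> Q (g i) (g i)))"
    and w: "\<And>i. i \<in> I \<Longrightarrow> (\<lambda>M. w M i) \<longlonglongrightarrow> wlim i" and nz: "\<And>i. i \<in> I \<Longrightarrow> wlim i \<noteq> 0"
    and cov: "\<And>i j h. i \<in> I \<Longrightarrow> j \<in> I \<Longrightarrow>
      (\<lambda>M. sample_cov M (\<lambda>t. g i (xs t)) (\<lambda>t. g j (xs t)) h) \<longlonglongrightarrow> cov_lag \<pi> Q (g i) (g j) h"
    and i: "i \<in> I" and j: "j \<in> I"
  shows "(\<lambda>M. l1dist (hat_gamma \<delta> g M (w M) xs i j) (acov \<pi> Q (g i) (g j))) \<longlonglongrightarrow> 0"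
    and "l1dist (acov \<pi> Q (g i) (g j)) (\<lambda>_. 0) < \<infinity>"
proof -
  have \<delta>1: "\<delta> i \<le> 1" and cone: "moment_cone (1 - \<delta> i) (cov_lag \<pi> Q (g i) (g i))" if "i \<in> I" for i
    using cov_lag_cone[OF L2[OF that]] \<delta>[OF that] by auto
  have "(\<lambda>M. l1dist (hat_gamma \<delta> g M (w M) xs i j) (acov \<pi> Q (g i) (g j))) \<longlonglongrightarrow> 0 \<and>
    l1dist (acov \<pi> Q (g i) (g j)) (\<lambda>_. 0) < \<infinity>"
  proof (cases "i = j")
    case True
    \<comment> \<open>The diagonal case is treated as the combination with constant weights 1 and 0,
      so that the same lemma covers it.\<close>
    have acov: "acov \<pi> Q (g i) (g j) = int_seq (cov_lag \<pi> Q (\<lambda>x. 1 * g i x + 0 * g i x) (\<lambda>x. 1 * g i x + 0 * g i x))"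
      using True L2[OF i] by (simp add: fun_eq_iff acov_eq_cov_lag)
    have "hat_gamma \<delta> g M (w M) xs i j = proj (\<delta> i) (sample_acov M (\<lambda>t. 1 * g i (xs t) + 0 * g i (xs t)))" for M
      using True by (simp add: hat_gamma_def)
    then show ?thesis
      unfolding acov using proj_sample_acov_tendsto[OF L2[OF i] L2[OF i] _ \<delta>1[OF i] cone[OF i] cone[OF i]
        tendsto_const tendsto_const cov[OF i i] cov[OF i i] cov[OF i i] cov[OF i i], of 1 0] \<delta>[OF i] by simp
  next
    case False
    define a where "a = min i j"
    define b where "b = max i j"
    have a: "a \<in> I" and b: "b \<in> I" using i j by (auto simp: a_def b_def min_def max_def)
    \<comment> \<open>The smaller \<delta> belongs to the larger interval, which contains both
      spectral measures and hence that of each combination.\<close>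
    define dl where "dl = min (\<delta> a) (\<delta> b)"
    have dl: "0 < dl" "dl \<le> 1" using \<delta>[OF a] \<delta>[OF b] \<delta>1[OF a] by (auto simp: dl_def)
    have ca: "moment_cone (1 - dl) (cov_lag \<pi> Q (g a) (g a))" and cb: "moment_cone (1 - dl) (cov_lag \<pi> Q (g b) (g b))"
      using \<delta>1[OF a] \<delta>1[OF b] by (auto simp: dl_def intro: moment_cone_mono[OF cone[OF a]] moment_cone_mono[OF cone[OF b]])
    \<comment> \<open>The sign \<open>s\<close> takes the values 1 and -1 of the polarisation
      identity, handled at once.\<close>
    let ?G = "\<lambda>s. cov_lag \<pi> Q (\<lambda>x. wlim a * g a x + s * wlim b * g b x) (\<lambda>x. wlim a * g a x + s * wlim b * g b x)"
    let ?P = "\<lambda>s M. proj dl (sample_acov M (\<lambda>t. w M a * g a (xs t) + s * w M b * g b (xs t)))"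
    have P: "(\<lambda>M. l1dist (?P s M) (int_seq (?G s))) \<longlonglongrightarrow> 0" "l1dist (int_seq (?G s)) (\<lambda>_. 0) < \<infinity>" for s
      by (rule proj_sample_acov_tendsto[OF L2[OF a] L2[OF b] dl ca cb w[OF a] tendsto_mult[OF tendsto_const w[OF b]]
        cov[OF a a] cov[OF a b] cov[OF b a] cov[OF b b]])+
    have c: "(\<lambda>M. 4 * w M a * w M b) \<longlonglongrightarrow> 4 * wlim a * wlim b"
      by (intro tendsto_mult tendsto_const w a b)
    have c0: "4 * wlim a * wlim b \<noteq> 0" using nz[OF a] nz[OF b] by simp
    have acov: "acov \<pi> Q (g i) (g j) = (\<lambda>k. (int_seq (?G 1) k - int_seq (?G (- 1)) k) / (4 * wlim a * wlim b))"
    proof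
      fix k
      have "cov_lag \<pi> Q (g i) (g j) h = cov_lag \<pi> Q (g a) (g b) h" for h
        using cov_lag_commute[OF L2[OF i] L2[OF j], of h] by (auto simp: a_def b_def min_def max_def)
      then show "acov \<pi> Q (g i) (g j) k = (int_seq (?G 1) k - int_seq (?G (- 1)) k) / (4 * wlim a * wlim b)"
        using c0 L2 i j unfolding cov_lag_combination[OF L2[OF a] L2[OF b]]
        by (simp add: acov_eq_cov_lag field_simps)
    qed
    have lim: "(\<lambda>M. l1dist (\<lambda>k. (?P 1 M k - ?P (- 1) M k) / (4 * w M a * w M b)) (acov \<pi> Q (g i) (g j))) \<longlonglongrightarrow> 0"
      unfolding acov by (rule l1dist_scaled_difference[OF P(1) P(1) P(2) P(2) c c0])
    have hat: "hat_gamma \<delta> g M (w M) xs i j = (\<lambda>k. (?P 1 M k - ?P (- 1) M k) / (4 * w M a * w M b))"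
      if "4 * w M a * w M b \<noteq> 0" for M
      using False that by (simp add: hat_gamma_def Let_def a_def[symmetric] b_def[symmetric] dl_def[symmetric])
    \<comment> \<open>The default value 0 of \<open>hat_gamma\<close> for vanishing weights can
      occur for finitely many \<open>M\<close> only, because the limit weights are nonzero.\<close>
    have "\<forall>\<^sub>F M in sequentially. 4 * w M a * w M b \<noteq> 0"
      using c c0 by (rule tendsto_imp_eventually_ne)
    then have "\<forall>\<^sub>F M in sequentially. l1dist (\<lambda>k. (?P 1 M k - ?P (- 1) M k) / (4 * w M a * w M b)) (acov \<pi> Q (g i) (g j)) =
        l1dist (hat_gamma \<delta> g M (w M) xs i j) (acov \<pi> Q (g i) (g j))"
      by eventually_elim (simp add: hat)
    moreover have "l1dist (acov \<pi> Q (g i) (g j)) (\<lambda>_. 0) < \<infinity>"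
    proof -
      have "l1dist (\<lambda>k. (int_seq (?G 1) k - int_seq (?G (- 1)) k) / (4 * wlim a * wlim b)) (\<lambda>_. 0) \<le>
          ennreal \<bar>1 / (4 * wlim a * wlim b)\<bar> * (l1dist (int_seq (?G 1)) (\<lambda>_. 0) + l1dist (int_seq (?G (- 1))) (\<lambda>_. 0))"
        by (rule l1dist_scaled_difference_le)
      also have "\<dots> < \<infinity>" using P(2)[of 1] P(2)[of "- 1"] by (simp add: ennreal_mult_less_top)
      finally show ?thesis unfolding acov .
    qed
    ultimately show ?thesis by (intro conjI Lim_transform_eventually[OF lim])
  qed
  then show "(\<lambda>M. l1dist (hat_gamma \<delta> g M (w M) xs i j) (acov \<pi> Q (g i) (g j))) \<longlonglongrightarrow> 0"
    "l1dist (acov \<pi> Q (g i) (g j)) (\<lambda>_. 0) < \<infinity>" by blast+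
qed

end

section \<open>From total variation to setwise convergence, and the conclusion\<close>

lemma abs_measure_diff_le_tv_dist:
  assumes "prob_space \<mu>" "prob_space \<nu>" "A \<in> sets borel"
  shows "\<bar>measure \<mu> A - measure \<nu> A\<bar> \<le> tv_dist \<mu> \<nu>"
proof -
  have "\<bar>measure \<mu> B - measure \<nu> B\<bar> \<le> 1" for B
    using prob_space.prob_le_1[OF assms(1), of B] prob_space.prob_le_1[OF assms(2), of B]
      measure_nonneg[of \<mu> B] measure_nonneg[of \<nu> B] by linarith
  then have "bdd_above ((\<lambda>A. \<bar>measure \<mu> A - measure \<nu> A\<bar>) ` sets borel)" by (intro bdd_aboveI[of _ 1]) auto
  then show ?thesis unfolding tv_dist_def using assms(3) by (intro cSUP_upper)
qed

lemma setwise_tendsto_of_geometric_tv: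
  assumes \<mu>: "\<And>n. prob_space (\<mu> n)" and \<nu>: "prob_space \<nu>" and A: "A \<in> sets borel"
    and tv: "\<And>n. tv_dist (\<mu> n) \<nu> \<le> C * \<rho> ^ n" and \<rho>: "\<rho> < 1" and C: "0 \<le> C"
  shows "(\<lambda>n. measure (\<mu> n) A) \<longlonglongrightarrow> measure \<nu> A"
proof -
  have le: "\<bar>measure (\<mu> n) A - measure \<nu> A\<bar> \<le> C * \<rho> ^ n" for n
    using abs_measure_diff_le_tv_dist[OF \<mu> \<nu> A] tv by (rule order_trans)
  have "(\<lambda>n. C * \<rho> ^ n) \<longlonglongrightarrow> 0"
  proof (cases "0 \<le> \<rho>")
    case True
    then have "(\<lambda>n. C * \<rho> ^ n) \<longlonglongrightarrow> C * 0"
      using \<rho> by (intro tendsto_mult tendsto_const LIMSEQ_power_zero) auto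
    then show ?thesis by simp
  next
    case False
    \<comment> \<open>The rate may be negative, even below -1. The bound at \<open>n = 1\<close>
      then forces \<open>C\<close> to vanish.\<close>
    have "0 \<le> C * \<rho>" using order_trans[OF abs_ge_zero le[of 1]] by simp
    with False C have "C = 0" by (simp add: zero_le_mult_iff)
    then show ?thesis by simp
  qed
  then have "(\<lambda>n. measure (\<mu> n) A - measure \<nu> A) \<longlonglongrightarrow> 0"
    by (rule Lim_null_comparison[rotated]) (use le in simp)
  then show ?thesis by (rule LIM_zero_cancel)
qed

theorem theorem2:
  fixes Q :: "'a::polish_space \<Rightarrow> 'a measure"
    and \<pi> :: "'a measure"
    and Px :: "'a \<Rightarrow> 'b measure"
    and X :: "nat \<Rightarrow> 'b \<Rightarrow> 'a"
    and d :: nat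
    and g :: "nat \<Rightarrow> 'a \<Rightarrow> real"
    and w :: "nat \<Rightarrow> 'b \<Rightarrow> nat \<Rightarrow> real"
    and wlim :: "nat \<Rightarrow> real"
    and \<delta> :: "nat \<Rightarrow> real"
  assumes kernel: "markov_kernel Q"
    and pi: "prob_space \<pi>" "sets \<pi> = sets borel"
    and chain: "markov_chain_law Q Px X"
    and A1: "psi_irreducible Q" "aperiodic Q" "positive_harris Q Px X"
    and A2: "reversible Q \<pi>"
    and A3: "\<exists>\<rho> < 1. \<exists>Mf :: 'a \<Rightarrow> real. (\<forall>x. Mf x \<ge> 0) \<and>
               (\<forall>x n. tv_dist (kernel_pow Q n x) \<pi> \<le> Mf x * \<rho> ^ n)"
    and B1: "\<forall>i \<in> {1..d}. g i \<in> borel_measurable borel \<and> integrable \<pi> (\<lambda>x. (g i x)\<^sup>2)"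
    and w_rv: "\<forall>x M. \<forall>i \<in> {1..d}. (\<lambda>\<omega>. w M \<omega> i) \<in> borel_measurable (Px x)"
    and w_conv: "\<forall>x. AE \<omega> in Px x. \<forall>i \<in> {1..d}. (\<lambda>M. w M \<omega> i) \<longlonglongrightarrow> wlim i"
    and wlim_nz: "\<forall>i \<in> {1..d}. wlim i \<noteq> 0"
    and delta: "\<forall>i \<in> {1..d}. 0 < \<delta> i \<and> \<delta> i \<le> spec_gap (spectral_measure (acov \<pi> Q (g i) (g i)))"
  shows "\<forall>i \<in> {1..d}. \<forall>j \<in> {1..d}. \<forall>x. AE \<omega> in Px x.
           ((\<lambda>M. sqdist (hat_gamma \<delta> g M (w M \<omega>) (\<lambda>t. X t \<omega>) i j) (acov \<pi> Q (g i) (g j)))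
              \<longlonglongrightarrow> 0)
         \<and> (acov \<pi> Q (g i) (g j)) summable_on UNIV
         \<and> (\<forall>\<^sub>F M in sequentially. (hat_gamma \<delta> g M (w M \<omega>) (\<lambda>t. X t \<omega>) i j) summable_on UNIV)
         \<and> ((\<lambda>M. \<bar>(\<Sum>\<^sub>\<infinity>k. hat_gamma \<delta> g M (w M \<omega>) (\<lambda>t. X t \<omega>) i j k)
                   - (\<Sum>\<^sub>\<infinity>k. acov \<pi> Q (g i) (g j) k)\<bar>) \<longlonglongrightarrow> 0)"
proof -
  interpret k: transition_kernel Q by (rule transition_kernel.intro[OF kernel])
  obtain \<rho> and Mf :: "'a \<Rightarrow> real" where \<rho>: "\<rho> < 1" and Mf: "\<And>x. 0 \<le> Mf x"
    and tv: "\<And>x n. tv_dist (kernel_pow Q n x) \<pi> \<le> Mf x * \<rho> ^ n"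
    using A3 by blast
  interpret stationary_reversible_markov Q Px X \<pi>
  proof (intro stationary_reversible_markov.intro stationary_reversible_markov_axioms.intro markov.intro
      markov_axioms.intro reversible_chain.intro reversible_chain_axioms.intro transition_kernel.intro kernel chain pi A2)
    show "(\<lambda>n. measure (kernel_pow Q n x) A) \<longlonglongrightarrow> measure \<pi> A" if "A \<in> sets borel" for x A
      using k.prob_space_kernel_pow pi(1) that tv \<rho> Mf by (rule setwise_tendsto_of_geometric_tv)
  qed
  have L2: "pow.L2 (g i)" if "i \<in> {1..d}" for i using B1 that by (simp add: pow.L2_def)
  show ?thesis
  proof (intro ballI allI)
    fix i j x assume i: "i \<in> {1..d}" and j: "j \<in> {1..d}"
    \<comment> \<open>One null set for all pairs of indices and all lags; outside it, and where the
      weights converge, the remaining argument is deterministic.\<close>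
    have "AE \<omega> in Px x. \<forall>i\<in>{1..d}. \<forall>j\<in>{1..d}. \<forall>h.
        (\<lambda>M. sample_cov M (\<lambda>t. g i (X t \<omega>)) (\<lambda>t. g j (X t \<omega>)) h) \<longlonglongrightarrow> cov_lag \<pi> Q (g i) (g j) h"
      by (intro AE_finite_allI AE_sample_cov L2) auto
    then show "AE \<omega> in Px x.
           ((\<lambda>M. sqdist (hat_gamma \<delta> g M (w M \<omega>) (\<lambda>t. X t \<omega>) i j) (acov \<pi> Q (g i) (g j)))
              \<longlonglongrightarrow> 0)
         \<and> (acov \<pi> Q (g i) (g j)) summable_on UNIV
         \<and> (\<forall>\<^sub>F M in sequentially. (hat_gamma \<delta> g M (w M \<omega>) (\<lambda>t. X t \<omega>) i j) summable_on UNIV)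
         \<and> ((\<lambda>M. \<bar>(\<Sum>\<^sub>\<infinity>k. hat_gamma \<delta> g M (w M \<omega>) (\<lambda>t. X t \<omega>) i j k)
                   - (\<Sum>\<^sub>\<infinity>k. acov \<pi> Q (g i) (g j) k)\<bar>) \<longlonglongrightarrow> 0)"
      using w_conv[rule_format, of x]
    proof eventually_elim
      case (elim \<omega>)
      have cov: "(\<lambda>M. sample_cov M (\<lambda>t. g i (X t \<omega>)) (\<lambda>t. g j (X t \<omega>)) h) \<longlonglongrightarrow> cov_lag \<pi> Q (g i) (g j) h"
        if "i \<in> {1..d}" "j \<in> {1..d}" for i j h using elim(1) that by blast
      have w: "(\<lambda>M. w M \<omega> i) \<longlonglongrightarrow> wlim i" if "i \<in> {1..d}" for i using elim(2) that by blast
      have hat: "(\<lambda>M. l1dist (hat_gamma \<delta> g M (w M \<omega>) (\<lambda>t. X t \<omega>) i j) (acov \<pi> Q (g i) (g j))) \<longlonglongrightarrow> 0"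
        "l1dist (acov \<pi> Q (g i) (g j)) (\<lambda>_. 0) < \<infinity>"
        by (rule hat_gamma_l1_tendsto[where I="{1..d}" and \<delta>=\<delta> and w="\<lambda>M. w M \<omega>" and wlim=wlim and xs="\<lambda>t. X t \<omega>"];
            use L2 delta w wlim_nz cov i j in blast)+
      show ?case using l1_convergence_consequences[OF hat] by blast
    qed
  qed
qed

end
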